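(* For every prime $p$ there exists a positive integer $n\le p^{3/4+o(1)}$ with $\gcd(n,p)=1$ such that $q_p(n)$ is a primitive root modulo $p$, where $o(1)$ denotes a quantity that tends to $0$ as $p\to\infty$.
   Context: For a prime $p$ and an integer $u$ with $\gcd(u,p)=1$, the Fermat quotient $q_p(u)$ is the unique integer with $q_p(u)\equiv \frac{u^{p-1}-1}{p}\pmod p$ and $0\le q_p(u)\le p-1$. *)

theory Defs
  imports Complex_Main "HOL-Number_Theory.Number_Theory"
begin

text \<open>
  The specification determines a unique value when \<open>p\<close> is prime and \<open>u\<close> is coprime to \<open>p\<close>
  (see \<open>fermat_quotient_ex1\<close> below), and then \<open>div\<close> is an exact division by Fermat's little
  theorem (see \<open>fermat_quotient_div_exact\<close>). Other arguments are irrelevant.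
\<close>

definition fermat_quotient :: "nat \<Rightarrow> int \<Rightarrow> int" where
  "fermat_quotient p u =
     (THE q. [q = (u ^ (p - 1) - 1) div int p] (mod int p) \<and> 0 \<le> q \<and> q \<le> int p - 1)"

lemma fermat_quotient_div_exact:
  assumes "prime p" "coprime u (int p)"
  shows "int p dvd u ^ (p - 1) - 1"
proof -
  interpret residues_prime p "residue_ring (int p)"
    using assms(1) by unfold_locales simp_all
  have "\<not> int p dvd u"
    using assms by (metis coprime_absorb_right not_prime_unit prime_nat_int_transfer)
  moreover have "[nat (u mod int p) ^ (p - 1) = 1] (mod p)"
    if "\<not> p dvd nat (u mod int p)"
    using fermat_theorem assms(1) that by blast
  moreover have "p dvd nat (u mod int p) \<longleftrightarrow> int p dvd u"
    using assms(1) by (metis dvd_mod_iff dvd_refl int_dvd_int_iff int_nat_eq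
        pos_mod_sign of_nat_0_less_iff prime_gt_0_nat)
  ultimately have "[int (nat (u mod int p) ^ (p - 1)) = int 1] (mod int p)"
    by (simp only: cong_int_iff) simp
  hence "[(u mod int p) ^ (p - 1) = 1] (mod int p)"
    using assms(1) by (simp add: prime_gt_0_nat)
  hence "[u ^ (p - 1) = 1] (mod int p)"
    by (simp add: cong_def power_mod)
  thus ?thesis
    by (simp add: cong_iff_dvd_diff)
qed

lemma fermat_quotient_ex1:
  assumes "p > 0"
  shows "\<exists>!q. [q = (u ^ (p - 1) - 1) div int p] (mod int p) \<and> 0 \<le> q \<and> q \<le> int p - 1"
proof (rule ex1I)
  let ?a = "(u ^ (p - 1) - 1) div int p"
  show "[?a mod int p = ?a] (mod int p) \<and> 0 \<le> ?a mod int p \<and> ?a mod int p \<le> int p - 1"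
    using assms by simp
  fix q assume "[q = ?a] (mod int p) \<and> 0 \<le> q \<and> q \<le> int p - 1"
  thus "q = ?a mod int p"
    by (auto simp: cong_def)
qed

end

theory Submission
  imports "HOL-Real_Asymp.Real_Asymp" "Berlekamp_Zassenhaus.Finite_Field" Defs
begin

text \<open>
  The Fermat quotient \<open>q\<close> turns products into sums. So it is enough to find a primitive root in \<open>A + B\<close> where
  \<open>B\<close> and \<open>A\<close> are the values of \<open>q\<close> at primes up to \<open>p powr (3/4 + \<epsilon>)\<close> and up to a tiny power of \<open>p\<close>.
  Ratios of distinct primes below \<open>p\<close> are distinct modulo \<open>p^2\<close>, and the kernel of \<open>q\<close> modulo \<open>p^2\<close> has \<open>p - 1\<close>
  elements; this gives \<open>card B \<ge> p powr (1/2 + \<epsilon>)\<close>. A similar argument with products of \<open>s\<close> primes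
  gives \<open>card A \<ge> p powr (1/(2*s))\<close>.

  For such sets Karatsuba's bilinear argument applies. It needs square-root cancellation for the joint
  distribution of \<open>x + a\<close>, \<open>a \<in> T\<close>, among the cosets of the \<open>d\<close>-th powers, with \<open>T\<close> of bounded size. Instead of
  Weil's theorem we use Stepanov's method directly over the prime field, with an error that is polynomial in \<open>d\<close>.
  This loss is harmless for \<open>d\<close> a tiny power of \<open>p\<close>, which covers the product of the
  prime divisors of \<open>p - 1\<close> up to \<open>c ln p\<close>, alone or times one more prime of moderate size. For a large prime
  divisor \<open>l\<close> of \<open>p - 1\<close>, Stepanov's method bounds \<open>k\<close>-fold intersections of shifts of the
  \<open>l\<close>-th powers by \<open>O(sqrt p)\<close> as soon as \<open>l^k \<ge> p\<close>, which is enough since there only an upper bound is needed.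

  The nonvanishing of Stepanov's auxiliary polynomial rests on a bound for the multiplicity of the roots of
  sums of polynomials times powers of linear factors, proved by the Wronskian principle that
  a linear differential equation of order less than \<open>n\<close> has fewer than \<open>n\<close> independent solutions.
\<close>

section \<open>Linear differential equations over polynomials\<close>

text \<open>The exponent 3/4 is forced by the size of \<open>B\<close>: Cauchy-Schwarz gives about
  N^2/p Fermat quotients of primes up to N, and more than p^(1/2) are needed. That 1/2 comes from
  the moments: once \<open>p \<le> card A ^ (2 * r)\<close>, both the diagonal term
  \<open>card A ^ r * p\<close> and the correlation terms of the 2r-th moment are at most
  \<open>card A ^ (2 * r) * sqrt p\<close> times a tiny power of p. Hence fewer than
  \<open>card B\<close> shifts b are exceptional, and a sieve over the prime divisors of
  \<open>p - 1\<close> finds a suitable a for any other b. The obstacle is that equidistribution is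
  available only for moduli up to a tiny power of p, which rules out full inclusion-exclusion.
  Instead, the a for which the discrete logarithm of b + a is coprime to the small primes are
  counted asymptotically, and those hit by the remaining primes are subtracted by a union bound. The
  medium primes exceed a multiple of ln p and are few, so the sum of their reciprocals is small and
  they remove about half at most; each large prime hits only a tiny proportion of
  \<open>A\<close>.\<close>

text \<open>Stated over a domain because it is applied both to scalars and to polynomial
  coefficients; elimination therefore cross-multiplies with the pivot \<open>v q e\<close> instead
  of dividing by it.\<close>

lemma nontrivial_solution:
  fixes v :: "'e \<Rightarrow> 'i \<Rightarrow> 'a::idom"
  assumes "finite Eq" "finite I" "card Eq < card I"
  shows "\<exists>c. (\<exists>i\<in>I. c i \<noteq> 0) \<and> (\<forall>q\<in>Eq. (\<Sum>i\<in>I. c i * v q i) = 0)"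
  using assms
proof (induction Eq arbitrary: I v rule: finite_induct)
  case empty
  then obtain i where "i \<in> I" by fastforce
  then show ?case by (intro exI[of _ "\<lambda>_. 1"]) auto
next
  case (insert q Eq)
  show ?case
  proof (cases "\<forall>i\<in>I. v q i = 0")
    case True
    obtain c where "\<exists>i\<in>I. c i \<noteq> 0" "\<forall>q\<in>Eq. (\<Sum>i\<in>I. c i * v q i) = 0"
      using insert.IH[of I v] insert.prems insert.hyps by auto
    with True show ?thesis by (intro exI[of _ c]) auto
  next
    case False
    then obtain e where e: "e \<in> I" "v q e \<noteq> 0" by blast
    define J where "J = I - {e}"
    define v' where "v' = (\<lambda>r i. v q e * v r i - v q i * v r e)"
    have J: "finite J" "I = insert e J" "e \<notin> J" using e insert.prems by (auto simp: J_def)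
    have "card Eq < card J" using insert.prems insert.hyps J by simp
    then obtain c' where c': "\<exists>i\<in>J. c' i \<noteq> 0" "\<And>r. r \<in> Eq \<Longrightarrow> (\<Sum>i\<in>J. c' i * v' r i) = 0"
      using insert.IH[of J v'] J by auto
    define c where "c = (\<lambda>i. if i = e then - (\<Sum>i\<in>J. c' i * v q i) else v q e * c' i)"
    have *: "(\<Sum>i\<in>I. c i * v r i) = (\<Sum>i\<in>J. c' i * v' r i)" for r
    proof -
      have "(\<Sum>i\<in>I. c i * v r i) = c e * v r e + (\<Sum>i\<in>J. c i * v r i)"
        using J by simp
      also have "(\<Sum>i\<in>J. c i * v r i) = (\<Sum>i\<in>J. v q e * c' i * v r i)"
        using J by (intro sum.cong) (auto simp: c_def)
      also have "c e * v r e = (\<Sum>i\<in>J. - (c' i * v q i * v r e))"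
        by (simp add: c_def sum_distrib_right sum_negf)
      finally show ?thesis
        by (simp add: v'_def algebra_simps flip: sum.distrib)
    qed
    have "(\<Sum>i\<in>J. c' i * v' q i) = 0" by (simp add: v'_def mult_ac)
    moreover obtain i where "i \<in> J" "c' i \<noteq> 0" using c' by blast
    hence "i \<in> I" "c i \<noteq> 0" using J e by (auto simp: c_def)
    ultimately show ?thesis using * c'(2) by (intro exI[of _ c]) auto
  qed
qed

lemma higher_pderiv_add: "(pderiv ^^ i) (f + g) = (pderiv ^^ i) f + (pderiv ^^ i) g"
  for f g :: "'a::idom poly"
  by (induction i) (auto simp: pderiv_add)

lemma higher_pderiv_0 [simp]: "(pderiv ^^ i) 0 = (0 :: 'a::idom poly)"
  by (induction i) auto

lemma higher_pderiv_sum: "(pderiv ^^ i) (\<Sum>e\<in>I. f e) = (\<Sum>e\<in>I. (pderiv ^^ i) (f e))"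
  for f :: "'i \<Rightarrow> 'a::idom poly"
  by (induction I rule: infinite_finite_induct) (auto simp: higher_pderiv_add)

lemma higher_pderiv_const_mult:
  fixes c f :: "'a::idom poly"
  assumes "pderiv c = 0"
  shows "(pderiv ^^ i) (c * f) = c * (pderiv ^^ i) f"
  by (induction i) (auto simp: pderiv_mult assms)

lemma pderiv_sum': "pderiv (\<Sum>e\<in>I. f e) = (\<Sum>e\<in>I. pderiv (f e))"
  for f :: "'i \<Rightarrow> 'a::idom poly"
  using higher_pderiv_sum[of 1 f I] by simp

text \<open>Let \<open>r\<close> be the order of a nonzero equation. The vectors of the first
  \<open>r\<close> derivatives of the more than \<open>r\<close> solutions are linearly dependent
  over the polynomials, and the equation extends such a dependence to the \<open>r\<close>-th
  derivative. So differentiating the coefficients of a dependence gives another one. A dependence of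
  minimal support is then proportional to its derivative, and the ratios of its coefficients are
  constants of the derivation.\<close>

lemma ode_independent_solutions:
  fixes f :: "'i \<Rightarrow> 'a::field poly" and q :: "nat \<Rightarrow> 'a poly"
  assumes char: "prime CHAR('a)" and fin: "finite I"
    and indep: "\<And>\<gamma>. (\<And>e. e \<in> I \<Longrightarrow> pderiv (\<gamma> e) = 0) \<Longrightarrow> (\<Sum>e\<in>I. \<gamma> e * f e) = 0 \<Longrightarrow> \<forall>e\<in>I. \<gamma> e = 0"
    and q: "\<And>e. e \<in> I \<Longrightarrow> (\<Sum>i<card I. q i * (pderiv ^^ i) (f e)) = 0"
  shows "\<forall>i<card I. q i = 0"
proof (rule ccontr)
  assume asm: "\<not> ?thesis"
  define r where "r = Max {i. i < card I \<and> q i \<noteq> 0}"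
  have "r \<in> {i. i < card I \<and> q i \<noteq> 0}"
    unfolding r_def using asm by (intro Max_in) auto
  hence r: "r < card I" "q r \<noteq> 0" by auto
  have r_max: "q i = 0" if "i < card I" "i > r" for i
  proof (rule ccontr)
    assume "q i \<noteq> 0"
    hence "i \<le> r" unfolding r_def using that by (intro Max_ge) auto
    thus False using that by simp
  qed
  have q': "(\<Sum>i<r. q i * (pderiv ^^ i) (f e)) + q r * (pderiv ^^ r) (f e) = 0" if "e \<in> I" for e
  proof -
    have "(\<Sum>i<card I. q i * (pderiv ^^ i) (f e)) = (\<Sum>i\<in>{..<Suc r}. q i * (pderiv ^^ i) (f e))"
      using r r_max by (intro sum.mono_neutral_right) (auto simp: not_less_eq)
    thus ?thesis using q[OF that] by simp
  qed
  define sol where "sol = (\<lambda>c. \<forall>i<r. (\<Sum>e\<in>I. c e * (pderiv ^^ i) (f e)) = 0)"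
  define supp where "supp = (\<lambda>c::'i \<Rightarrow> 'a poly. {e\<in>I. c e \<noteq> 0})"
  have sol_r: "(\<Sum>e\<in>I. c e * (pderiv ^^ i) (f e)) = 0" if "sol c" "i \<le> r" for c i
  proof (cases "i < r")
    case False
    have "q r * (\<Sum>e\<in>I. c e * (pderiv ^^ r) (f e)) = (\<Sum>e\<in>I. c e * (q r * (pderiv ^^ r) (f e)))"
      by (simp add: sum_distrib_left mult_ac)
    also have "\<dots> = (\<Sum>e\<in>I. c e * (- (\<Sum>i<r. q i * (pderiv ^^ i) (f e))))"
      using q' by (intro sum.cong refl arg_cong2[of _ _ _ _ "(*)"]) (simp add: eq_neg_iff_add_eq_0 add.commute)
    also have "\<dots> = - (\<Sum>e\<in>I. \<Sum>i<r. q i * (c e * (pderiv ^^ i) (f e)))"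
      by (simp add: sum_distrib_left sum_negf mult_ac)
    also have "\<dots> = - (\<Sum>i<r. q i * (\<Sum>e\<in>I. c e * (pderiv ^^ i) (f e)))"
      by (subst sum.swap) (simp add: sum_distrib_left)
    also have "\<dots> = 0" using that by (simp add: sol_def)
    finally show ?thesis using r False that by (auto simp: not_less)
  qed (use that in \<open>auto simp: sol_def\<close>)
  have "\<exists>c. (\<exists>e\<in>I. c e \<noteq> 0) \<and> (\<forall>i\<in>{..<r}. (\<Sum>e\<in>I. c e * (pderiv ^^ i) (f e)) = 0)"
    using r fin by (intro nontrivial_solution) auto
  hence "\<exists>c. sol c \<and> supp c \<noteq> {}" by (auto simp: sol_def supp_def)
  then obtain c where c: "sol c" "supp c \<noteq> {}"
    and min: "\<And>c'. sol c' \<Longrightarrow> supp c' \<noteq> {} \<Longrightarrow> card (supp c) \<le> card (supp c')"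
    using arg_min_nat_lemma[of "\<lambda>c. sol c \<and> supp c \<noteq> {}" _ "\<lambda>c. card (supp c)"] by blast
  from c obtain e0 where e0: "e0 \<in> I" "c e0 \<noteq> 0" by (auto simp: supp_def)
  have sol': "sol (\<lambda>e. pderiv (c e))"
    unfolding sol_def
  proof (intro allI impI)
    fix i assume i: "i < r"
    have "0 = pderiv (\<Sum>e\<in>I. c e * (pderiv ^^ i) (f e))"
      using sol_r[OF c(1), of i] i by simp
    also have "\<dots> = (\<Sum>e\<in>I. c e * (pderiv ^^ Suc i) (f e)) + (\<Sum>e\<in>I. pderiv (c e) * (pderiv ^^ i) (f e))"
      by (simp add: pderiv_sum' pderiv_mult sum.distrib mult_ac)
    also have "(\<Sum>e\<in>I. c e * (pderiv ^^ Suc i) (f e)) = 0"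
      using sol_r[OF c(1), of "Suc i"] i by simp
    finally show "(\<Sum>e\<in>I. pderiv (c e) * (pderiv ^^ i) (f e)) = 0" by simp
  qed
  \<comment> \<open>Numerator of the derivative of \<open>c e / c e0\<close>. It vanishes at
    \<open>e0\<close>, so minimality of the support of \<open>c\<close> forces it to vanish on all
    of \<open>I\<close>.\<close>
  define c' where "c' = (\<lambda>e. c e0 * pderiv (c e) - pderiv (c e0) * c e)"
  have "sol c'"
    unfolding sol_def
  proof (intro allI impI)
    fix i assume "i < r"
    have "(\<Sum>e\<in>I. c' e * (pderiv ^^ i) (f e)) = c e0 * (\<Sum>e\<in>I. pderiv (c e) * (pderiv ^^ i) (f e))
        - pderiv (c e0) * (\<Sum>e\<in>I. c e * (pderiv ^^ i) (f e))"
      by (simp add: c'_def sum_distrib_left algebra_simps flip: sum_subtractf)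
    also have "\<dots> = 0"
      using c(1) sol' \<open>i < r\<close> by (simp add: sol_def)
    finally show "(\<Sum>e\<in>I. c' e * (pderiv ^^ i) (f e)) = 0" .
  qed
  have "supp c' \<subset> supp c"
    using e0 by (auto simp: supp_def c'_def mult_ac)
  hence "card (supp c') < card (supp c)"
    using fin by (intro psubset_card_mono) (auto simp: supp_def)
  with min[OF \<open>sol c'\<close>] have c'0: "c' e = 0" if "e \<in> I" for e
    using that by (force simp: supp_def)
  \<comment> \<open>Stands for the quotient \<open>c e / c e0\<close>: the two differ by the factor
    \<open>c e0 ^ CHAR('a)\<close>, whose derivative is zero.\<close>
  define \<gamma> where "\<gamma> = (\<lambda>e. c e * c e0 ^ (CHAR('a) - 1))"
  have "pderiv (\<gamma> e) = 0" if "e \<in> I" for e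
  proof -
    obtain m where m: "CHAR('a) = Suc (Suc m)"
      using prime_ge_2_nat[OF char] by (auto simp: numeral_2_eq_2 dest!: le_Suc_ex)
    have "of_nat (Suc (Suc m)) = (0 :: 'a)" unfolding m[symmetric] by (rule of_nat_CHAR)
    hence "of_nat (Suc m) + 1 = (0 :: 'a)" by (simp only: of_nat_Suc add.commute)
    hence neg: "of_nat (Suc m) = (-1 :: 'a)" by (simp only: eq_neg_iff_add_eq_0)
    have "\<gamma> e = c e * c e0 ^ Suc m"
      by (simp add: \<gamma>_def m)
    hence "pderiv (\<gamma> e) = c e * (smult (- 1) (c e0 ^ m) * pderiv (c e0)) + c e0 ^ Suc m * pderiv (c e)"
      by (simp only: pderiv_mult pderiv_power_Suc neg)
    also have "\<dots> = c e0 ^ m * c' e"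
      by (simp add: c'_def algebra_simps)
    finally show ?thesis using c'0[OF that] by simp
  qed
  moreover have "(\<Sum>e\<in>I. \<gamma> e * f e) = c e0 ^ (CHAR('a) - 1) * (\<Sum>e\<in>I. c e * (pderiv ^^ 0) (f e))"
    unfolding \<gamma>_def funpow_0 sum_distrib_left by (intro sum.cong) (simp_all only: mult_ac)
  hence "(\<Sum>e\<in>I. \<gamma> e * f e) = 0" using sol_r[OF c(1), of 0] by simp
  ultimately have "\<gamma> e0 = 0" using indep e0 by blast
  thus False using e0 by (simp add: \<gamma>_def)
qed

section \<open>Polynomials whose exponents have small residues modulo the characteristic\<close>

text \<open>For \<open>J \<le> p\<close> these are the sums of X^(p*j) * P_j with all P_j of degree
  less than \<open>J\<close>. In characteristic \<open>p\<close> this is the span of the polynomials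
  of degree less than \<open>J\<close> over the constants of the derivation, and it is the shape of
  the coefficients in Stepanov's auxiliary polynomial.\<close>

definition pfrac :: "nat \<Rightarrow> nat \<Rightarrow> 'a::zero poly \<Rightarrow> bool" where
  "pfrac p J C \<longleftrightarrow> (\<forall>i. coeff C i \<noteq> 0 \<longrightarrow> i mod p < J)"

lemma pfrac_diff: "pfrac p J C \<Longrightarrow> pfrac p J C' \<Longrightarrow> pfrac p J (C - C')"
  for C C' :: "'a::ab_group_add poly"
  unfolding pfrac_def coeff_diff by (metis diff_zero)

lemma pfrac_add: "pfrac p J C \<Longrightarrow> pfrac p J C' \<Longrightarrow> pfrac p J (C + C')"
  for C C' :: "'a::comm_monoid_add poly"
  unfolding pfrac_def coeff_add by (metis add_0)

lemma pfrac_lowdeg: "degree P < J \<Longrightarrow> J \<le> p \<Longrightarrow> pfrac p J P"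
  unfolding pfrac_def by (metis le_degree le_less_trans less_le_trans mod_less)

text \<open>A vanishing derivative leaves only exponents divisible by the characteristic. This
  reduces independence over the constants, as needed for the differential equations, to independence
  with \<open>pfrac\<close> coefficients.\<close>

lemma pfrac_deriv_0_mult:
  fixes g P :: "'a::field poly"
  assumes char: "prime CHAR('a)" and g: "pderiv g = 0" and P: "degree P < J" "J \<le> CHAR('a)"
  shows "pfrac CHAR('a) J (g * P)"
  unfolding pfrac_def
proof (intro allI impI)
  fix i assume "coeff (g * P) i \<noteq> 0"
  then obtain j where j: "j \<le> i" "coeff g j * coeff P (i - j) \<noteq> 0"
    unfolding coeff_mult by (metis (no_types, lifting) atMost_iff sum.neutral)
  have "CHAR('a) dvd j"
  proof (cases j)
    case (Suc m)
    have "coeff (pderiv g) m = 0" by (simp add: g)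
    hence "of_nat j = (0::'a)" using j Suc by (simp add: coeff_pderiv)
    thus ?thesis by (simp add: of_nat_eq_0_iff_char_dvd)
  qed auto
  moreover have "i - j < J" using j P by (metis le_degree le_less_trans mult_zero_right)
  moreover have "i mod CHAR('a) = (j mod CHAR('a) + (i - j)) mod CHAR('a)"
    using j by (metis le_add_diff_inverse mod_add_left_eq)
  ultimately show "i mod CHAR('a) < J"
    using P by (simp add: mod_eq_0_iff_dvd)
qed

lemma pfrac_monom_mult:
  fixes C :: "'a::comm_semiring_1 poly"
  assumes "pfrac p J C"
  shows "pfrac p J (monom c (p * n) * C)"
  unfolding pfrac_def
proof (intro allI impI)
  fix i assume i: "coeff (monom c (p * n) * C) i \<noteq> 0"
  have "p * n \<le> i" "coeff C (i - p * n) \<noteq> 0"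
    using i by (auto simp: coeff_monom_mult split: if_splits)
  hence "(i - p * n) mod p < J" using assms by (auto simp: pfrac_def)
  thus "i mod p < J" using \<open>p * n \<le> i\<close>
    by (metis le_add_diff_inverse2 mod_mult_self2)
qed

text \<open>Division by X^p + c moves exponents by multiples of \<open>p\<close> only, so the
  quotient keeps the \<open>pfrac\<close> shape and the remainder has degree less than
  \<open>J\<close>, not merely less than \<open>p\<close>.\<close>

lemma pfrac_division:
  fixes C :: "'a::field poly"
  assumes "pfrac p J C" "p > 0" "J \<le> p" "degree C < p * Suc N" "J > 0"
  shows "\<exists>C' P. C = (monom 1 p + [:c:]) * C' + P \<and> pfrac p J C' \<and> degree P < J \<and> (C' = 0 \<or> degree C' < p * N)"
  using assms
proof (induction "degree C" arbitrary: C rule: less_induct)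
  case less
  show ?case
  proof (cases "degree C < p")
    case True
    have "degree C < J"
    proof (cases "C = 0")
      case False
      hence "coeff C (degree C) \<noteq> 0" by simp
      hence "degree C mod p < J" using less.prems by (simp add: pfrac_def)
      thus ?thesis using True by simp
    qed (use less.prems in auto)
    thus ?thesis using less.prems by (intro exI[of _ 0] exI[of _ C]) (auto simp: pfrac_def)
  next
    case False
    define n where "n = degree C - p"
    have n: "degree C = n + p" using False by (simp add: n_def)
    have "C \<noteq> 0" using False less.prems by auto
    define h where "h = monom (lead_coeff C) n"
    have hf: "pfrac p J h"
    proof -
      have "coeff C (n + p) \<noteq> 0" using \<open>C \<noteq> 0\<close> n by (metis leading_coeff_0_iff)
      hence "(n + p) mod p < J" using less.prems unfolding pfrac_def by blast
      thus ?thesis by (auto simp: pfrac_def h_def)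
    qed
    define C1 where "C1 = C - (monom 1 p + [:c:]) * h"
    have split: "(monom 1 p + [:c:]) * h = monom 1 (p * 1) * h + monom c (p * 0) * h"
      by (simp add: algebra_simps monom_0)
    have C1f: "pfrac p J C1"
      unfolding C1_def split using hf less.prems(1) by (intro pfrac_diff pfrac_add pfrac_monom_mult)
    have hd: "degree (monom c 0 * h) \<le> n" "monom 1 p * h = monom (lead_coeff C) (degree C)"
      by (auto simp: h_def mult_monom n add.commute intro: order.trans[OF degree_monom_le])
    have "degree C1 < degree C \<or> C1 = 0"
    proof (rule disjCI)
      assume "C1 \<noteq> 0"
      have "degree C1 \<le> degree C"
        unfolding C1_def split using hd less.prems(2)
        by (intro degree_diff_le degree_add_le) (auto simp: n intro: order.trans[OF degree_monom_le])
      moreover have "coeff C1 (degree C) = 0"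
      proof -
        have "coeff (monom c 0 * h) (degree C) = 0"
          using hd(1) less.prems(2) by (intro coeff_eq_0) (auto simp: n)
        thus ?thesis unfolding C1_def split using hd(2) by (simp add: algebra_simps)
      qed
      ultimately show "degree C1 < degree C"
        using \<open>C1 \<noteq> 0\<close> by (metis leading_coeff_0_iff le_neq_implies_less)
    qed
    hence deg: "degree C1 < degree C" using n less.prems by auto
    obtain C' P where C': "C1 = (monom 1 p + [:c:]) * C' + P" "pfrac p J C'" "degree P < J"
        "C' = 0 \<or> degree C' < p * N"
      using less.hyps[OF deg C1f less.prems(2,3) _ less.prems(5)] less.prems deg by auto
    have "n < p * N" using less.prems n by simp
    moreover have "degree h \<le> n" by (simp add: h_def degree_monom_le)
    ultimately have "degree (C' + h) < p * N"
      using C'(4) by (cases "C' = 0") (auto intro: degree_add_less)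
    moreover have "C = (monom 1 p + [:c:]) * (C' + h) + P"
      using C'(1) by (simp only: C1_def algebra_simps)
    ultimately show ?thesis using C' hf pfrac_add by blast
  qed
qed

section \<open>Products of powers of linear factors\<close>

text \<open>Exponent vectors are lists so that everything built on them recurses along
  \<open>as\<close>; the independence proof peels off one linear factor at a time.\<close>

fun expts :: "nat \<Rightarrow> 'a list \<Rightarrow> nat list set" where
  "expts D [] = {[]}"
| "expts D (a # as) = (\<lambda>(e, es). e # es) ` ({..<D} \<times> expts D as)"

lemma expts_finite [simp]: "finite (expts D as)"
  by (induction as) auto

lemma expts_card: "card (expts D as) = D ^ length as"
  by (induction as) (auto simp: card_image inj_on_def card_cartesian_product)

lemma expts_sum_Cons:
  "(\<Sum>es\<in>expts D (a # as). f es) = (\<Sum>e<D. \<Sum>es\<in>expts D as. f (e # es))"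
  by (simp add: sum.reindex inj_on_def sum.cartesian_product case_prod_unfold)

text \<open>All exponents are multiples of \<open>t\<close>: at a point where the
  \<open>t\<close>-th power of each linear factor is prescribed, the value is known and does not
  depend on the point (\<open>poly_gpow\<close>).\<close>

fun gpow :: "nat \<Rightarrow> 'a::field list \<Rightarrow> nat list \<Rightarrow> 'a poly" where
  "gpow t (a # as) (e # es) = [:a, 1:] ^ (t * e) * gpow t as es"
| "gpow t _ _ = 1"

definition radp :: "'a::field list \<Rightarrow> 'a poly" where
  "radp as = (\<Prod>a\<leftarrow>as. [:a, 1:])"

text \<open>This is \<open>radp as\<close> times the logarithmic derivative of
  \<open>gpow t as es\<close>; it has nothing to do with the discrete logarithm
  \<open>dlog_mod\<close>.\<close>

fun dlog :: "nat \<Rightarrow> 'a::field list \<Rightarrow> nat list \<Rightarrow> 'a poly" where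
  "dlog t (a # as) (e # es) = of_nat (t * e) * radp as + [:a, 1:] * dlog t as es"
| "dlog t _ _ = 0"

lemma radp_Nil [simp]: "radp [] = 1"
  by (simp add: radp_def)

lemma radp_Cons: "radp (a # as) = [:a, 1:] * radp as"
  by (simp add: radp_def)

lemma radp_nonzero [simp]: "radp as \<noteq> 0"
  by (induction as) (simp_all only: radp_Nil radp_Cons mult_eq_0_iff, auto)

lemma degree_radp [simp]: "degree (radp as) = length as"
proof (induction as)
  case (Cons a as)
  have "degree ([:a, 1:] * radp as) = degree [:a, 1:] + degree (radp as)"
    by (intro degree_mult_eq) auto
  thus ?case using Cons by (simp only: radp_Cons) simp
qed simp

lemma mult_pderiv_power:
  "R * pderiv (R ^ n) = of_nat n * pderiv R * R ^ n" for R :: "'a::field poly"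
proof (cases n)
  case (Suc m)
  show ?thesis unfolding Suc pderiv_power_Suc
    by (simp add: of_nat_poly mult_ac del: of_nat_Suc)
qed auto

lemma gpow_nonzero [simp]: "gpow t as es \<noteq> 0"
  by (induction t as es rule: gpow.induct) auto

lemma radp_pderiv_gpow:
  "es \<in> expts D as \<Longrightarrow> radp as * pderiv (gpow t as es) = dlog t as es * gpow t as es"
proof (induction as arbitrary: es)
  case (Cons a as)
  then obtain e es' where es: "es = e # es'" "es' \<in> expts D as" by auto
  have "radp (a # as) * pderiv (gpow t (a # as) es)
      = ([:a, 1:] * pderiv ([:a, 1:] ^ (t * e))) * radp as * gpow t as es'
        + [:a, 1:] ^ (t * e) * [:a, 1:] * (radp as * pderiv (gpow t as es'))"
    unfolding es radp_Cons gpow.simps pderiv_mult by (simp only: algebra_simps)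
  also have "\<dots> = dlog t (a # as) es * gpow t (a # as) es"
    unfolding mult_pderiv_power Cons.IH[OF es(2)] unfolding es gpow.simps dlog.simps
    by (simp only: pderiv_pCons pderiv_1 algebra_simps) (simp add: algebra_simps del: mult_pCons_left mult_pCons_right)
  finally show ?case .
qed (simp add: radp_def)

lemma degree_dlog: "es \<in> expts D as \<Longrightarrow> degree (dlog t as es) \<le> length as - 1"
proof (induction as arbitrary: es)
  case (Cons a as)
  then obtain e es' where es: "es = e # es'" "es' \<in> expts D as" by auto
  have "degree (of_nat (t * e) * radp as :: 'a poly) \<le> length as"
    by (rule order.trans[OF degree_mult_le]) (simp del: of_nat_mult)
  moreover have "degree ([:a, 1:] * dlog t as es') \<le> length as"
  proof (cases "as = []")
    case False
    have "degree ([:a, 1:] * dlog t as es') \<le> degree [:a, 1:] + degree (dlog t as es')"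
      by (rule degree_mult_le)
    also have "\<dots> \<le> 1 + (length as - 1)" using Cons.IH[OF es(2)] by simp
    finally show ?thesis using False by (cases as) auto
  next
    case True
    thus ?thesis by (cases es') auto
  qed
  ultimately show ?case unfolding es dlog.simps by (auto intro: degree_add_le)
qed auto

text \<open>With \<open>R = radp as\<close> and \<open>G = gpow t as es\<close>, the \<open>i\<close>-th derivative of \<open>P G\<close> is
  \<open>(dcoef t as es i P) G / R^i\<close>; see \<open>radp_power_pderiv\<close>.\<close>

fun dcoef :: "nat \<Rightarrow> 'a::field list \<Rightarrow> nat list \<Rightarrow> nat \<Rightarrow> 'a poly \<Rightarrow> 'a poly" where
  "dcoef t as es 0 P = P"
| "dcoef t as es (Suc i) P = radp as * pderiv (dcoef t as es i P)
     + (dlog t as es - of_nat i * pderiv (radp as)) * dcoef t as es i P"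

lemma radp_power_pderiv:
  assumes "es \<in> expts D as"
  shows "radp as ^ i * (pderiv ^^ i) (P * gpow t as es) = dcoef t as es i P * gpow t as es"
proof (induction i)
  case (Suc i)
  define R where "R = radp as"
  define F where "F = (pderiv ^^ i) (P * gpow t as es)"
  define G where "G = gpow t as es"
  have IH: "R ^ i * F = dcoef t as es i P * G" using Suc by (simp add: R_def F_def G_def)
  have "R * (R ^ i * pderiv F) = R * pderiv (R ^ i * F) - of_nat i * pderiv R * (R ^ i * F)"
    using mult_pderiv_power[of R i] by (simp add: pderiv_mult algebra_simps)
  also have "\<dots> = dcoef t as es (Suc i) P * G"
    using radp_pderiv_gpow[OF assms, of t]
    unfolding IH by (simp add: R_def[symmetric] G_def[symmetric] pderiv_mult algebra_simps)
  finally show ?case by (simp add: R_def F_def G_def mult_ac)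
qed auto

text \<open>The bound is free of \<open>t\<close>: each differentiation costs only
  \<open>length as\<close> in degree. This keeps the number of linear conditions small, here and in
  Stepanov's method.\<close>

lemma degree_dcoef:
  assumes "es \<in> expts D as" "degree P < J"
  shows "degree (dcoef t as es i P) < J + i * length as"
proof (induction i)
  case (Suc i)
  define Q where "Q = dcoef t as es i P"
  have IH: "degree Q < J + i * length as" using Suc by (simp add: Q_def)
  show ?case
  proof (cases "as = []")
    case True
    hence "dcoef t as es (Suc i) P = pderiv Q"
      by (simp add: Q_def radp_def)
    moreover have "degree (pderiv Q) \<le> degree Q"
      by (intro degree_le) (auto simp: coeff_pderiv coeff_eq_0)
    ultimately show ?thesis using IH True by simp
  next
    case False
    have pd: "degree (pderiv H) \<le> degree H" for H :: "'a poly"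
      by (intro degree_le) (auto simp: coeff_pderiv coeff_eq_0)
    have "degree (radp as * pderiv Q) \<le> length as + degree Q"
      using pd[of Q] by (intro order.trans[OF degree_mult_le]) simp
    moreover have "degree ((dlog t as es - of_nat i * pderiv (radp as)) * Q) \<le> length as + degree Q"
    proof -
      have "degree (of_nat i * pderiv (radp as)) \<le> length as"
        using pd[of "radp as"] by (intro order.trans[OF degree_mult_le]) simp
      moreover have "degree (dlog t as es) \<le> length as"
        using degree_dlog[OF assms(1), of t] by simp
      ultimately have "degree (dlog t as es - of_nat i * pderiv (radp as)) \<le> length as"
        by (intro degree_diff_le) auto
      thus ?thesis by (intro order.trans[OF degree_mult_le]) simp
    qed
    ultimately have "degree (dcoef t as es (Suc i) P) \<le> length as + degree Q"
      unfolding dcoef.simps Q_def[symmetric] by (rule degree_add_le)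
    thus ?thesis using IH by simp
  qed
qed (use assms in auto)

lemma dcoef_add: "dcoef t as es i (P + Q) = dcoef t as es i P + dcoef t as es i Q"
  by (induction i) (auto simp: pderiv_add algebra_simps)

lemma dcoef_mult_const:
  "pderiv c = 0 \<Longrightarrow> dcoef t as es i (c * P) = c * dcoef t as es i P"
  by (induction i) (auto simp: pderiv_mult algebra_simps)

lemma dcoef_0 [simp]: "dcoef t as es i 0 = 0"
  by (induction i) auto

lemma dcoef_sum: "dcoef t as es i (\<Sum>x\<in>X. f x) = (\<Sum>x\<in>X. dcoef t as es i (f x))"
  by (induction X rule: infinite_finite_induct) (auto simp: dcoef_add)

section \<open>Root multiplicities and independence of products of powers\<close>

lemma linear_dvd_mult_gpow:
  assumes "b \<notin> set as" "[:b, 1:] ^ m dvd q * gpow t as es" "length es = length as"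
  shows "[:b, 1:] ^ m dvd q"
proof -
  have "poly (gpow t as es) (-b) \<noteq> 0"
    using assms(1,3) by (induction t as es rule: gpow.induct) auto
  hence "order (-b) (gpow t as es) = 0"
    by (simp add: order_root)
  hence "q \<noteq> 0 \<Longrightarrow> order (-b) (q * gpow t as es) = order (-b) q"
    by (simp add: order_mult)
  thus ?thesis using assms(2) by (cases "q = 0") (auto simp: order_divides[of "-b", simplified])
qed

lemma power_dvd_higher_pderiv:
  fixes F :: "'a::field poly"
  assumes "[:b, 1:] ^ V dvd F"
  shows "[:b, 1:] ^ (V - i) dvd (pderiv ^^ i) F"
proof (induction i)
  case (Suc i)
  then obtain H where H: "(pderiv ^^ i) F = [:b, 1:] ^ (V - i) * H" by blast
  show ?case
  proof (cases "V - i")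
    case (Suc m)
    have pd: "pderiv [:b, 1:] = 1" by (simp add: pderiv_pCons)
    have "pderiv ([:b, 1:] ^ (V - i) * H) = [:b, 1:] ^ m * ([:b, 1:] * pderiv H + smult (of_nat (Suc m)) H)"
      unfolding Suc pderiv_mult pderiv_power_Suc pd
      by (simp add: algebra_simps del: of_nat_Suc mult_pCons_left mult_pCons_right)
    moreover have "V - Suc i = m" using Suc by simp
    ultimately show ?thesis using H by simp
  qed auto
qed (use assms in auto)

lemma expts_length: "es \<in> expts D as \<Longrightarrow> length es = length as"
  by (induction as arbitrary: es) auto

text \<open>Rounds up \<open>Q + J + m * k + (m - 1)\<close> for \<open>m = D ^ k\<close> and
  \<open>Q = m * (J + m * k)\<close>, the count in \<open>root_multiplicity_bound\<close>: the
  degree of what a differential operator leaves, plus the orders of vanishing lost to at most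
  \<open>m - 1\<close> differentiations.\<close>

definition multiplicity_bound :: "nat \<Rightarrow> nat \<Rightarrow> nat \<Rightarrow> nat" where
  "multiplicity_bound D k J = (D ^ k + 1) * (J + D ^ k * k + 1)"

lemma multiplicity_bound_mono:
  assumes "k \<le> l" "D > 0"
  shows "multiplicity_bound D k J \<le> multiplicity_bound D l J"
proof -
  have "D ^ k \<le> D ^ l" using assms by (intro power_increasing) auto
  thus ?thesis unfolding multiplicity_bound_def using assms by (intro mult_mono add_mono) auto
qed

text \<open>Counting coefficients yields a nonzero differential operator of order less than the
  number of nonzero summands that kills all of them but one. It cannot kill the last one too,
  because the summands are independent over the constants. Applied to the whole sum it leaves a
  product of a power-free factor of small degree and a \<open>gpow\<close> that has no root at -b,
  while most of the multiplicity at -b survives.\<close>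

lemma root_multiplicity_bound:
  fixes as :: "'a::field list"
  assumes char: "prime CHAR('a)" and J: "J \<le> CHAR('a)" and b: "b \<notin> set as"
    and indep: "\<And>C. (\<And>es. es \<in> expts D as \<Longrightarrow> pfrac CHAR('a) J (C es)) \<Longrightarrow>
        (\<Sum>es\<in>expts D as. C es * gpow t as es) = 0 \<Longrightarrow> \<forall>es\<in>expts D as. C es = 0"
    and P: "\<And>es. es \<in> expts D as \<Longrightarrow> degree (P es) < J" "\<exists>es\<in>expts D as. P es \<noteq> 0"
    and V: "multiplicity_bound D (length as) J \<le> V"
  shows "\<not> [:b, 1:] ^ V dvd (\<Sum>es\<in>expts D as. P es * gpow t as es)"
proof
  assume dvd: "[:b, 1:] ^ V dvd (\<Sum>es\<in>expts D as. P es * gpow t as es)"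
  define I where "I = {es\<in>expts D as. P es \<noteq> 0}"
  define m where "m = card I"
  define k where "k = length as"
  \<comment> \<open>With this degree bound for the coefficients of the operator, the
    \<open>m * Q\<close> unknowns outnumber the \<open>(m - 1) * (Q + J + m * k)\<close>
    equations.\<close>
  define Q where "Q = m * (J + m * k)"
  define R where "R = radp as"
  define F where "F = (\<Sum>es\<in>I. P es * gpow t as es)"
  have F: "(\<Sum>es\<in>expts D as. P es * gpow t as es) = F"
    unfolding F_def I_def by (intro sum.mono_neutral_right) auto
  have fin: "finite I" by (simp add: I_def)
  obtain e0 where e0: "e0 \<in> I" using P(2) by (auto simp: I_def)
  have m: "m > 0" using e0 fin by (auto simp: m_def card_gt_0_iff)
  have J0: "J > 0" using P by fastforce
  have "card ((I - {e0}) \<times> {..<Q + J + m * k}) < card ({..<m} \<times> {..<Q})"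
  proof -
    have "(m - 1) * (J + m * k) < Q" using m J0 by (simp add: Q_def)
    moreover have "m * Q = (m - 1) * Q + Q" using m by (cases m) auto
    moreover have "(m - 1) * (Q + J + m * k) = (m - 1) * Q + (m - 1) * (J + m * k)"
      by (simp only: distrib_left add.assoc)
    ultimately have "(m - 1) * (Q + J + m * k) < m * Q"
      by linarith
    thus ?thesis using e0 fin by (simp add: card_cartesian_product m_def)
  qed
  then obtain c where c: "\<exists>x\<in>{..<m} \<times> {..<Q}. c x \<noteq> 0"
    "\<forall>y\<in>(I - {e0}) \<times> {..<Q + J + m * k}. (\<Sum>x\<in>{..<m} \<times> {..<Q}.
        c x * coeff (monom 1 (snd x) * dcoef t as (fst y) (fst x) (P (fst y))) (snd y)) = 0"
    using nontrivial_solution[where Eq = "(I - {e0}) \<times> {..<Q + J + m * k}" and I = "{..<m} \<times> {..<Q}"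
        and v = "\<lambda>y x. coeff (monom 1 (snd x) * dcoef t as (fst y) (fst x) (P (fst y))) (snd y)"] fin
    by auto
  define q where "q = (\<lambda>i. \<Sum>j<Q. monom (c (i, j)) j)"
  \<comment> \<open>The operator with coefficients \<open>q i * radp as ^ i\<close> turns the
    summand of index \<open>es\<close> into \<open>S es * gpow t as es\<close>; \<open>c\<close> was
    chosen to make \<open>S es\<close> vanish for every \<open>es\<close> in \<open>I\<close> except
    \<open>e0\<close>.\<close>
  define S where "S = (\<lambda>es. \<Sum>i<m. q i * dcoef t as es i (P es))"
  have q_nz: "\<exists>i<m. q i \<noteq> 0"
  proof -
    obtain i j where ij: "i < m" "j < Q" "c (i, j) \<noteq> 0" using c(1) by auto
    have "coeff (q i) j = c (i, j)" using ij by (simp add: q_def coeff_sum)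
    thus ?thesis using ij by (metis coeff_0)
  qed
  have q_deg: "degree (q i) < Q" for i
  proof -
    have "Q > 0" using m J0 by (simp add: Q_def)
    have "degree (q i) \<le> Q - 1"
      unfolding q_def by (intro degree_sum_le) (auto intro: order.trans[OF degree_monom_le])
    with \<open>Q > 0\<close> show ?thesis by simp
  qed
  have S_deg: "degree (S es) < Q + J + m * k" if "es \<in> I" for es
  proof -
    have "degree (q i * dcoef t as es i (P es)) \<le> Q + J + m * k - 1" if "i < m" for i
    proof -
      have "degree (dcoef t as es i (P es)) < J + i * k"
        unfolding k_def using \<open>es \<in> I\<close> P by (intro degree_dcoef) (auto simp: I_def)
      also have "\<dots> \<le> J + m * k" using that by simp
      finally show ?thesis using q_deg[of i]
        by (intro order.trans[OF degree_mult_le]) simp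
    qed
    hence "degree (S es) \<le> Q + J + m * k - 1"
      unfolding S_def by (intro degree_sum_le) auto
    thus ?thesis using J0 by simp
  qed
  have S0: "S es = 0" if es: "es \<in> I - {e0}" for es
  proof (rule poly_eqI)
    fix n
    show "coeff (S es) n = coeff 0 n"
    proof (cases "n < Q + J + m * k")
      case True
      have "S es = (\<Sum>i<m. \<Sum>j<Q. monom (c (i, j)) j * dcoef t as es i (P es))"
        by (simp only: S_def q_def sum_distrib_right)
      also have "\<dots> = (\<Sum>x\<in>{..<m} \<times> {..<Q}. monom (c x) (snd x) * dcoef t as es (fst x) (P es))"
        by (subst sum.cartesian_product) (intro sum.cong, auto)
      also have "\<dots> = (\<Sum>x\<in>{..<m} \<times> {..<Q}. smult (c x) (monom 1 (snd x) * dcoef t as es (fst x) (P es)))"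
        by (intro sum.cong refl) (simp only: mult_smult_left[symmetric] smult_monom mult_1_right)
      finally have "S es = \<dots>" .
      hence "coeff (S es) n = (\<Sum>x\<in>{..<m} \<times> {..<Q}. c x * coeff (monom 1 (snd x) * dcoef t as es (fst x) (P es)) n)"
        by (simp add: coeff_sum)
      also have "\<dots> = 0" using c(2) True es by auto
      finally show ?thesis by simp
    qed (use S_deg[of es] es in \<open>auto intro!: coeff_eq_0\<close>)
  qed
  have key: "(\<Sum>i<m. q i * (R ^ i * (pderiv ^^ i) (P es * gpow t as es))) = S es * gpow t as es" if "es \<in> I" for es
    using that radp_power_pderiv[where t = t and P = "P es" and as = as and es = es and D = D]
    unfolding S_def R_def sum_distrib_right by (intro sum.cong refl) (simp add: I_def mult.assoc)
  have ind': "\<forall>e\<in>I. \<gamma> e = 0" if g: "\<And>e. e \<in> I \<Longrightarrow> pderiv (\<gamma> e) = 0"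
    and s: "(\<Sum>e\<in>I. \<gamma> e * (P e * gpow t as e)) = 0" for \<gamma>
  proof -
    define C where "C = (\<lambda>es. if es \<in> I then \<gamma> es * P es else 0)"
    have "(\<Sum>es\<in>expts D as. C es * gpow t as es) = (\<Sum>e\<in>I. C e * gpow t as e)"
      by (intro sum.mono_neutral_right) (auto simp: C_def I_def)
    also have "\<dots> = (\<Sum>e\<in>I. \<gamma> e * (P e * gpow t as e))"
      by (intro sum.cong refl) (simp add: C_def mult.assoc)
    finally have "(\<Sum>es\<in>expts D as. C es * gpow t as es) = 0" using s by simp
    moreover have "pfrac CHAR('a) J (C es)" if "es \<in> expts D as" for es
    proof (cases "es \<in> I")
      case True
      thus ?thesis using pfrac_deriv_0_mult[OF char g, of es "P es" J] P(1) J that by (simp add: C_def)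
    qed (simp add: C_def pfrac_def)
    ultimately have "\<forall>es\<in>expts D as. C es = 0" using indep by blast
    thus ?thesis by (auto simp: C_def I_def split: if_splits)
  qed
  have "S e0 \<noteq> 0"
  proof
    assume "S e0 = 0"
    have "(\<Sum>i<card I. q i * R ^ i * (pderiv ^^ i) (P e * gpow t as e)) = 0" if "e \<in> I" for e
      using key[OF that] S0[of e] \<open>S e0 = 0\<close> that by (cases "e = e0") (simp_all add: m_def mult.assoc)
    hence "\<forall>i<card I. q i * R ^ i = 0"
      by (intro ode_independent_solutions[OF char fin, where f = "\<lambda>es. P es * gpow t as es"] ind')
    thus False using q_nz by (auto simp: R_def m_def)
  qed
  have "(\<Sum>i<m. q i * R ^ i * (pderiv ^^ i) F) = (\<Sum>i<m. \<Sum>es\<in>I. q i * (R ^ i * (pderiv ^^ i) (P es * gpow t as es)))"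
    by (simp only: F_def higher_pderiv_sum sum_distrib_left mult.assoc)
  also have "\<dots> = (\<Sum>es\<in>I. S es * gpow t as es)"
    by (subst sum.swap) (intro sum.cong refl key)
  also have "\<dots> = S e0 * gpow t as e0"
    using S0 fin e0 by (simp add: sum.remove)
  finally have eq: "(\<Sum>i<m. q i * R ^ i * (pderiv ^^ i) F) = S e0 * gpow t as e0" .
  have "[:b, 1:] ^ (V - (m - 1)) dvd S e0 * gpow t as e0"
    unfolding eq[symmetric]
  proof (intro dvd_sum dvd_mult)
    fix i assume "i \<in> {..<m}"
    have "[:b, 1:] ^ (V - (m - 1)) dvd [:b, 1:] ^ (V - i)"
      using \<open>i \<in> {..<m}\<close> by (intro le_imp_power_dvd) auto
    also have "\<dots> dvd (pderiv ^^ i) F"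
      using dvd F by (intro power_dvd_higher_pderiv) auto
    finally show "[:b, 1:] ^ (V - (m - 1)) dvd (pderiv ^^ i) F" .
  qed
  hence "[:b, 1:] ^ (V - (m - 1)) dvd S e0"
    by (rule linear_dvd_mult_gpow[OF b]) (use e0 expts_length[of e0 D as] in \<open>auto simp: I_def\<close>)
  hence "degree ([:b, 1:] ^ (V - (m - 1))) \<le> degree (S e0)"
    using \<open>S e0 \<noteq> 0\<close> by (intro dvd_imp_degree_le)
  hence "V - (m - 1) < Q + J + m * k"
    using S_deg[OF e0] by (simp add: degree_linear_power)
  moreover have "m \<le> D ^ k"
    unfolding m_def k_def expts_card[symmetric] by (intro card_mono) (auto simp: I_def)
  have "(m + 1) * (J + m * k + 1) \<le> (D ^ k + 1) * (J + D ^ k * k + 1)"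
    using \<open>m \<le> D ^ k\<close> by (intro mult_mono add_mono) auto
  hence "(m + 1) * (J + m * k + 1) \<le> V" using V by (simp add: multiplicity_bound_def k_def)
  ultimately show False by (simp add: Q_def algebra_simps)
qed

text \<open>Induction on \<open>as\<close>. The coefficients are reduced modulo the
  \<open>p\<close>-th power of the first factor X + a. If some remainder is nonzero, the lowest
  block, multiplied by (X + a)^(t*m), makes a sum over the other factors divisible by (X + a)^t,
  which exceeds the multiplicity allowed by \<open>root_multiplicity_bound\<close>. So all
  remainders vanish and the \<open>p\<close>-th power can be divided out repeatedly.\<close>

lemma gpow_independent:
  fixes as :: "'a::field list"
  assumes char: "prime CHAR('a)" and J: "0 < J" "J \<le> CHAR('a)" and D: "0 < D" "D * t \<le> CHAR('a)"
    and as: "distinct as" and mult: "as \<noteq> [] \<Longrightarrow> multiplicity_bound D (length as - 1) J \<le> t"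
    and C: "\<And>es. es \<in> expts D as \<Longrightarrow> pfrac CHAR('a) J (C es)"
    and zero: "(\<Sum>es\<in>expts D as. C es * gpow t as es) = 0"
  shows "\<forall>es\<in>expts D as. C es = 0"
  using as mult C zero
proof (induction as arbitrary: C)
  case Nil
  thus ?case by simp
next
  case (Cons a as)
  let ?p = "CHAR('a)"
  have p0: "?p > 0" using prime_gt_0_nat[OF char] .
  \<comment> \<open>In characteristic \<open>p\<close> this is X^p + a^p, so division by it respects
    \<open>pfrac\<close>.\<close>
  define u where "u = [:a, 1:] ^ ?p"
  have u: "u = monom 1 ?p + [:a ^ ?p:]"
  proof -
    have "[:a, 1:] = monom 1 1 + [:a:]" by (simp add: monom_altdef)
    hence "u = (monom 1 1 + [:a:]) ^ ?p" by (simp only: u_def)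
    also have "\<dots> = monom 1 1 ^ ?p + [:a:] ^ ?p"
      by (rule freshmans_dream) (simp_all add: char)
    finally show ?thesis by (simp only: monom_power poly_const_pow) simp
  qed
  have mult': "\<not> [:a, 1:] ^ t dvd (\<Sum>es\<in>expts D as. P es * gpow t as es)"
    if "\<And>es. es \<in> expts D as \<Longrightarrow> degree (P es) < J" "\<exists>es\<in>expts D as. P es \<noteq> 0" for P
  proof (rule root_multiplicity_bound[OF char J(2) _ _ that])
    show "a \<notin> set as" using Cons.prems by simp
    fix C' assume C': "\<And>es. es \<in> expts D as \<Longrightarrow> pfrac ?p J (C' es)" "(\<Sum>es\<in>expts D as. C' es * gpow t as es) = 0"
    show "\<forall>es\<in>expts D as. C' es = 0"
    proof (rule Cons.IH[OF _ _ C'])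
      assume "as \<noteq> []"
      thus "multiplicity_bound D (length as - 1) J \<le> t"
        using Cons.prems(2) multiplicity_bound_mono[of "length as - 1" "length as" D J] D by simp
    qed (use Cons.prems in auto)
  qed (use Cons.prems in auto)
  \<comment> \<open>Inner induction on a degree bound in units of \<open>p\<close>: each round
    divides all coefficients by \<open>u\<close>.\<close>
  have "\<forall>es\<in>expts D (a # as). C es = 0"
    if "\<forall>es\<in>expts D (a # as). C es = 0 \<or> degree (C es) < ?p * N"
      "\<forall>es\<in>expts D (a # as). pfrac ?p J (C es)"
      "(\<Sum>es\<in>expts D (a # as). C es * gpow t (a # as) es) = 0" for N C
    using that
  proof (induction N arbitrary: C)
    case (Suc N)
    have "\<forall>es\<in>expts D (a # as). \<exists>C' P. C es = u * C' + P \<and> pfrac ?p J C' \<and> degree P < J \<and> (C' = 0 \<or> degree C' < ?p * N)"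
    proof
      fix es assume es: "es \<in> expts D (a # as)"
      show "\<exists>C' P. C es = u * C' + P \<and> pfrac ?p J C' \<and> degree P < J \<and> (C' = 0 \<or> degree C' < ?p * N)"
      proof -
        have "C es = 0 \<or> degree (C es) < ?p * Suc N" using Suc.prems(1) es by blast
        hence "degree (C es) < ?p * Suc N" using p0 by (cases "C es = 0") auto
        moreover have "pfrac ?p J (C es)" using Suc.prems(2) es by blast
        ultimately show ?thesis unfolding u using J p0 by (intro pfrac_division)
      qed
    qed
    then obtain C' P where CP: "\<And>es. es \<in> expts D (a # as) \<Longrightarrow> C es = u * C' es + P es"
      "\<And>es. es \<in> expts D (a # as) \<Longrightarrow> pfrac ?p J (C' es)"
      "\<And>es. es \<in> expts D (a # as) \<Longrightarrow> degree (P es) < J"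
      "\<And>es. es \<in> expts D (a # as) \<Longrightarrow> C' es = 0 \<or> degree (C' es) < ?p * N"
      by metis
    let ?SC = "\<Sum>es\<in>expts D (a # as). C' es * gpow t (a # as) es"
    define H where "H = (\<lambda>e. \<Sum>es\<in>expts D as. P (e # es) * gpow t as es)"
    let ?SH = "\<Sum>e<D. [:a, 1:] ^ (t * e) * H e"
    have "0 = (\<Sum>es\<in>expts D (a # as). (u * C' es + P es) * gpow t (a # as) es)"
      unfolding Suc.prems(3)[symmetric] by (intro sum.cong refl arg_cong2[of _ _ _ _ "(*)"] CP(1))
    also have "\<dots> = u * (?SC)
        + (\<Sum>es\<in>expts D (a # as). P es * gpow t (a # as) es)"
      by (simp add: ring_distribs sum.distrib sum_distrib_left mult_ac)
    also have "(\<Sum>es\<in>expts D (a # as). P es * gpow t (a # as) es) = (?SH)"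
      unfolding expts_sum_Cons H_def by (simp add: sum_distrib_left mult_ac)
    finally have eq: "u * (?SC) + (?SH) = 0"
      by simp
    \<comment> \<open>For the least bad block \<open>m\<close>, the hypothesis
      \<open>D * t \<le> CHAR('a)\<close> makes (X + a)^(t*(m+1)) divide \<open>u\<close>. It
      divides all later blocks as well, hence also block \<open>m\<close>.\<close>
    have P0: "P (e # es) = 0" if "e < D" "es \<in> expts D as" for e es
    proof (rule ccontr)
      assume ne: "P (e # es) \<noteq> 0"
      define bad where "bad = (\<lambda>e. e < D \<and> (\<exists>es\<in>expts D as. P (e # es) \<noteq> 0))"
      have "bad e" using that ne by (auto simp: bad_def)
      define m where "m = (LEAST e. bad e)"
      have m: "bad m" unfolding m_def by (rule LeastI, fact)
      have less: "\<not> bad e" if "e < m" for e using that not_less_Least unfolding m_def by blast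
      have mD: "m < D" using m by (simp add: bad_def)
      have H0: "H e = 0" if "e < m" for e
        using less[OF that] that mD by (auto simp: H_def bad_def)
      have "t * Suc m \<le> D * t" using mD mult_le_mono2[of "Suc m" D t] by (simp add: mult.commute)
      hence tp: "t * Suc m \<le> ?p" using D by simp
      have "[:a, 1:] ^ (t * Suc m) dvd (?SH)"
      proof -
        have "(?SH) = u * - (?SC)"
          using eq unfolding mult_minus_right eq_neg_iff_add_eq_0 by (simp only: add.commute)
        moreover have "[:a, 1:] ^ (t * Suc m) dvd u"
          unfolding u_def by (rule le_imp_power_dvd[OF tp])
        ultimately show ?thesis by (simp only: dvd_mult2)
      qed
      moreover have "(?SH) = [:a, 1:] ^ (t * m) * H m + (\<Sum>e\<in>{m<..<D}. [:a, 1:] ^ (t * e) * H e)"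
      proof -
        have "(?SH) = (\<Sum>e\<in>insert m {m<..<D}. [:a, 1:] ^ (t * e) * H e)"
          using mD H0 by (intro sum.mono_neutral_right) (auto simp: not_less_iff_gr_or_eq)
        thus ?thesis by simp
      qed
      moreover have "[:a, 1:] ^ (t * Suc m) dvd (\<Sum>e\<in>{m<..<D}. [:a, 1:] ^ (t * e) * H e)"
        by (intro dvd_sum dvd_mult2 le_imp_power_dvd mult_le_mono) auto
      ultimately have "[:a, 1:] ^ (t * Suc m) dvd [:a, 1:] ^ (t * m) * H m"
        by (simp only: dvd_add_left_iff)
      hence "[:a, 1:] ^ (t * m) * [:a, 1:] ^ t dvd [:a, 1:] ^ (t * m) * H m"
        by (simp only: power_add[symmetric] mult_Suc_right add.commute)
      hence "[:a, 1:] ^ t dvd H m"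
        by (subst (asm) dvd_mult_cancel_left) simp
      moreover have "\<not> [:a, 1:] ^ t dvd H m"
        unfolding H_def using m CP(3) by (intro mult') (auto simp: bad_def)
      ultimately show False by contradiction
    qed
    have "(?SH) = 0"
      using P0 by (intro sum.neutral) (auto simp: H_def)
    moreover have "u \<noteq> 0" by (simp add: u_def)
    ultimately have "(?SC) = 0" using eq by simp
    hence "\<forall>es\<in>expts D (a # as). C' es = 0" using CP by (intro Suc.IH) blast+
    moreover have "P es = 0" if "es \<in> expts D (a # as)" for es using P0 that by auto
    ultimately show ?case using CP(1) by simp
  qed auto
  moreover define N where "N = Suc (\<Sum>es\<in>expts D (a # as). degree (C es))"
  have "degree (C es) < ?p * N" if "es \<in> expts D (a # as)" for es
  proof -
    have "degree (C es) \<le> (\<Sum>es\<in>expts D (a # as). degree (C es))"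
      by (rule member_le_sum[OF that]) auto
    hence "degree (C es) < N" by (simp add: N_def)
    also have "N \<le> ?p * N" using p0 by simp
    finally show ?thesis .
  qed
  ultimately show ?case using Cons.prems by blast
qed

section \<open>Stepanov's method\<close>

text \<open>The restriction \<open>M \<le> CHAR('a)\<close> keeps the factors produced by
  differentiating powers of X - x invertible.\<close>

lemma power_dvd_if_derivs_vanish:
  fixes F :: "'a::field poly"
  assumes "prime CHAR('a)" "M \<le> CHAR('a)" "\<And>i. i < M \<Longrightarrow> poly ((pderiv ^^ i) F) x = 0"
  shows "[:-x, 1:] ^ M dvd F"
  using assms(2,3)
proof (induction M arbitrary: F)
  case (Suc M)
  have "[:-x, 1:] ^ M dvd F" using Suc.prems by (intro Suc.IH) auto
  then obtain H where H: "F = [:-x, 1:] ^ M * H" by blast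
  show ?case
  proof (cases M)
    case 0
    have "poly F x = 0" using Suc.prems(2)[of 0] by simp
    thus ?thesis using 0 by (simp add: poly_eq_0_iff_dvd)
  next
    case (Suc m)
    have "[:-x, 1:] ^ M dvd pderiv F"
    proof (rule Suc.IH)
      fix i assume "i < M"
      thus "poly ((pderiv ^^ i) (pderiv F)) x = 0"
        using Suc.prems(2)[of "Suc i"] by (simp add: funpow_swap1)
    qed (use Suc.prems in auto)
    moreover have pd: "pderiv [:-x, 1:] = 1" by (simp add: pderiv_pCons)
    have "pderiv F = [:-x, 1:] ^ M * pderiv H + [:-x, 1:] ^ m * smult (of_nat M) H"
      unfolding H \<open>M = Suc m\<close> pderiv_mult pderiv_power_Suc pd
      by (simp add: algebra_simps del: of_nat_Suc mult_pCons_left mult_pCons_right)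
    ultimately have "[:-x, 1:] ^ M dvd [:-x, 1:] ^ m * smult (of_nat M) H"
      by (metis dvd_add_right_iff dvd_triv_left)
    hence "[:-x, 1:] ^ m * [:-x, 1:] dvd [:-x, 1:] ^ m * smult (of_nat M) H"
      using \<open>M = Suc m\<close> by (simp only: power_Suc2)
    hence "[:-x, 1:] dvd smult (of_nat M) H"
      by (subst (asm) dvd_mult_cancel_left) simp
    moreover have "of_nat M \<noteq> (0 :: 'a)"
      using Suc.prems(1) \<open>M = Suc m\<close> by (auto simp: of_nat_eq_0_iff_char_dvd dest!: dvd_imp_le simp del: of_nat_Suc)
    ultimately have "[:-x, 1:] dvd H" by (simp add: dvd_smult_iff)
    thus ?thesis unfolding H power_Suc2 by (intro mult_dvd_mono) auto
  qed
qed auto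

lemma linear_power_dvd_cancel:
  fixes h q :: "'a::field poly"
  assumes "poly q c \<noteq> 0" "[:-c, 1:] ^ m dvd h * q"
  shows "[:-c, 1:] ^ m dvd h"
proof -
  have "order c q = 0" using assms(1) by (simp add: order_root)
  hence "h \<noteq> 0 \<Longrightarrow> order c (h * q) = order c h"
    using assms(1) by (subst order_mult) auto
  thus ?thesis using assms by (cases "h = 0") (auto simp: order_divides)
qed

lemma card_multiple_roots_le_degree:
  fixes F :: "'a::field poly"
  assumes "finite S" "F \<noteq> 0" "\<And>x. x \<in> S \<Longrightarrow> [:-x, 1:] ^ M dvd F"
  shows "M * card S \<le> degree F"
proof -
  have "(\<Prod>x\<in>S. [:-x, 1:] ^ M) dvd F"
    using assms(1,3)
  proof (induction S rule: finite_induct)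
    case (insert x S)
    then obtain H where H: "F = (\<Prod>x\<in>S. [:-x, 1:] ^ M) * H" by blast
    have "poly (\<Prod>x\<in>S. [:-x, 1:] ^ M) x \<noteq> 0"
      using insert by (auto simp: poly_prod)
    hence "[:-x, 1:] ^ M dvd H"
      by (rule linear_power_dvd_cancel) (use insert.prems[of x] H in \<open>simp add: mult.commute\<close>)
    thus ?case using insert by (simp only: H prod.insert) (simp add: mult.commute mult_dvd_mono del: mult_pCons_left mult_pCons_right)
  qed simp
  hence "degree (\<Prod>x\<in>S. [:-x, 1:] ^ M) \<le> degree F"
    using assms(2) by (rule dvd_imp_degree_le)
  also have "degree (\<Prod>x\<in>S. [:-x, 1:] ^ M) = (\<Sum>x\<in>S. degree ([:-x, 1:] ^ M))"
    by (rule degree_prod_eq_sum_degree) auto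
  finally show ?thesis by (simp add: degree_linear_power mult.commute)
qed

fun wprod :: "'a::field list \<Rightarrow> nat list \<Rightarrow> 'a" where
  "wprod (z # zs) (e # es) = z ^ e * wprod zs es"
| "wprod _ _ = 1"

lemma poly_gpow:
  assumes "list_all2 (\<lambda>a z. (x + a) ^ t = z) as zs" "es \<in> expts D as"
  shows "poly (gpow t as es) x = wprod zs es"
  using assms
proof (induction arbitrary: es rule: list_all2_induct)
  case (Cons a as z zs)
  thus ?case by (auto simp: power_mult add.commute)
qed auto

lemma degree_gpow: "es \<in> expts D as \<Longrightarrow> degree (gpow t as es) \<le> length as * (D * t)"
proof (induction as arbitrary: es)
  case (Cons a as)
  then obtain e es' where es: "es = e # es'" "es' \<in> expts D as" "e < D" by auto
  have "degree (gpow t (a # as) es) \<le> degree ([:a, 1:] ^ (t * e)) + degree (gpow t as es')"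
    unfolding es gpow.simps by (rule degree_mult_le)
  also have "\<dots> \<le> D * t + length as * (D * t)"
    using Cons.IH[OF es(2)] es(3) by (intro add_mono) (auto simp: degree_linear_power mult.commute)
  finally show ?case by simp
qed auto

lemma poly_radp_Cons: "poly (radp (a # as)) x = (x + a) * poly (radp as) x"
  by (simp add: radp_Cons algebra_simps)

text \<open>The auxiliary polynomial \<open>\<Phi>\<close> is a sum of X^(p*j) * P *
  \<open>gpow t as es\<close> with \<open>J * D ^ k * L\<close> free coefficients. On
  \<open>S\<close> one has x^p = x and known values of \<open>gpow\<close>, so each derivative of
  \<open>\<Phi>\<close>, times a power of \<open>radp as\<close>, agrees with a polynomial of degree
  less than \<open>J + M * k + L\<close>. Making these vanish identically for all orders below
  \<open>M\<close> is a smaller linear system. Then \<open>\<Phi>\<close>, nonzero by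
  \<open>gpow_independent\<close>, has zeros of order \<open>M\<close> on \<open>S\<close>, to be
  compared with its degree.\<close>

theorem stepanov:
  fixes as zs :: "'a::field list" and S :: "'a set"
  defines "k \<equiv> length as" and "p \<equiv> CHAR('a)"
  assumes char: "prime CHAR('a)" and S: "finite S" "\<And>x. x \<in> S \<Longrightarrow> x ^ p = x"
    "\<And>x. x \<in> S \<Longrightarrow> list_all2 (\<lambda>a z. (x + a) ^ t = z) as zs" and zs: "0 \<notin> set zs"
    and as: "distinct as" "as \<noteq> []"
    and J: "0 < J" "J \<le> p" and D: "0 < D" "D * t \<le> p" and mult: "multiplicity_bound D (k - 1) J \<le> t"
    and M: "M \<le> p" "M * (J + M * k + L) < J * D ^ k * L"
  shows "M * card S \<le> J + p * (L - 1) + k * (D * t)"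
proof -
  define I where "I = expts D as \<times> {..<L} \<times> {..<J}"
  \<comment> \<open>One equation for each order of differentiation and each coefficient of
    \<open>T\<close>.\<close>
  define Eq where "Eq = {..<M} \<times> {..<J + M * k + L}"
  define v where "v = (\<lambda>(\<mu>, n) (es, j, s). coeff (smult (wprod zs es) (monom 1 j * dcoef t as es \<mu> (monom 1 s))) n)"
  have L0: "L > 0" using M(2) by (cases L) auto
  have t0: "t > 0" using mult J(1) by (auto simp: multiplicity_bound_def)
  have "card Eq < card I"
    using M(2) by (simp add: I_def Eq_def card_cartesian_product expts_card k_def mult_ac)
  then obtain c where c: "\<exists>x\<in>I. c x \<noteq> 0" "\<forall>q\<in>Eq. (\<Sum>x\<in>I. c x * v q x) = 0"
    using nontrivial_solution[of Eq I v] by (auto simp: I_def Eq_def)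
  define P where "P = (\<lambda>es j. \<Sum>s<J. monom (c (es, j, s)) s)"
  define C where "C = (\<lambda>es. \<Sum>j<L. monom 1 (p * j) * P es j)"
  define \<Phi> where "\<Phi> = (\<Sum>es\<in>expts D as. C es * gpow t as es)"
  \<comment> \<open>The low-degree polynomial that agrees on \<open>S\<close> with
    \<open>radp as ^ \<mu>\<close> times the \<open>\<mu>\<close>-th derivative of
    \<open>\<Phi>\<close>: X^(p*j) has become X^j and each \<open>gpow\<close> its constant value
    \<open>wprod zs es\<close>.\<close>
  define T where "T = (\<lambda>\<mu>. \<Sum>es\<in>expts D as. \<Sum>j<L. smult (wprod zs es) (monom 1 j * dcoef t as es \<mu> (P es j)))"
  have P_coeff: "coeff (P es j) s = (if s < J then c (es, j, s) else 0)" for es j s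
    by (auto simp: P_def coeff_sum)
  have P_deg: "degree (P es j) < J" for es j
    using J(1) by (intro degree_lessI) (auto simp: P_coeff)
  have monom_pd: "pderiv (monom 1 (p * j)) = (0 :: 'a poly)" for j
    by (simp add: pderiv_monom p_def of_nat_eq_0_iff_char_dvd del: of_nat_mult)
  \<comment> \<open>Because \<open>J \<le> p\<close>, the blocks X^(p*j) * P_j do not overlap, so a
    nonzero solution gives a nonzero \<open>C es\<close>.\<close>
  have C_coeff: "coeff (C es) (p * j0 + s) = c (es, j0, s)" if "j0 < L" "s < J" for es j0 s
  proof -
    have "coeff (monom 1 (p * j) * P es j) (p * j0 + s) = (if j = j0 then c (es, j0, s) else 0)" for j
    proof (cases j j0 rule: linorder_cases)
      case less
      then obtain d where d: "j0 = j + Suc d" using less_imp_Suc_add by auto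
      have "p * j0 + s = p * j + (p * Suc d + s)" by (simp add: d algebra_simps)
      moreover have "coeff (P es j) (p * Suc d + s) = 0" using J by (simp add: P_coeff)
      ultimately show ?thesis using less by (simp add: coeff_monom_mult add.assoc)
    next
      case equal
      thus ?thesis using that by (simp add: coeff_monom_mult P_coeff)
    next
      case greater
      then obtain d where d: "j = j0 + Suc d" using less_imp_Suc_add by auto
      have "p * j0 + s < p * j" using that J by (simp add: d algebra_simps)
      thus ?thesis using greater by (simp add: coeff_monom_mult)
    qed
    thus ?thesis using that by (simp add: C_def coeff_sum)
  qed
  have "\<Phi> \<noteq> 0"
  proof
    assume "\<Phi> = 0"
    hence z: "(\<Sum>es\<in>expts D as. C es * gpow t as es) = 0" by (simp add: \<Phi>_def)
    have fr: "pfrac CHAR('a) J (C es)" for es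
    proof -
      have "pfrac p J (\<Sum>j\<in>X. monom 1 (p * j) * P es j)" if "finite X" for X
        using that
        by (induction X rule: finite_induct)
          (simp_all add: pfrac_def[of _ _ 0] pfrac_add pfrac_monom_mult pfrac_lowdeg P_deg J)
      thus ?thesis by (simp add: C_def p_def)
    qed
    have C0: "\<forall>es\<in>expts D as. C es = 0"
      using gpow_independent[OF char J(1) J(2)[unfolded p_def] D(1) D(2)[unfolded p_def] as(1) _ fr z] mult
      by (simp add: k_def)
    obtain es j s where "es \<in> expts D as" "j < L" "s < J" "c (es, j, s) \<noteq> 0"
      using c(1) by (auto simp: I_def)
    thus False using C0 C_coeff[of j s es] by simp
  qed
  have T0: "T \<mu> = 0" if "\<mu> < M" for \<mu>
  proof (rule poly_eqI)
    fix n
    have "T \<mu> = (\<Sum>es\<in>expts D as. \<Sum>j<L. \<Sum>s<J. smult (c (es, j, s)) (smult (wprod zs es) (monom 1 j * dcoef t as es \<mu> (monom 1 s))))"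
    proof -
      have "dcoef t as es \<mu> (P es j) = (\<Sum>s<J. smult (c (es, j, s)) (dcoef t as es \<mu> (monom 1 s)))" for es j
      proof -
        have "dcoef t as es \<mu> (monom (c (es, j, s)) s) = smult (c (es, j, s)) (dcoef t as es \<mu> (monom 1 s))" for s
          using dcoef_mult_const[of "[:c (es, j, s):]" t as es \<mu> "monom 1 s"] by (simp add: pderiv_pCons smult_monom)
        thus ?thesis by (simp add: P_def dcoef_sum)
      qed
      thus ?thesis unfolding T_def by (simp add: sum_distrib_left smult_sum2 mult_ac)
    qed
    hence eq: "coeff (T \<mu>) n = (\<Sum>x\<in>I. c x * v (\<mu>, n) x)"
      by (simp add: coeff_sum I_def v_def sum.cartesian_product case_prod_unfold mult.assoc)
    show "coeff (T \<mu>) n = coeff 0 n"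
    proof (cases "n < J + M * k + L")
      case True
      thus ?thesis using eq c(2) that by (auto simp: Eq_def)
    next
      case False
      have "degree (smult (wprod zs es) (monom 1 j * dcoef t as es \<mu> (P es j))) \<le> J + M * k + L - 1"
        if "es \<in> expts D as" "j < L" for es j
      proof -
        have "degree (dcoef t as es \<mu> (P es j)) < J + \<mu> * k"
          unfolding k_def using that P_deg by (intro degree_dcoef)
        also have "\<dots> \<le> J + M * k" using \<open>\<mu> < M\<close> by simp
        finally have "degree (monom 1 j * dcoef t as es \<mu> (P es j)) \<le> J + M * k + L - 1"
          using that degree_monom_le[of "1::'a" j] by (intro order.trans[OF degree_mult_le]) simp
        thus ?thesis using degree_smult_le order.trans by blast
      qed
      hence "degree (T \<mu>) \<le> J + M * k + L - 1"
        unfolding T_def by (intro degree_sum_le) auto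
      thus ?thesis using False L0 by (simp add: coeff_eq_0)
    qed
  qed
  have vanish: "poly ((pderiv ^^ \<mu>) \<Phi>) x = 0" if "x \<in> S" "\<mu> < M" for x \<mu>
  proof -
    have xp: "x ^ (p * j) = x ^ j" for j
      using S(2)[OF that(1)] by (simp only: power_mult)
    have "radp as ^ \<mu> * (pderiv ^^ \<mu>) \<Phi> = (\<Sum>es\<in>expts D as. \<Sum>j<L. monom 1 (p * j) * (radp as ^ \<mu> * (pderiv ^^ \<mu>) (P es j * gpow t as es)))"
      by (simp add: \<Phi>_def C_def higher_pderiv_sum sum_distrib_left sum_distrib_right mult.assoc
          higher_pderiv_const_mult[OF monom_pd] mult.left_commute[of "radp as ^ \<mu>"])
    also have "\<dots> = (\<Sum>es\<in>expts D as. \<Sum>j<L. monom 1 (p * j) * (dcoef t as es \<mu> (P es j) * gpow t as es))"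
      by (intro sum.cong refl arg_cong2[of _ _ _ _ "(*)"] radp_power_pderiv)
    finally have "poly (radp as ^ \<mu> * (pderiv ^^ \<mu>) \<Phi>) x =
       (\<Sum>es\<in>expts D as. \<Sum>j<L. x ^ (p * j) * (poly (dcoef t as es \<mu> (P es j)) x * poly (gpow t as es) x))"
      by (simp add: poly_sum poly_monom)
    also have "\<dots> = (\<Sum>es\<in>expts D as. \<Sum>j<L. wprod zs es * (x ^ j * poly (dcoef t as es \<mu> (P es j)) x))"
      using poly_gpow[OF S(3)[OF that(1)]] by (intro sum.cong refl) (simp add: xp)
    also have "\<dots> = poly (T \<mu>) x"
      by (simp add: T_def poly_sum poly_monom)
    finally have "poly (radp as) x ^ \<mu> * poly ((pderiv ^^ \<mu>) \<Phi>) x = 0"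
      using T0[OF that(2)] by simp
    moreover have "poly (radp as) x \<noteq> 0"
      using S(3)[OF that(1)] zs t0
      by (induction rule: list_all2_induct) (auto simp: poly_radp_Cons)
    ultimately show ?thesis by simp
  qed
  have "M * card S \<le> degree \<Phi>"
    using S(1) \<open>\<Phi> \<noteq> 0\<close>
  proof (rule card_multiple_roots_le_degree)
    fix x assume "x \<in> S"
    thus "[:-x, 1:] ^ M dvd \<Phi>" using vanish M(1) char
      by (intro power_dvd_if_derivs_vanish) (auto simp: p_def)
  qed
  also have "degree \<Phi> \<le> J + p * (L - 1) + k * (D * t)"
    unfolding \<Phi>_def
  proof (rule degree_sum_le)
    fix es assume es: "es \<in> expts D as"
    have "degree (C es) \<le> J + p * (L - 1)"
      unfolding C_def
    proof (rule degree_sum_le)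
      fix j assume "j \<in> {..<L}"
      hence "p * j \<le> p * (L - 1)" by (intro mult_le_mono) auto
      moreover have "degree (monom 1 (p * j) * P es j) \<le> p * j + degree (P es j)"
        by (intro order.trans[OF degree_mult_le] add_mono degree_monom_le) auto
      ultimately show "degree (monom 1 (p * j) * P es j) \<le> J + p * (L - 1)"
        using P_deg[of es j] by linarith
    qed auto
    thus "degree (C es * gpow t as es) \<le> J + p * (L - 1) + k * (D * t)"
      using degree_gpow[OF es, of t] unfolding k_def
      by (intro order.trans[OF degree_mult_le] add_mono)
  qed auto
  finally show ?thesis .
qed

section \<open>Transfer to integers modulo a prime\<close>

definition stepanov_bound :: "nat \<Rightarrow> bool" where
  "stepanov_bound p \<longleftrightarrow> (\<forall>as zs t J D L M. distinct as \<longrightarrow> set as \<subseteq> {..<p} \<longrightarrow> as \<noteq> [] \<longrightarrow>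
     length zs = length as \<longrightarrow> (\<forall>z\<in>set zs. \<not> p dvd z) \<longrightarrow> 0 < J \<longrightarrow> J \<le> p \<longrightarrow> 0 < D \<longrightarrow> D * t \<le> p \<longrightarrow>
     multiplicity_bound D (length as - 1) J \<le> t \<longrightarrow> M \<le> p \<longrightarrow> M * (J + M * length as + L) < J * D ^ length as * L \<longrightarrow>
     M * card {x\<in>{..<p}. \<forall>i<length as. [(x + as ! i) ^ t = zs ! i] (mod p)}
       \<le> J + p * (L - 1) + length as * (D * t))"

lemma stepanov_bound_CARD: "stepanov_bound CARD('a::prime_card)"
  unfolding stepanov_bound_def
proof (intro allI impI)
  let ?p = "CARD('a)"
  let ?h = "of_nat :: nat \<Rightarrow> 'a mod_ring"
  fix as zs :: "nat list" and t J D L M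
  assume as: "distinct as" "set as \<subseteq> {..<?p}" "as \<noteq> []"
    and zs: "length zs = length as" "\<forall>z\<in>set zs. \<not> ?p dvd z"
    and J: "0 < J" "J \<le> ?p" and D: "0 < D" "D * t \<le> ?p" and m: "multiplicity_bound D (length as - 1) J \<le> t"
    and M: "M \<le> ?p" "M * (J + M * length as + L) < J * D ^ length as * L"
  define S where "S = {x\<in>{..<?p}. \<forall>i<length as. [(x + as ! i) ^ t = zs ! i] (mod ?p)}"
  have eq_iff: "?h x = ?h y \<longleftrightarrow> [x = y] (mod ?p)" for x y
    by (simp add: of_nat_eq_iff_cong_CHAR)
  have inj: "inj_on ?h {..<?p}"
    by (auto simp: inj_on_def eq_iff cong_def)
  have char: "prime CHAR('a mod_ring)" by (simp add: prime_card)
  have "M * card (?h ` S) \<le> J + CHAR('a mod_ring) * (L - 1) + length (map ?h as) * (D * t)"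
  proof (rule stepanov[OF char])
    fix x assume "x \<in> ?h ` S"
    then obtain y where y: "x = ?h y" "y \<in> S" by blast
    show "x ^ CHAR('a mod_ring) = x"
      using finite_field_power_card_eq_same[of x] by simp
    show "list_all2 (\<lambda>a z. (x + a) ^ t = z) (map ?h as) (map ?h zs)"
      unfolding list_all2_conv_all_nth
    proof safe
      fix i assume "i < length (map ?h as)"
      hence "?h ((y + as ! i) ^ t) = ?h (zs ! i)" using y by (simp only: eq_iff) (simp add: S_def)
      thus "(x + map ?h as ! i) ^ t = map ?h zs ! i" using \<open>i < _\<close> zs by (simp add: y)
    qed (use zs in simp)
  next
    show "0 \<notin> set (map ?h zs)"
      using zs(2) of_nat_0_mod_ring_dvd by fastforce
    show "distinct (map ?h as)"
      using as inj by (auto simp: distinct_map intro: inj_on_subset)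
  qed (use as J D m M in \<open>auto simp: S_def\<close>)
  moreover have "card (?h ` S) = card S"
    by (rule card_image) (use inj in \<open>auto simp: S_def intro: inj_on_subset\<close>)
  ultimately show "M * card {x\<in>{..<?p}. \<forall>i<length as. [(x + as ! i) ^ t = zs ! i] (mod ?p)}
      \<le> J + ?p * (L - 1) + length as * (D * t)"
    by (simp add: S_def)
qed

text \<open>HOL has no type depending on a number \<open>p\<close>. But \<open>stepanov_bound\<close> is a closed predicate of \<open>p\<close>, so it
  is enough to have a type whose cardinality is a prime that violates it if any prime does.\<close>

definition bad_prime :: nat where
  "bad_prime = (SOME p. prime p \<and> ((\<exists>q. prime q \<and> \<not> stepanov_bound q) \<longrightarrow> \<not> stepanov_bound p))"

lemma bad_prime: "prime bad_prime" "prime q \<Longrightarrow> \<not> stepanov_bound q \<Longrightarrow> \<not> stepanov_bound bad_prime"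
proof -
  have "\<exists>p. prime p \<and> ((\<exists>q. prime q \<and> \<not> stepanov_bound q) \<longrightarrow> \<not> stepanov_bound p)"
    using two_is_prime_nat by blast
  from someI_ex[OF this] show "prime bad_prime" "prime q \<Longrightarrow> \<not> stepanov_bound q \<Longrightarrow> \<not> stepanov_bound bad_prime"
    unfolding bad_prime_def by blast+
qed

typedef bad_index = "{..<bad_prime}"
  using prime_gt_0_nat[OF bad_prime(1)] by auto

lemma card_bad_index: "CARD(bad_index) = bad_prime"
  using type_definition.card[OF type_definition_bad_index] by simp

instance bad_index :: prime_card
  by standard (simp add: card_bad_index bad_prime)

theorem stepanov_mod_prime: "prime p \<Longrightarrow> stepanov_bound p"
  using bad_prime(2) stepanov_bound_CARD[where ?'a = bad_index] by (auto simp: card_bad_index)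

section \<open>Equidistribution of power residue classes\<close>

text \<open>For \<open>t = (p - 1) div d\<close> and entries of \<open>zs\<close> prime to
  \<open>p\<close>, each condition confines x + a to at most one coset of the \<open>d\<close>-th
  powers.\<close>

definition sols :: "nat \<Rightarrow> nat \<Rightarrow> nat list \<Rightarrow> nat list \<Rightarrow> nat set" where
  "sols p t as zs = {x\<in>{..<p}. \<forall>i<length as. [(x + as ! i) ^ t = zs ! i] (mod p)}"

lemma finite_sols [simp]: "finite (sols p t as zs)"
  by (simp add: sols_def)

lemma card_sols_le: "card (sols p t as zs) \<le> p"
  using card_mono[of "{..<p}" "sols p t as zs"] by (auto simp: sols_def)

lemma card_sols_stepanov:
  assumes "prime p" "distinct as" "set as \<subseteq> {..<p}" "length as = k" "k \<ge> 1" "length zs = k" "\<forall>z\<in>set zs. \<not> p dvd z"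
    "0 < J" "J \<le> p" "0 < D" "D * t \<le> p" "multiplicity_bound D (k - 1) J \<le> t" "M \<le> p" "M * (J + M * k + L) < J * D ^ k * L"
  shows "M * card (sols p t as zs) \<le> J + p * (L - 1) + k * (D * t)"
proof -
  have "as \<noteq> []" using assms by auto
  thus ?thesis using assms(2-) unfolding sols_def assms(4)[symmetric]
    by (intro stepanov_mod_prime[OF assms(1), unfolded stepanov_bound_def, rule_format]) simp_all
qed

text \<open>Stepanov's method with \<open>D = d\<close>: about \<open>n * L\<close> orders of
  vanishing against a degree of about \<open>p * L\<close> give the main term \<open>p / n\<close>,
  where \<open>n = d ^ k\<close>. The constant 72 is 4 * 18, where \<open>18 * (k + 1)\<close>
  bounds \<open>k + Y\<close>; it also ensures that \<open>n * L\<close> is at least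
  \<open>2 * Y\<close>. Only an upper bound results; \<open>correlation_bound\<close> derives the
  lower one.\<close>

lemma card_sols_equidistributed:
  assumes p: "prime p" and d: "d dvd p - 1" and as: "distinct as" "set as \<subseteq> {..<p}" "length as = k" "k \<ge> 1"
    and zs: "length zs = k" "\<forall>z\<in>set zs. \<not> p dvd z"
  shows "real (card (sols p ((p - 1) div d) as zs)) \<le> p / d ^ k + 72 * (k + 1) * (d ^ k) ^ 3 * sqrt p"
proof -
  define n where "n = d ^ k"
  define m where "m = d ^ (k - 1)"
  define s where "s = sqrt p"
  define t where "t = (p - 1) div d"
  define S where "S = sols p t as zs"
  have p2: "p \<ge> 2" using prime_ge_2_nat[OF p] .
  have d0: "d > 0" using d p2 by (cases "d = 0") auto
  have td: "t * d = p - 1" using d by (simp add: t_def)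
  have n1: "n \<ge> 1" "m \<ge> 1" using d0 by (simp_all add: n_def m_def Suc_le_eq)
  have md: "m * d = n" using \<open>k \<ge> 1\<close> by (cases k) (auto simp: m_def n_def)
  have s2: "s * s = p" by (simp add: s_def)
  have s0: "s \<ge> 1" using p2 by (simp add: s_def)
  show ?thesis
  proof (cases "s \<le> 72 * (k + 1) * n ^ 3")
    \<comment> \<open>Here the error term already exceeds the trivial bound
      \<open>p\<close>.\<close>
    case True
    have "real (card S) \<le> s * s" using card_sols_le s2 by (simp add: S_def)
    also have "\<dots> \<le> 72 * (k + 1) * n ^ 3 * s" using True s0 by (intro mult_right_mono) auto
    also have "\<dots> \<le> p / d ^ k + 72 * (k + 1) * n ^ 3 * s" by simp
    finally show ?thesis by (simp add: S_def t_def n_def s_def add_ac)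
  next
    case False
    hence big: "s > 72 * (real k + 1) * n ^ 3" by (simp add: add_ac)
    have n3: "real n \<le> n ^ 3" "real n ^ 2 \<le> n ^ 3" using n1 by (auto intro: power_increasing[of 1 3 "real n", simplified] power_increasing)
    \<comment> \<open>With \<open>M = n * L\<close> the inequality between equations and unknowns
      would fail by \<open>n * L ^ 2 * (n * k + 1)\<close>, which is at most
      \<open>p * (k + 1) / n\<close>. Lowering \<open>M\<close> by \<open>Y\<close> gains at least
      \<open>Y * J\<close> with \<open>J \<ge> p / (16 * n)\<close>, so anything above
      \<open>16 * (k + 1)\<close> is enough.\<close>
    define Y where "Y = 17 * (k + 1)"
    \<comment> \<open>The factor 8 leaves only \<open>2 * n * J \<le> p / 4\<close> as the leading
      part of the multiplicity condition.\<close>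
    define J where "J = p div (8 * n)"
    \<comment> \<open>Large enough for the loss \<open>p * (k + Y) / (n * L)\<close> to be of order
      \<open>(k + 1) * n * sqrt p\<close>, small enough for \<open>n * L ^ 2 * (n * k + 1)\<close>
      to stay below \<open>Y * J\<close>.\<close>
    define L where "L = nat \<lfloor>s / n ^ 2\<rfloor>"
    define M where "M = n * L - Y"
    have nn: "real n \<ge> 1" using n1 by simp
    have big1: "s \<ge> 72 * (real k + 1) * n ^ 2" "s \<ge> 72 * (real k + 1) * n"
      using n3 nn by (intro order.trans[OF mult_left_mono less_imp_le[OF big]]; simp)+
    have L: "real L \<le> s / n ^ 2" "real L \<ge> s / n ^ 2 / 2"
    proof -
      have a: "s / n ^ 2 \<ge> 1"
      proof -
        have "1 * real n ^ 2 \<le> 72 * (real k + 1) * real n ^ 2" by (intro mult_right_mono) auto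
        also have "\<dots> \<le> s" using big1(1) by simp
        finally show ?thesis using nn by (simp add: le_divide_eq)
      qed
      thus "real L \<le> s / n ^ 2" by (simp add: L_def)
      have "real L > s / n ^ 2 - 1" using a unfolding L_def by linarith
      moreover have "real L \<ge> 1" using a unfolding L_def by (simp add: le_nat_iff le_floor_iff)
      moreover have "y / 2 \<le> real L" if "y - 1 < real L" "1 \<le> real L" for y using that by linarith
      ultimately show "real L \<ge> s / n ^ 2 / 2" by blast
    qed
    have nL: "n * real L \<le> s / n" "n * real L \<ge> s / n / 2"
    proof -
      have eq: "n * (s / n ^ 2) = s / n" using nn by (simp add: power2_eq_square)
      have "n * real L \<le> n * (s / n ^ 2)" using L by (intro mult_left_mono) auto
      thus "n * real L \<le> s / n" by (simp only: eq)
      have "n * (s / n ^ 2 / 2) \<le> n * real L" using L by (intro mult_left_mono) auto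
      also have "n * (s / n ^ 2 / 2) = s / n / 2" unfolding eq[symmetric] by (simp only: times_divide_eq_right)
      finally show "n * real L \<ge> s / n / 2" .
    qed
    have sn: "s / n \<ge> 72 * (real k + 1)"
      using big1(2) nn by (subst le_divide_eq) simp
    have Y: "real Y = 17 * (real k + 1)" by (simp add: Y_def)
    have nLY: "real (n * L) \<ge> 2 * Y" using nL sn Y by simp
    have M: "real M = n * real L - Y"
    proof -
      have "real Y \<le> real (n * L)" using nLY by simp
      hence "Y \<le> n * L" by (simp only: of_nat_le_iff)
      thus ?thesis by (simp add: M_def of_nat_diff)
    qed
    have p_big: "real p \<ge> 72 * (real k + 1) * n ^ 2 * s"
      using mult_right_mono[OF big1(1), of s] s0 s2 by simp
    have "1 \<le> s" by fact
    have p_big2: "real p \<ge> 72 * (real k + 1) * n ^ 2"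
    proof -
      have "72 * (real k + 1) * n ^ 2 * 1 \<le> 72 * (real k + 1) * n ^ 2 * s"
        by (rule mult_left_mono[OF s0]) auto
      from order.trans[OF this p_big] show ?thesis by (simp only: mult_1_right)
    qed
    have nsq: "real n \<le> n ^ 2" using nn by (simp add: power2_eq_square)
    have p_big3: "real p \<ge> 72 * n"
    proof -
      have "72 * real n \<le> 72 * (real k + 1) * n ^ 2" using nsq by (intro mult_mono) auto
      thus ?thesis using p_big2 by linarith
    qed
    have J: "real J \<le> p / (8 * n)" "real J \<ge> p / (16 * n)"
    proof -
      have "real J = of_int \<lfloor>p / (8 * n)\<rfloor>" unfolding J_def
        by (metis of_nat_mult of_nat_numeral floor_divide_of_nat_eq of_int_of_nat_eq)
      moreover have "p / (8 * n) \<ge> 1" using p_big3 nn by (simp add: field_simps)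
      moreover have "real_of_int \<lfloor>y\<rfloor> \<le> y \<and> y / 2 \<le> real_of_int \<lfloor>y\<rfloor>" if "1 \<le> y" for y :: real
      proof -
        have "1 \<le> \<lfloor>y\<rfloor>" using that by simp
        thus ?thesis by (intro conjI; linarith)
      qed
      ultimately have *: "real J \<le> p / (8 * n)" "real J \<ge> p / (8 * n) / 2" by (simp_all only:)
      have "p / (8 * n) / 2 = p / (16 * n)" by simp
      with * show "real J \<le> p / (8 * n)" "real J \<ge> p / (16 * n)" by (simp_all only:)
    qed
    have "72 * n \<le> p" using p_big3 by linarith
    hence J0: "0 < J" using n1 by (simp add: J_def div_greater_zero_iff)
    have Jp: "J \<le> p" by (simp add: J_def)
    have "M * card S \<le> J + p * (L - 1) + k * (d * t)"
      unfolding S_def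
    proof (rule card_sols_stepanov[OF p as zs])
      show "0 < J" by (fact J0)
      show "J \<le> p" by (fact Jp)
      show "d * t \<le> p" using td by (simp add: mult.commute)
      show "M \<le> p"
      proof -
        have "real M \<le> s / n" using M nL Y by simp
        also have "\<dots> \<le> s" using nn s0 by (simp add: field_simps)
        also have "\<dots> \<le> s * s" using s0 by simp
        finally show ?thesis using s2 by simp
      qed
      show "multiplicity_bound d (k - 1) J \<le> t"
      proof -
        have mn': "real m \<le> real n" using mult_le_mono2[of 1 d m] d0 md by simp
        have "real ((m + 1) * (J + m * (k - 1) + 1) * d) \<le> (2 * m) * (J + m * real k + m) * d"
        proof -
          have "(m + 1) * (J + m * (k - 1) + 1) * d \<le> (2 * m) * (J + m * k + m) * d"
            using n1 by (intro mult_le_mono add_le_mono) auto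
          hence "real ((m + 1) * (J + m * (k - 1) + 1) * d) \<le> real ((2 * m) * (J + m * k + m) * d)"
            by (simp only: of_nat_le_iff)
          thus ?thesis by simp
        qed
        also have "\<dots> = 2 * n * (J + m * real k + m)" by (simp add: md[symmetric])
        also have "\<dots> \<le> 2 * n * (p / (8 * n) + n * real k + n)"
          using J(1) mn' by (intro mult_left_mono add_mono mult_right_mono) auto
        also have "\<dots> = p / 4 + 2 * (real k + 1) * n ^ 2"
          using nn by (simp add: field_simps power2_eq_square)
        also have "2 * (real k + 1) * n ^ 2 = (72 * (real k + 1) * n ^ 2) / 36" by simp
        also have "p / 4 + \<dots> \<le> p / 4 + p / 36" using p_big2 by (intro add_left_mono divide_right_mono) auto
        also have "\<dots> \<le> real (p - 1)" using p2 by (simp add: of_nat_diff)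
        finally have "multiplicity_bound d (k - 1) J * d \<le> t * d"
          unfolding multiplicity_bound_def m_def[symmetric] td by linarith
        thus ?thesis using d0 by simp
      qed
      show "M * (J + M * k + L) < J * d ^ k * L"
      proof -
        have "real (M * (J + M * k + L)) \<le> (n * real L - Y) * (J + (n * real L) * k + L)"
        proof -
          have le: "real M \<le> n * real L" using M by linarith
          have "real (M * (J + M * k + L)) = real M * (real J + real M * real k + real L)" by simp
          also have "\<dots> \<le> real M * (real J + (n * real L) * k + real L)"
            using le by (intro mult_left_mono add_mono mult_right_mono) auto
          finally show ?thesis by (simp only: M)
        qed
        also have "\<dots> \<le> n * real L * J + n * real L ^ 2 * (n * k + 1) - Y * J"
        proof -
          have "0 \<le> real Y * ((n * real L) * k + L)" by simp
          thus ?thesis by (simp add: algebra_simps power2_eq_square)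
        qed
        also have "n * real L ^ 2 * (n * k + 1) < Y * J"
        proof -
          have "n * real L ^ 2 * (n * k + 1) \<le> n * (s / n ^ 2) ^ 2 * (n * k + n)"
            using L nn by (intro mult_mono power_mono add_mono) auto
          also have "\<dots> = p * (k + 1) / n ^ 2"
            using nn s2 by (simp add: field_simps power2_eq_square)
          also have "\<dots> \<le> p * (k + 1) / n"
            using nn nsq p2 by (intro divide_left_mono) auto
          also have "\<dots> < 17 / 16 * (p * (k + 1) / n)"
          proof -
            have "0 < p * (k + 1)" using p2 by simp
            hence "0 < real (p * (k + 1))" by (simp only: of_nat_0_less_iff)
            hence "0 < p * (k + 1) / n" using nn by (intro divide_pos_pos) linarith+
            thus ?thesis by linarith
          qed
          also have "\<dots> = 17 * (k + 1) * (p / (16 * n))" by (simp add: algebra_simps add_divide_distrib)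
          also have "\<dots> \<le> Y * J" using J(2) unfolding Y_def of_nat_mult by (intro mult_mono) auto
          finally show ?thesis .
        qed
        finally have "real (M * (J + M * k + L)) < real (n * L * J)" by simp
        thus ?thesis by (simp only: of_nat_less_iff n_def mult_ac)
      qed
    qed (use d0 in auto)
    hence "real (M * card S) \<le> real (J + p * (L - 1) + k * (d * t))" by (simp only: of_nat_le_iff)
    also have "\<dots> \<le> p * (L + k)"
    proof -
      have "L \<ge> 1" using nLY Y by (cases L) auto
      hence "J + p * (L - 1) \<le> p * L" using Jp by (cases L) auto
      moreover have "d * t \<le> p" using td by (simp add: mult.commute)
      hence "k * (d * t) \<le> k * p" by (rule mult_le_mono2)
      ultimately have "J + p * (L - 1) + k * (d * t) \<le> p * L + k * p" by (rule add_le_mono)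
      also have "\<dots> = p * (L + k)" by (simp add: algebra_simps)
      finally have "J + p * (L - 1) + k * (d * t) \<le> p * (L + k)" .
      thus ?thesis by (simp only: of_nat_le_iff)
    qed
    finally have main: "real M * card S \<le> p * (real L + k)" by simp
    define E where "E = 72 * (k + 1) * n ^ 3 * s"
    have M0: "real M > 0" using M nLY Y by simp
    have "p * (real L + k) \<le> (p / n + E) * M"
    proof -
      have "p * (k + real Y) \<le> E * (n * real L / 2)"
      proof -
        have "p * (k + real Y) \<le> p * (18 * (real k + 1))" using Y by (intro mult_left_mono) auto
        also have "\<dots> = (72 * (real k + 1) * n * s) * (s / n / 4)" unfolding s2[symmetric] using nn by (simp add: field_simps)
        also have "\<dots> \<le> E * (n * real L / 2)"
        proof -
          have E: "E = 72 * (real k + 1) * real n ^ 3 * s" by (simp add: E_def)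
          have "real n \<le> real n ^ 3" using n3(1) by simp
          hence "72 * (real k + 1) * n * s \<le> E"
            unfolding E using s0 by (intro mult_right_mono mult_left_mono) auto
          moreover have "x / 4 \<le> y / 2" if "x / 2 \<le> y" for x y :: real using that by simp
          hence "s / n / 4 \<le> n * real L / 2" using nL(2) by blast
          moreover have "0 \<le> E" unfolding E using s0 by (intro mult_nonneg_nonneg) auto
          ultimately show ?thesis using s0 by (intro mult_mono) auto
        qed
        finally show ?thesis .
      qed
      also have "\<dots> \<le> E * M"
      proof (rule mult_left_mono)
        have "x / 2 \<le> x - y" if "2 * y \<le> x" for x y :: real using that by simp
        moreover have "2 * real Y \<le> n * real L" using nLY by (simp only: of_nat_mult of_nat_numeral)
        ultimately show "n * real L / 2 \<le> real M" unfolding M by blast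
      qed (use s0 in \<open>auto simp: E_def\<close>)
      finally have "p * (k + real Y) \<le> E * M" .
      moreover have "p * real Y / n \<le> p * real Y / 1" using nn by (intro divide_left_mono) auto
      moreover have "p / n * M = p * real L - p * real Y / n" using nn by (simp add: M field_simps)
      ultimately show ?thesis by (simp add: algebra_simps)
    qed
    with main have "card S * real M \<le> (p / n + E) * M" by (simp add: mult.commute)
    hence "card S \<le> p / n + E" using M0 by simp
    thus ?thesis by (simp add: S_def t_def E_def n_def s_def add_ac)
  qed
qed

text \<open>The expected count \<open>p / d ^ k\<close> is at most 1, so \<open>L = 1\<close> is
  enough and \<open>D\<close> may be smaller than \<open>d\<close>: about half of
  \<open>D ^ k\<close> orders of vanishing against a degree of order \<open>k * D * t\<close>. With
  \<open>D\<close> maximal for the multiplicity condition, the quotient \<open>D * t / D ^ k\<close>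
  is of order \<open>sqrt p\<close>, because \<open>D * sqrt t \<le> sqrt p\<close> and
  \<open>sqrt t\<close> is bounded by a constant times \<open>D ^ k\<close>.\<close>

lemma card_sols_large_index:
  assumes p: "prime p" and d: "d dvd p - 1" and as: "distinct as" "set as \<subseteq> {..<p}" "length as = k" "k \<ge> 1"
    and zs: "length zs = k" "\<forall>z\<in>set zs. \<not> p dvd z" and large: "p \<le> d ^ k"
  shows "real (card (sols p ((p - 1) div d) as zs)) \<le> 22 * (10 * k * 4 ^ k) * k * sqrt p"
proof -
  define T where "T = 10 * k * 4 ^ k"
  define t where "t = (p - 1) div d"
  let ?ok = "\<lambda>D. 10 * k * D ^ (2 * k) \<le> t"
  define S where "S = sols p t as zs"
  have p2: "p \<ge> 2" using prime_ge_2_nat[OF p] .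
  have d0: "d > 0" using d p2 by (cases "d = 0") auto
  have td: "t * d = p - 1" using d by (simp add: t_def)
  have t0: "t > 0" using td p2 by (cases t) auto
  have T1: "T \<ge> 40" using \<open>k \<ge> 1\<close> power_increasing[of 1 k "4::nat"] mult_le_mono[of 10 "10 * k" 4 "4 ^ k"] by (simp add: T_def)
  have sp: "sqrt p \<ge> 1" using p2 by simp
  show ?thesis
  proof (cases "t < T")
    \<comment> \<open>A single one of the conditions already has at most \<open>t\<close>
      solutions.\<close>
    case True
    define a where "a = as ! 0"
    have as0: "0 < length as" using as by simp
    have "card S \<le> card ((\<lambda>x. (x + a) mod p) ` S)"
    proof (rule eq_imp_le[OF card_image[symmetric]], rule inj_onI)
      fix x y assume "x \<in> S" "y \<in> S" "(x + a) mod p = (y + a) mod p"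
      hence "[x + a = y + a] (mod p)" "x < p" "y < p" by (auto simp: cong_def S_def sols_def)
      thus "x = y" by (metis cong_add_rcancel_nat cong_less_modulus_unique_nat)
    qed
    also have "\<dots> \<le> card {x\<in>{..<p}. [x ^ t = zs ! 0] (mod p)}"
      using as0 p2 by (intro card_mono) (auto simp: S_def sols_def a_def cong_def power_mod)
    also have "\<dots> \<le> t" by (rule roots_mod_prime_bound) (use p t0 in auto)
    finally have "real (card S) \<le> T" using True by simp
    also have "\<dots> \<le> 22 * T * k * sqrt p"
    proof -
      have "T * 1 \<le> (22 * T) * k" using \<open>k \<ge> 1\<close> by (intro mult_le_mono) auto
      hence "real T \<le> real (22 * T * k)" by (simp only: of_nat_le_iff mult_1_right)
      also have "\<dots> \<le> real (22 * T * k) * sqrt p" using mult_left_mono[OF sp, of "real (22 * T * k)"] by simp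
      finally show ?thesis by simp
    qed
    finally show ?thesis by (simp add: S_def t_def T_def)
  next
    case False
    \<comment> \<open>The expression \<open>10 * k * D ^ (2 * k)\<close> dominates the multiplicity
      bound for the \<open>J\<close> chosen below, and \<open>T\<close> is its value at
      \<open>D = 2\<close>, so \<open>D \<ge> 2\<close> here. Maximality gives
      \<open>t < 10 * k * (D + 1) ^ (2 * k)\<close>.\<close>
    define D where "D = (GREATEST D. 10 * k * D ^ (2 * k) \<le> t)"
    have bdd: "D' \<le> t" if "10 * k * D' ^ (2 * k) \<le> t" for D'
    proof -
      have "D' \<le> D' ^ (2 * k)" using \<open>k \<ge> 1\<close> by (cases "D' = 0") (auto intro: self_le_power)
      also have "\<dots> \<le> 10 * k * D' ^ (2 * k)" using \<open>k \<ge> 1\<close> by simp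
      finally show ?thesis using that by simp
    qed
    have two: "10 * k * 2 ^ (2 * k) \<le> t" using False by (simp add: T_def power_mult)
    have D: "10 * k * D ^ (2 * k) \<le> t"
      unfolding D_def by (rule GreatestI_nat[where P = "?ok", OF two]) (use bdd in blast)
    have D2: "D \<ge> 2"
      unfolding D_def by (rule Greatest_le_nat[where P = "?ok", OF two]) (use bdd in blast)
    have D': "t < 10 * k * (D + 1) ^ (2 * k)"
    proof (rule ccontr)
      assume "\<not> ?thesis"
      hence "D + 1 \<le> D" unfolding D_def
        by (intro Greatest_le_nat[where P = "?ok"]) (use bdd in \<open>auto simp: D_def\<close>)
      thus False by simp
    qed
    define n where "n = D ^ k"
    define m where "m = D ^ (k - 1)"
    have n: "n \<ge> 2" using D2 \<open>k \<ge> 1\<close> self_le_power[of D k] by (simp add: n_def)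
    have m: "m \<ge> 1" using D2 by (simp add: m_def Suc_le_eq)
    have mD: "m * D = n" using \<open>k \<ge> 1\<close> by (cases k) (auto simp: m_def n_def)
    have n2: "n * n = D ^ (2 * k)" by (simp add: n_def power_add[symmetric] mult_2)
    have mn: "10 * k * (m * n) \<le> t"
    proof -
      have "m * n \<le> n * n" using mD D2 by (intro mult_le_mono) auto
      hence "10 * k * (m * n) \<le> 10 * k * D ^ (2 * k)" unfolding n2 by (intro mult_le_mono) auto
      thus ?thesis using D by (rule order.trans)
    qed
    have tp: "t \<le> p" using td d0 by (metis diff_le_self dvd_imp_le dvd_triv_left dual_order.trans mult_eq_0_iff neq0_conv t0 le_refl)
    have kn: "10 * k * n \<le> t"
    proof -
      have "10 * k * n \<le> 10 * k * (m * n)" using m by (intro mult_le_mono2) simp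
      thus ?thesis using mn by (rule order.trans)
    qed
    have knn: "k * n \<ge> 2" using n \<open>k \<ge> 1\<close> mult_le_mono[of 1 k 2 n] by simp
    \<comment> \<open>With \<open>2 * M \<le> n\<close> this gives
      \<open>J + M * k + 1 < 2 * J\<close>, which is what the count of unknowns requires when
      \<open>L = 1\<close>.\<close>
    define J where "J = k * n + 2"
    define M where "M = n div 2"
    have "D ^ (2 * k) \<le> 10 * k * D ^ (2 * k)" using \<open>k \<ge> 1\<close> by simp
    hence D2k: "D ^ (2 * k) \<le> t" using D by linarith
    have Dd: "D \<le> d"
    proof (rule ccontr)
      assume "\<not> D \<le> d"
      hence "d ^ (2 * k) \<le> D ^ (2 * k)" by (intro power_mono) auto
      also have "\<dots> \<le> t" by fact
      also have "\<dots> \<le> p" by fact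
      also have "p \<le> d ^ k" by fact
      finally have "d ^ (2 * k) \<le> d ^ k" .
      moreover have "d > 1" using large p2 d0 by (cases "d = 1") auto
      ultimately have "2 * k \<le> k" using power_le_imp_le_exp by blast
      thus False using \<open>k \<ge> 1\<close> by simp
    qed
    \<comment> \<open>Taking \<open>L = 1\<close> removes the term of size \<open>p\<close> from the
      degree.\<close>
    have "M * card S \<le> J + p * (1 - 1) + k * (D * t)"
      unfolding S_def
    proof (rule card_sols_stepanov[OF p as zs])
      show "0 < J" by (simp add: J_def)
      show "J \<le> p" using kn knn tp by (simp add: J_def)
      show "0 < D" using D2 by simp
      have "D * t \<le> d * t" using Dd by simp
      also have "\<dots> \<le> p" using td by (simp add: mult.commute)
      finally show "D * t \<le> p" .
      show "M \<le> p" using kn tp \<open>k \<ge> 1\<close> unfolding M_def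
        by (metis (no_types, lifting) div_le_dividend dual_order.trans mult_le_mono1 mult_1 mult.commute one_le_mult_iff one_le_numeral)
      show "multiplicity_bound D (k - 1) J \<le> t"
      proof -
        have "(m + 1) * (J + m * (k - 1) + 1) \<le> (2 * m) * (5 * (k * n))"
        proof (intro mult_le_mono)
          have "m * (k - 1) \<le> n * k" using mD D2 by (intro mult_le_mono) auto
          thus "J + m * (k - 1) + 1 \<le> 5 * (k * n)" using knn unfolding J_def by (simp add: mult.commute)
        qed (use m in auto)
        also have "\<dots> = 10 * k * (m * n)" by simp
        finally show ?thesis using mn by (simp add: multiplicity_bound_def m_def)
      qed
      show "M * (J + M * k + 1) < J * D ^ k * 1"
      proof -
        have M2: "2 * M \<le> n" by (simp add: M_def)
        have "2 * (M * (J + M * k + 1)) \<le> n * (J + M * k + 1)"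
          using mult_le_mono1[OF M2, of "J + M * k + 1"] by (simp only: mult.assoc)
        also have "\<dots> < n * (2 * J)"
        proof -
          have "M * k \<le> n * k" using M2 by (intro mult_le_mono) auto
          moreover have "x + 2 + y + 1 < 2 * (x + 2)" if "y \<le> x" for x y :: nat using that by simp
          ultimately have "J + M * k + 1 < 2 * J" unfolding J_def mult.commute[of k n] by blast
          thus ?thesis using n by (intro mult_strict_left_mono) auto
        qed
        also have "n * (2 * J) = 2 * (J * D ^ k * 1)" by (simp add: n_def)
        finally show ?thesis by (simp only: nat_mult_less_cancel_disj)
      qed
    qed
    hence main: "M * card S \<le> J + k * (D * t)" by simp
    have M3: "n \<le> 3 * M" using n by (simp add: M_def)
    have JD: "J \<le> k * (D * t)"
    proof -
      have "J \<le> 10 * k * n" using knn by (simp add: J_def)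
      also have "\<dots> \<le> t" by (fact kn)
      also have "\<dots> \<le> k * (D * t)" using \<open>k \<ge> 1\<close> D2 by (cases k; cases D) auto
      finally show ?thesis .
    qed
    have "n * card S \<le> 3 * (M * card S)" using mult_le_mono1[OF M3] by (simp add: mult.assoc)
    also have "\<dots> \<le> 3 * (2 * (k * (D * t)))" using main JD by (intro mult_le_mono2) simp
    finally have nS: "real n * card S \<le> 6 * k * D * t" by (simp flip: of_nat_mult add: mult_ac)
    have rt: "sqrt t \<le> n * sqrt T"
    proof -
      have "(D + 1) ^ (2 * k) \<le> (2 * D) ^ (2 * k)" using D2 by (intro power_mono) auto
      also have "\<dots> = 4 ^ k * (n * n)" by (simp add: power_mult_distrib n2 power_mult)
      finally have "10 * k * (D + 1) ^ (2 * k) \<le> 10 * k * (4 ^ k * (n * n))" by (rule mult_le_mono2)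
      also have "10 * k * (4 ^ k * (n * n)) = n * n * T" by (simp add: T_def mult_ac)
      finally have "t \<le> n * n * T" using D' by linarith
      hence "real t \<le> real n * real n * T" by (metis of_nat_le_iff of_nat_mult)
      hence "sqrt t \<le> sqrt (real n * real n * T)" by (rule real_sqrt_le_mono)
      thus ?thesis by (simp add: real_sqrt_mult)
    qed
    \<comment> \<open>In \<open>k\<close>-th powers: \<open>D ^ (2 * k) * (t * d) ^ k \<le> p * p ^
      k \<le> d ^ k * p ^ k\<close>.\<close>
    have Dp: "D * sqrt t \<le> sqrt p"
    proof -
      have "(real D ^ 2 * t) ^ k \<le> real p ^ k"
      proof -
        have "(D ^ 2 * t) ^ k * d ^ k = D ^ (2 * k) * (t * d) ^ k" by (simp add: power_mult_distrib power_mult)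
        also have "\<dots> \<le> t * p ^ k" using D2k td by (intro mult_le_mono power_mono) auto
        also have "\<dots> \<le> p * p ^ k" using tp by simp
        also have "\<dots> \<le> p ^ k * d ^ k" using large by simp
        finally have "(D ^ 2 * t) ^ k \<le> p ^ k" using d0 by simp
        thus ?thesis by (metis of_nat_le_iff of_nat_mult of_nat_power)
      qed
      hence "real D ^ 2 * t \<le> p" using \<open>k \<ge> 1\<close> by (subst (asm) power_mono_iff) auto
      hence "sqrt (real D ^ 2 * t) \<le> sqrt p" by (rule real_sqrt_le_mono)
      thus ?thesis by (simp add: real_sqrt_mult)
    qed
    have "real n * card S \<le> 6 * k * (D * sqrt t) * sqrt t"
    proof -
      have "6 * k * (D * sqrt t) * sqrt t = 6 * k * D * (sqrt t * sqrt t)" by (simp add: algebra_simps)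
      thus ?thesis using nS by (simp add: mult.assoc)
    qed
    also have "\<dots> \<le> 6 * k * sqrt p * (n * sqrt T)" using Dp rt by (intro mult_mono) auto
    finally have "real n * card S \<le> n * (6 * k * sqrt p * sqrt T)" by (simp add: mult_ac)
    hence "card S \<le> 6 * k * sqrt p * sqrt T" using n by simp
    also have "\<dots> \<le> 22 * T * k * sqrt p"
    proof -
      have "sqrt T \<le> T" using T1 real_sqrt_le_mono[of T "real T * real T"] by simp
      hence "(6 * k * sqrt p) * sqrt T \<le> (22 * k * sqrt p) * T" by (intro mult_mono) auto
      thus ?thesis by (simp add: mult_ac)
    qed
    finally show ?thesis by (simp add: S_def t_def T_def)
  qed
qed

section \<open>Moments of shifted classes\<close>

text \<open>The counts are bounded from above only, but they add up to almost \<open>card X\<close>,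
  so each is also bounded below with the error multiplied by the number of patterns. The average
  count may then be subtracted from every count, because the weights at \<open>b0\<close> sum to
  zero. Values of \<open>Y\<close> from \<open>d\<close> on mark an undefined class and carry weight
  zero.\<close>

lemma correlation_bound:
  fixes Y :: "'a \<Rightarrow> 'x \<Rightarrow> nat" and w :: "'a \<Rightarrow> nat \<Rightarrow> real" and e :: real
  assumes X: "finite X" and T: "finite T" "b0 \<in> T" and d: "d \<ge> 1" and e: "e \<ge> 0"
    and w: "\<And>b j. b \<in> T \<Longrightarrow> \<bar>w b j\<bar> \<le> 1" "\<And>b j. b \<in> T \<Longrightarrow> j \<ge> d \<Longrightarrow> w b j = 0"
    and mean: "(\<Sum>j<d. w b0 j) = 0"
    and count: "\<And>\<zeta>. \<zeta> \<in> T \<rightarrow>\<^sub>E {..<d} \<Longrightarrow> real (card {x\<in>X. \<forall>b\<in>T. Y b x = \<zeta> b}) \<le> real (card X) / d ^ card T + e"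
    and bot: "\<And>b. b \<in> T \<Longrightarrow> card {x\<in>X. Y b x \<ge> d} \<le> 1"
  shows "\<bar>\<Sum>x\<in>X. \<Prod>b\<in>T. w b (Y b x)\<bar> \<le> real d ^ card T * (real d ^ card T * e + card T)"
proof -
  define n where "n = d ^ card T"
  define P where "P = (T \<rightarrow>\<^sub>E {..<d})"
  define N where "N = (\<lambda>\<zeta>. card {x\<in>X. \<forall>b\<in>T. Y b x = \<zeta> b})"
  define X' where "X' = {x\<in>X. \<forall>b\<in>T. Y b x < d}"
  define cl where "cl = (\<lambda>x. restrict (\<lambda>b. Y b x) T)"
  have P: "finite P" "card P = n"
    using T by (simp_all add: P_def n_def finite_PiE card_PiE)
  have n: "real n \<ge> 1" using d by (simp add: n_def)
  have X': "finite X'" "X' \<subseteq> X" "cl ` X' \<subseteq> P"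
    using X by (auto simp: X'_def cl_def P_def)
  have fib: "{x\<in>X'. cl x = \<zeta>} = {x\<in>X. \<forall>b\<in>T. Y b x = \<zeta> b}" if "\<zeta> \<in> P" for \<zeta>
    using that by (auto simp: X'_def cl_def P_def PiE_iff extensional_def restrict_def fun_eq_iff)
  have sum_N: "(\<Sum>\<zeta>\<in>P. real (N \<zeta>) * f \<zeta>) = (\<Sum>x\<in>X'. f (cl x))" for f :: "('a \<Rightarrow> nat) \<Rightarrow> real"
  proof -
    have "(\<Sum>x\<in>X'. f (cl x)) = (\<Sum>\<zeta>\<in>P. \<Sum>x\<in>{x\<in>X'. cl x = \<zeta>}. f (cl x))"
      using sum.group[OF X'(1) P(1) X'(3), of "\<lambda>x. f (cl x)"] by simp
    also have "\<dots> = (\<Sum>\<zeta>\<in>P. real (N \<zeta>) * f \<zeta>)"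
    proof (intro sum.cong refl)
      fix \<zeta> assume "\<zeta> \<in> P"
      have "(\<Sum>x\<in>{x\<in>X'. cl x = \<zeta>}. f (cl x)) = (\<Sum>x\<in>{x\<in>X'. cl x = \<zeta>}. f \<zeta>)"
        by (intro sum.cong) auto
      thus "(\<Sum>x\<in>{x\<in>X'. cl x = \<zeta>}. f (cl x)) = real (N \<zeta>) * f \<zeta>"
        using fib[OF \<open>\<zeta> \<in> P\<close>] by (simp add: N_def)
    qed
    finally show ?thesis ..
  qed
  have "card (X - X') \<le> card (\<Union>b\<in>T. {x\<in>X. Y b x \<ge> d})"
    using X T by (intro card_mono) (auto simp: X'_def not_less)
  also have "\<dots> \<le> (\<Sum>b\<in>T. card {x\<in>X. Y b x \<ge> d})"
    using T by (intro card_UN_le)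
  also have "\<dots> \<le> (\<Sum>b\<in>T. 1)" by (intro sum_mono bot)
  finally have "card (X - X') \<le> card T" by simp
  moreover have "card X = card X' + card (X - X')"
    using X X' card_Diff_subset[OF X'(1,2)] card_mono[OF X X'(2)] by simp
  moreover have "(\<Sum>\<zeta>\<in>P. real (N \<zeta>)) = real (card X')"
    using sum_N[of "\<lambda>_. 1"] by simp
  ultimately have tot: "(\<Sum>\<zeta>\<in>P. real (N \<zeta>)) \<ge> real (card X) - card T" by simp
  have upper: "real (N \<zeta>) \<le> card X / n + e" if "\<zeta> \<in> P" for \<zeta>
    using count[of \<zeta>] that by (simp add: N_def P_def n_def)
  \<comment> \<open>The upper bounds for all other patterns together with the total
    \<open>tot\<close> bound this count from below.\<close>
  have dev: "\<bar>real (N \<zeta>) - card X / n\<bar> \<le> n * e + card T" if "\<zeta> \<in> P" for \<zeta>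
  proof -
    have "(\<Sum>\<xi>\<in>P. real (N \<xi>)) = N \<zeta> + (\<Sum>\<xi>\<in>P - {\<zeta>}. real (N \<xi>))"
      using P(1) that by (rule sum.remove)
    also have "(\<Sum>\<xi>\<in>P - {\<zeta>}. real (N \<xi>)) \<le> (\<Sum>\<xi>\<in>P - {\<zeta>}. card X / n + e)"
      by (intro sum_mono upper) auto
    also have "\<dots> = (real n - 1) * (card X / n + e)"
      using P that n by (simp add: of_nat_diff)
    also have "\<dots> = card X - card X / n + n * e - e"
      using n by (simp add: field_simps)
    finally have "real (N \<zeta>) - card X / n \<ge> - card T - n * e" using tot e by simp
    moreover have "e \<le> n * e" using n e mult_right_mono[of 1 "real n" e] by simp
    ultimately show ?thesis using upper[OF that] by (simp add: abs_le_iff)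
  qed
  have prod_bound: "\<bar>\<Prod>b\<in>T. w b (\<zeta> b)\<bar> \<le> 1" for \<zeta>
    unfolding abs_prod by (intro prod_le_1) (auto intro: w)
  have "(\<Sum>x\<in>X. \<Prod>b\<in>T. w b (Y b x)) = (\<Sum>x\<in>X'. \<Prod>b\<in>T. w b (Y b x))"
  proof (rule sum.mono_neutral_right[OF X X'(2)], rule ballI)
    fix x assume "x \<in> X - X'"
    then obtain b where "b \<in> T" "Y b x \<ge> d" by (auto simp: X'_def not_less)
    thus "(\<Prod>b\<in>T. w b (Y b x)) = 0" using T w(2)[of b "Y b x"] by (intro prod_zero bexI[of _ b]) auto
  qed
  also have "\<dots> = (\<Sum>x\<in>X'. \<Prod>b\<in>T. w b (cl x b))"
    by (intro sum.cong prod.cong) (auto simp: cl_def)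
  also have "\<dots> = (\<Sum>\<zeta>\<in>P. real (N \<zeta>) * (\<Prod>b\<in>T. w b (\<zeta> b)))"
    by (rule sum_N[symmetric])
  \<comment> \<open>The subtracted term is a product of sums over the classes, one of which is zero
    by \<open>mean\<close>.\<close>
  also have "\<dots> = (\<Sum>\<zeta>\<in>P. (real (N \<zeta>) - card X / n) * (\<Prod>b\<in>T. w b (\<zeta> b)))"
  proof -
    have "(\<Sum>\<zeta>\<in>P. (\<Prod>b\<in>T. w b (\<zeta> b))) = (\<Prod>b\<in>T. \<Sum>j<d. w b j)"
      unfolding P_def using T by (subst prod_sum_PiE) auto
    also have "\<dots> = 0" using T mean by (intro prod_zero) auto
    finally have "(\<Sum>\<zeta>\<in>P. card X / n * (\<Prod>b\<in>T. w b (\<zeta> b))) = 0"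
      by (simp only: sum_distrib_left[symmetric])
    thus ?thesis by (simp add: left_diff_distrib sum_subtractf)
  qed
  finally have "\<bar>\<Sum>x\<in>X. \<Prod>b\<in>T. w b (Y b x)\<bar> = \<bar>\<Sum>\<zeta>\<in>P. (real (N \<zeta>) - card X / n) * (\<Prod>b\<in>T. w b (\<zeta> b))\<bar>"
    by simp
  also have "\<dots> \<le> (\<Sum>\<zeta>\<in>P. \<bar>(real (N \<zeta>) - card X / n) * (\<Prod>b\<in>T. w b (\<zeta> b))\<bar>)"
    by (rule sum_abs)
  also have "\<dots> \<le> (\<Sum>\<zeta>\<in>P. (n * e + card T) * 1)"
    unfolding abs_mult using e by (intro sum_mono mult_mono dev prod_bound) auto
  also have "\<dots> = n * (n * e + card T)" using P by simp
  finally show ?thesis by (simp add: n_def)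
qed

text \<open>If every value occurs at least twice, there are at most \<open>r\<close> values, so the
  tuple factors as a map from \<open>2 * r\<close> indices to \<open>r\<close> slots followed by a
  map from the slots to \<open>A\<close>.\<close>

lemma card_nonunique_tuples:
  assumes "finite A"
  shows "card {g \<in> {..<2 * r} \<rightarrow>\<^sub>E A. \<forall>b\<in>g ` {..<2 * r}. card {i\<in>{..<2 * r}. g i = b} \<noteq> 1} \<le> r ^ (2 * r) * card A ^ r"
proof -
  define m where "m = 2 * r"
  define G where "G = {g \<in> {..<m} \<rightarrow>\<^sub>E A. \<forall>b\<in>g ` {..<m}. card {i\<in>{..<m}. g i = b} \<noteq> 1}"
  define F where "F = (\<lambda>(h, s). restrict (\<lambda>i. h (s i)) {..<m}) ` (({..<r} \<rightarrow>\<^sub>E A) \<times> ({..<m} \<rightarrow>\<^sub>E {..<r}))"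
  have fin: "finite (({..<r} \<rightarrow>\<^sub>E A) \<times> ({..<m} \<rightarrow>\<^sub>E {..<r}))"
    using assms by (intro finite_cartesian_product finite_PiE) auto
  have "G \<subseteq> F"
  proof
    fix g assume g: "g \<in> G"
    define T where "T = g ` {..<m}"
    have T: "finite T" "T \<subseteq> A" using g by (auto simp: T_def G_def)
    have "(\<Sum>b\<in>T. 2) \<le> (\<Sum>b\<in>T. card {i\<in>{..<m}. g i = b})"
    proof (rule sum_mono)
      fix b assume "b \<in> T"
      hence "card {i\<in>{..<m}. g i = b} \<noteq> 1" using g by (auto simp: G_def T_def)
      moreover have "card {i\<in>{..<m}. g i = b} \<noteq> 0" using \<open>b \<in> T\<close> by (auto simp: T_def)
      ultimately show "2 \<le> card {i\<in>{..<m}. g i = b}" by linarith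
    qed
    also have "\<dots> = card {..<m}"
      using sum.group[of "{..<m}" T g "\<lambda>_. 1::nat"] T by (simp add: T_def)
    finally have card_T: "card T \<le> r" by (simp add: m_def)
    obtain \<phi> where \<phi>: "bij_betw \<phi> {0..<card T} T" using ex_bij_betw_nat_finite[OF T(1)] by blast
    define s where "s = restrict (\<lambda>i. inv_into {0..<card T} \<phi> (g i)) {..<m}"
    \<comment> \<open>Slots beyond the number of values are filled with an arbitrary value from
      \<open>T\<close>.\<close>
    define h where "h = restrict (\<lambda>i. if i < card T then \<phi> i else \<phi> 0) {..<r}"
    have s: "s i < card T" "\<phi> (s i) = g i" if "i < m" for i
    proof -
      have "g i \<in> \<phi> ` {0..<card T}" using \<phi> that by (auto simp: bij_betw_def T_def)
      thus "s i < card T" "\<phi> (s i) = g i"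
        using that inv_into_into[of "g i" \<phi> "{0..<card T}"] by (auto simp: s_def f_inv_into_f)
    qed
    have "h \<in> {..<r} \<rightarrow>\<^sub>E A"
    proof (cases "m = 0")
      case True
      thus ?thesis by (auto simp: h_def m_def)
    next
      case False
      hence "0 < card T" using s(1)[of 0] by auto
      hence "\<phi> 0 \<in> A" "\<And>i. i < card T \<Longrightarrow> \<phi> i \<in> A" using \<phi> T by (auto simp: bij_betw_def)
      thus ?thesis by (auto simp: h_def)
    qed
    moreover have "s \<in> {..<m} \<rightarrow>\<^sub>E {..<r}"
    proof (rule PiE_I)
      fix i assume "i \<in> {..<m}"
      thus "s i \<in> {..<r}" using s(1)[of i] card_T by auto
    qed (simp add: s_def)
    moreover have "g = restrict (\<lambda>i. h (s i)) {..<m}"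
    proof
      fix i
      show "g i = restrict (\<lambda>i. h (s i)) {..<m} i"
      proof (cases "i < m")
        case True
        thus ?thesis using s[OF True] card_T by (simp add: h_def)
      qed (use g in \<open>auto simp: G_def PiE_def extensional_def\<close>)
    qed
    ultimately show "g \<in> F" unfolding F_def by (intro image_eqI[of _ _ "(h, s)"]) auto
  qed
  hence "card G \<le> card F" using fin by (intro card_mono) (auto simp: F_def)
  also have "\<dots> \<le> card (({..<r} \<rightarrow>\<^sub>E A) \<times> ({..<m} \<rightarrow>\<^sub>E {..<r}))"
    unfolding F_def using fin by (rule card_image_le)
  also have "\<dots> = r ^ m * card A ^ r"
    by (simp add: card_cartesian_product card_PiE mult.commute)
  finally show ?thesis by (simp add: G_def m_def)
qed

text \<open>The power is expanded over tuples of elements of \<open>A\<close>. Tuples without an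
  entry of multiplicity one are few and are estimated trivially; the others cancel by
  \<open>correlation_bound\<close>.\<close>

lemma moment_bound:
  fixes Y :: "'a \<Rightarrow> 'x \<Rightarrow> nat" and u :: "nat \<Rightarrow> real" and e :: real
  assumes X: "finite X" and A: "finite A" and d: "d \<ge> 1" and e: "e \<ge> 0"
    and u: "\<And>j. \<bar>u j\<bar> \<le> 1" "\<And>j. j \<ge> d \<Longrightarrow> u j = 0" "(\<Sum>j<d. u j) = 0"
    and count: "\<And>T \<zeta>. T \<subseteq> A \<Longrightarrow> T \<noteq> {} \<Longrightarrow> card T \<le> 2 * r \<Longrightarrow> \<zeta> \<in> T \<rightarrow>\<^sub>E {..<d} \<Longrightarrow>
      real (card {x\<in>X. \<forall>b\<in>T. Y b x = \<zeta> b}) \<le> real (card X) / d ^ card T + e"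
    and bot: "\<And>b. b \<in> A \<Longrightarrow> card {x\<in>X. Y b x \<ge> d} \<le> 1"
  shows "(\<Sum>x\<in>X. (\<Sum>a\<in>A. u (Y a x)) ^ (2 * r)) \<le>
     real (r ^ (2 * r)) * card A ^ r * card X + card A ^ (2 * r) * (real d ^ (2 * r) * (real d ^ (2 * r) * e + 2 * r))"
proof -
  define m where "m = 2 * r"
  define G where "G = ({..<m} \<rightarrow>\<^sub>E A)"
  define G2 where "G2 = {g\<in>G. \<forall>b\<in>g ` {..<m}. card {i\<in>{..<m}. g i = b} \<noteq> 1}"
  define s where "s = (\<lambda>g. \<Sum>x\<in>X. \<Prod>i<m. u (Y (g i) x))"
  have fin: "finite G" using A by (auto simp: G_def intro: finite_PiE)
  have "(\<Sum>x\<in>X. (\<Sum>a\<in>A. u (Y a x)) ^ m) = (\<Sum>g\<in>G. s g)"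
  proof -
    have "(\<Sum>a\<in>A. u (Y a x)) ^ m = (\<Sum>g\<in>G. \<Prod>i<m. u (Y (g i) x))" for x
      using prod_sum_PiE[of "{..<m}" "\<lambda>_. A" "\<lambda>_ a. u (Y a x)"] A by (simp add: G_def)
    thus ?thesis unfolding s_def by (simp add: sum.swap[of _ X])
  qed
  also have "\<dots> = (\<Sum>g\<in>G2. s g) + (\<Sum>g\<in>G - G2. s g)"
    using fin by (subst sum.subset_diff[of G2 G]) (auto simp: G2_def)
  also have "(\<Sum>g\<in>G2. s g) \<le> (\<Sum>g\<in>G2. real (card X))"
  proof (rule sum_mono)
    fix g
    have "(\<Prod>i<m. u (Y (g i) x)) \<le> 1" for x
    proof -
      have "\<bar>\<Prod>i<m. u (Y (g i) x)\<bar> \<le> 1"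
        unfolding abs_prod by (intro prod_le_1) (auto intro: u)
      thus ?thesis by simp
    qed
    hence "s g \<le> (\<Sum>x\<in>X. 1)" unfolding s_def by (intro sum_mono)
    thus "s g \<le> real (card X)" by simp
  qed
  also have "\<dots> = real (card G2) * card X" by simp
  also have "\<dots> \<le> real (r ^ (2 * r) * card A ^ r) * card X"
    using card_nonunique_tuples[OF A, of r]
    by (intro mult_right_mono) (auto simp: G2_def G_def m_def simp del: of_nat_mult of_nat_power)
  also have "(\<Sum>g\<in>G - G2. s g) \<le> (\<Sum>g\<in>G - G2. real d ^ m * (real d ^ m * e + m))"
  proof (rule sum_mono)
    fix g assume g: "g \<in> G - G2"
    define T where "T = g ` {..<m}"
    define c where "c = (\<lambda>b. card {i\<in>{..<m}. g i = b})"
    \<comment> \<open>At a value of multiplicity one the weight is \<open>u\<close> itself, which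
      has mean zero; higher powers of \<open>u\<close> need not.\<close>
    obtain b0 where b0: "b0 \<in> T" "c b0 = 1" using g by (auto simp: G2_def T_def c_def)
    have T: "finite T" "T \<subseteq> A" "card T \<le> m" "T \<noteq> {}"
      using g b0 card_image_le[of "{..<m}" g] by (auto simp: T_def G_def)
    have c: "c b > 0" if "b \<in> T" for b using that by (auto simp: c_def T_def card_gt_0_iff)
    have "(\<Prod>i<m. u (Y (g i) x)) = (\<Prod>b\<in>T. u (Y b x) ^ c b)" for x
    proof -
      have "(\<Prod>i<m. u (Y (g i) x)) = (\<Prod>b\<in>T. \<Prod>i\<in>{i\<in>{..<m}. g i = b}. u (Y (g i) x))"
        unfolding T_def by (rule prod.image_gen) auto
      also have "\<dots> = (\<Prod>b\<in>T. u (Y b x) ^ c b)"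
        by (intro prod.cong refl) (simp add: c_def)
      finally show ?thesis .
    qed
    hence "s g = (\<Sum>x\<in>X. \<Prod>b\<in>T. u (Y b x) ^ c b)" by (simp add: s_def)
    also have "\<dots> \<le> \<bar>\<Sum>x\<in>X. \<Prod>b\<in>T. u (Y b x) ^ c b\<bar>" by simp
    also have "\<dots> \<le> real d ^ card T * (real d ^ card T * e + card T)"
    proof (rule correlation_bound[OF X T(1) b0(1) d e, where w = "\<lambda>b j. u j ^ c b"])
      fix b j assume b: "b \<in> T"
      show "\<bar>u j ^ c b\<bar> \<le> 1" by (simp add: power_abs power_le_one u)
      show "u j ^ c b = 0" if "j \<ge> d" using u(2)[OF that] c[OF b] by simp
    qed (use u(3) b0 T count bot in \<open>auto simp: m_def\<close>)
    also have "\<dots> \<le> real d ^ m * (real d ^ m * e + m)"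
    proof -
      have "real d ^ card T \<le> real d ^ m" using d T by (intro power_increasing) auto
      thus ?thesis using e T by (intro mult_mono add_mono) auto
    qed
    finally show "s g \<le> real d ^ m * (real d ^ m * e + m)" .
  qed
  also have "\<dots> \<le> card A ^ m * (real d ^ m * (real d ^ m * e + m))"
  proof -
    have "card (G - G2) \<le> card G" using fin by (intro card_mono) auto
    also have "\<dots> = card A ^ m" by (simp add: G_def card_PiE)
    finally have "real (card (G - G2)) \<le> real (card A ^ m)" by (simp only: of_nat_le_iff)
    thus ?thesis using e by (simp add: mult_right_mono)
  qed
  finally show ?thesis by (simp add: m_def)
qed

text \<open>Double counting of pairs of a point and a \<open>k\<close>-subset of \<open>A\<close>
  all of whose elements hit it: a point with at least \<open>s\<close> hits contributes at least
  \<open>s choose k\<close> pairs. Upper bounds for \<open>k\<close>-fold intersections are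
  enough.\<close>

lemma card_many_hits:
  fixes Z :: "'a \<Rightarrow> 'x \<Rightarrow> bool" and W :: real
  assumes X: "finite X" and A: "finite A" and k: "k \<ge> 1" and W: "W \<ge> 0"
    and count: "\<And>T. T \<subseteq> A \<Longrightarrow> card T = k \<Longrightarrow> real (card {x\<in>X. \<forall>a\<in>T. Z a x}) \<le> W" and s: "s \<ge> k"
  shows "card {x\<in>X. card {a\<in>A. Z a x} \<ge> s} * (s / k) ^ k \<le> card A ^ k * W"
proof -
  define X' where "X' = {x\<in>X. card {a\<in>A. Z a x} \<ge> s}"
  define TT where "TT = {T. T \<subseteq> A \<and> card T = k}"
  have fin: "finite X'" "finite TT" using X A by (auto simp: X'_def TT_def)
  have "card X' * (s / k) ^ k \<le> card X' * real (s choose k)"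
    using binomial_ge_n_over_k_pow_k[OF s, where ?'a = real] by (intro mult_left_mono) auto
  also have "\<dots> = (\<Sum>x\<in>X'. real (s choose k))" by simp
  also have "\<dots> \<le> (\<Sum>x\<in>X'. \<Sum>T\<in>TT. if \<forall>a\<in>T. Z a x then 1 else 0)"
  proof (rule sum_mono)
    fix x assume x: "x \<in> X'"
    have "s choose k \<le> card {a\<in>A. Z a x} choose k"
      using x by (intro binomial_right_mono) (auto simp: X'_def)
    also have "\<dots> = card {T. T \<subseteq> {a\<in>A. Z a x} \<and> card T = k}"
      using A by (subst n_subsets) auto
    also have "{T. T \<subseteq> {a\<in>A. Z a x} \<and> card T = k} = {T\<in>TT. \<forall>a\<in>T. Z a x}"
      by (auto simp: TT_def)
    finally have "real (s choose k) \<le> card {T\<in>TT. \<forall>a\<in>T. Z a x}" by simp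
    also have "\<dots> = (\<Sum>T\<in>TT. if \<forall>a\<in>T. Z a x then 1 else 0)"
      using fin by (simp add: sum.If_cases Int_def)
    finally show "real (s choose k) \<le> (\<Sum>T\<in>TT. if \<forall>a\<in>T. Z a x then 1 else 0)" .
  qed
  also have "\<dots> = (\<Sum>T\<in>TT. \<Sum>x\<in>X'. if \<forall>a\<in>T. Z a x then 1 else 0)" by (rule sum.swap)
  also have "\<dots> \<le> (\<Sum>T\<in>TT. W)"
  proof (rule sum_mono)
    fix T assume "T \<in> TT"
    have "(\<Sum>x\<in>X'. if \<forall>a\<in>T. Z a x then 1 else 0) = real (card {x\<in>X'. \<forall>a\<in>T. Z a x})"
      using fin by (simp add: sum.If_cases Int_def)
    also have "\<dots> \<le> card {x\<in>X. \<forall>a\<in>T. Z a x}"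
      using X by (intro of_nat_mono card_mono) (auto simp: X'_def)
    also have "\<dots> \<le> W" using \<open>T \<in> TT\<close> by (intro count) (auto simp: TT_def)
    finally show "(\<Sum>x\<in>X'. if \<forall>a\<in>T. Z a x then 1 else 0) \<le> W" .
  qed
  also have "\<dots> = (card A choose k) * W" using A by (simp add: TT_def n_subsets)
  also have "\<dots> \<le> card A ^ k * W"
  proof -
    have "card A choose k \<le> card A ^ k"
      by (cases "k \<le> card A") (auto simp: binomial_le_pow binomial_eq_0)
    hence "real (card A choose k) \<le> real (card A ^ k)" by (simp only: of_nat_le_iff)
    thus ?thesis using W by (simp add: mult_right_mono)
  qed
  finally show ?thesis by (simp add: X'_def)
qed

section \<open>Discrete logarithms of shifted sets\<close>

text \<open>The exponent is not normalized; only its residues modulo divisors of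
  \<open>p - 1\<close> and its coprimality to \<open>p - 1\<close> matter.\<close>

definition dlog_mod :: "nat \<Rightarrow> nat \<Rightarrow> nat \<Rightarrow> nat" where
  "dlog_mod p g x = (SOME i. [g ^ i = x] (mod p))"

lemma dlog_mod:
  assumes "prime p" "residue_primroot p g" "\<not> p dvd x"
  shows "[g ^ dlog_mod p g x = x] (mod p)"
proof -
  have "p > 1" using assms(1) prime_gt_1_nat by blast
  have "coprime p x" using assms prime_imp_coprime by blast
  hence "x mod p \<in> totatives p"
    using \<open>p > 1\<close> assms(3) by (auto simp: totatives_def coprime_commute dvd_eq_mod_eq_0 intro: less_imp_le)
  then obtain i where "x mod p = g ^ i mod p"
    using residue_primroot_is_generator[OF \<open>p > 1\<close> assms(2)] by (auto simp: bij_betw_def)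
  hence "[g ^ i = x] (mod p)" by (simp add: cong_def)
  thus ?thesis unfolding dlog_mod_def by (rule someI)
qed

lemma primroot_if_coprime_dlog:
  assumes "prime p" "residue_primroot p g" "\<not> p dvd x" "coprime (dlog_mod p g x) (p - 1)"
  shows "residue_primroot p x"
proof -
  have ord: "ord p g = p - 1" "coprime p g" "p > 0"
    using assms by (auto simp: residue_primroot_def totient_prime)
  have "ord p (g ^ dlog_mod p g x) = p - 1"
    using ord assms(4) by (simp add: ord_power)
  hence "residue_primroot p (g ^ dlog_mod p g x)"
    using ord assms(1) by (simp add: residue_primroot_def totient_prime)
  thus ?thesis using residue_primroot_cong[OF dlog_mod[OF assms(1-3)]] by simp
qed

lemma dlog_class_power:
  assumes "prime p" "residue_primroot p g" "\<not> p dvd x" "d dvd p - 1"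
  shows "[x ^ ((p - 1) div d) = g ^ ((p - 1) div d * (dlog_mod p g x mod d))] (mod p)"
proof -
  define t where "t = (p - 1) div d"
  define i where "i = dlog_mod p g x"
  have td: "t * d = p - 1" using assms by (simp add: t_def)
  have "coprime g p" using assms by (auto simp: residue_primroot_def coprime_commute)
  hence fermat: "[g ^ (p - 1) = 1] (mod p)"
    using assms(1) euler_theorem[of g p] by (simp add: totient_prime)
  have "[x ^ t = (g ^ i) ^ t] (mod p)"
    using cong_pow[OF dlog_mod[OF assms(1-3)], of t] by (simp add: i_def cong_sym)
  also have "(g ^ i) ^ t = g ^ (t * (i mod d)) * (g ^ (p - 1)) ^ (i div d)"
  proof -
    have "i * t = t * (i mod d) + (p - 1) * (i div d)"
      unfolding td[symmetric] by (metis add.commute distrib_left mult.commute mult.assoc mult_div_mod_eq)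
    thus ?thesis by (simp only: power_mult[symmetric] power_add[symmetric])
  qed
  also have "[g ^ (t * (i mod d)) * (g ^ (p - 1)) ^ (i div d) = g ^ (t * (i mod d)) * 1 ^ (i div d)] (mod p)"
    by (intro cong_mult cong_refl cong_pow fermat)
  finally show ?thesis by (simp add: t_def i_def)
qed

lemma not_dvd_primroot_power: "prime p \<Longrightarrow> residue_primroot p g \<Longrightarrow> \<not> p dvd g ^ n"
  by (metis coprime_absorb_right not_prime_unit prime_dvd_power residue_primroot_def coprime_commute coprime_dvd_mult_left_iff dvd_refl coprime_common_divisor)

text \<open>The extra value \<open>d\<close> stands for the undefined logarithm of zero; it is taken
  by at most one residue x.\<close>

definition shift_class :: "nat \<Rightarrow> nat \<Rightarrow> nat \<Rightarrow> nat \<Rightarrow> nat \<Rightarrow> nat" where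
  "shift_class p g d a x = (if p dvd x + a then d else dlog_mod p g (x + a) mod d)"

lemma shift_class_fibre_subset:
  assumes p: "prime p" "residue_primroot p g" "d dvd p - 1" and T: "finite T" and \<zeta>: "\<And>b. b \<in> T \<Longrightarrow> \<zeta> b < d"
  defines "as \<equiv> sorted_list_of_set T"
  shows "{x\<in>{..<p}. \<forall>b\<in>T. shift_class p g d b x = \<zeta> b}
      \<subseteq> sols p ((p - 1) div d) as (map (\<lambda>b. g ^ ((p - 1) div d * \<zeta> b)) as)"
proof safe
  fix x assume x: "x < p" "\<forall>b\<in>T. shift_class p g d b x = \<zeta> b"
  show "x \<in> sols p ((p - 1) div d) as (map (\<lambda>b. g ^ ((p - 1) div d * \<zeta> b)) as)"
    unfolding sols_def mem_Collect_eq
  proof (intro conjI allI impI)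
    fix i assume i: "i < length as"
    hence b: "as ! i \<in> T" using T by (metis as_def nth_mem set_sorted_list_of_set)
    have "\<not> p dvd x + as ! i" "dlog_mod p g (x + as ! i) mod d = \<zeta> (as ! i)"
      using x(2) b \<zeta>[OF b] by (auto simp: shift_class_def split: if_splits)
    thus "[(x + as ! i) ^ ((p - 1) div d) = map (\<lambda>b. g ^ ((p - 1) div d * \<zeta> b)) as ! i] (mod p)"
      using dlog_class_power[OF p(1,2) _ p(3), of "x + as ! i"] i by simp
  qed (use x in auto)
qed

lemma card_shift_class_fibre:
  assumes p: "prime p" "residue_primroot p g" "d dvd p - 1" and T: "T \<subseteq> {..<p}" "T \<noteq> {}"
    and \<zeta>: "\<And>b. b \<in> T \<Longrightarrow> \<zeta> b < d"
  shows "real (card {x\<in>{..<p}. \<forall>b\<in>T. shift_class p g d b x = \<zeta> b})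
     \<le> real p / real d ^ card T + 72 * (real (card T) + 1) * (real d ^ card T) ^ 3 * sqrt p"
    and "p \<le> d ^ card T \<Longrightarrow> real (card {x\<in>{..<p}. \<forall>b\<in>T. shift_class p g d b x = \<zeta> b})
     \<le> 22 * (10 * real (card T) * 4 ^ card T) * real (card T) * sqrt p"
proof -
  define as where "as = sorted_list_of_set T"
  let ?F = "{x\<in>{..<p}. \<forall>b\<in>T. shift_class p g d b x = \<zeta> b}"
  have fin: "finite T" using T finite_subset by blast
  have as: "distinct as" "set as \<subseteq> {..<p}" "length as = card T" "card T \<ge> 1"
    using T fin by (auto simp: as_def Suc_le_eq card_gt_0_iff)
  let ?zs = "map (\<lambda>b. g ^ ((p - 1) div d * \<zeta> b)) as"
  have zs: "length ?zs = card T" "\<forall>z\<in>set ?zs. \<not> p dvd z"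
    using as(3) not_dvd_primroot_power[OF p(1,2)] by auto
  have "card ?F \<le> card (sols p ((p - 1) div d) as ?zs)"
    using shift_class_fibre_subset[OF p fin \<zeta>] by (intro card_mono) (auto simp: as_def)
  hence le: "real (card ?F) \<le> card (sols p ((p - 1) div d) as ?zs)"
    by simp
  show "real (card ?F)
     \<le> real p / real d ^ card T + 72 * (real (card T) + 1) * (real d ^ card T) ^ 3 * sqrt p"
    using le card_sols_equidistributed[OF p(1,3) as zs] by linarith
  show "real (card ?F)
     \<le> 22 * (10 * real (card T) * 4 ^ card T) * real (card T) * sqrt p" if "p \<le> d ^ card T"
    using le card_sols_large_index[OF p(1,3) as zs that] by linarith
qed

lemma card_shift_zero: "p > 0 \<Longrightarrow> card {x\<in>{..<p}. p dvd x + b} \<le> 1" for b :: nat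
proof (rule ccontr)
  assume "p > 0" "\<not> ?thesis"
  then obtain x y where "x < p" "y < p" "p dvd x + b" "p dvd y + b" "x \<noteq> y"
    by (auto simp: not_le card_le_Suc0_iff_eq)
  hence "[x + b = y + b] (mod p)" by (simp add: cong_def dvd_eq_mod_eq_0)
  hence "[x = y] (mod p)" by (simp add: cong_add_rcancel_nat)
  thus False using \<open>x < p\<close> \<open>y < p\<close> \<open>x \<noteq> y\<close> by (simp add: cong_def)
qed

text \<open>The first summand comes from the tuples without a unique entry, the other two from the
  correlation error.\<close>

definition moment_const :: "nat \<Rightarrow> real" where
  "moment_const r = r ^ (2 * r) + 72 * (2 * r + 1) + 2 * r"

lemma moment_const_nonneg: "moment_const r \<ge> 0"
  by (simp add: moment_const_def)

text \<open>Markov's inequality for the 2r-th moment. The hypothesis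
  \<open>p \<le> card A ^ (2 * r)\<close> bounds the diagonal term \<open>card A ^ r * p\<close> by
  \<open>card A ^ (2 * r) * sqrt p\<close>. In the exponent \<open>10 * r\<close>, the part
  \<open>6 * r\<close> comes from the cube in \<open>card_shift_class_fibre\<close> and
  \<open>4 * r\<close> from the two factors in \<open>correlation_bound\<close>.\<close>

lemma card_large_deviation:
  fixes h :: "nat \<Rightarrow> real" and \<tau> \<mu> :: real
  assumes p: "prime p" "residue_primroot p g" "d dvd p - 1" and A: "A \<subseteq> {..<p}" "p \<le> card A ^ (2 * r)" "r \<ge> 1"
    and h: "\<And>j. 0 \<le> h j \<and> h j \<le> 1" and \<tau>: "\<tau> > 0"
  defines "\<mu> \<equiv> (\<Sum>j<d. h j) / d"
  shows "real (card {x\<in>{..<p}. \<bar>\<Sum>a\<in>{a\<in>A. \<not> p dvd x + a}. h (dlog_mod p g (x + a) mod d) - \<mu>\<bar> \<ge> \<tau> * card A})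
     \<le> moment_const r * real d ^ (10 * r) / \<tau> ^ (2 * r) * sqrt p"
proof -
  have p2: "p \<ge> 2" using prime_ge_2_nat[OF p(1)] .
  have d: "d \<ge> 1" using p(3) p2 by (cases "d = 0") auto
  define u where "u = (\<lambda>j. if j < d then h j - \<mu> else 0)"
  define e where "e = 72 * (2 * r + 1) * real d ^ (6 * r) * sqrt p"
  define D where "D = (\<lambda>x. \<Sum>a\<in>A. u (shift_class p g d a x))"
  define X' where "X' = {x\<in>{..<p}. \<bar>D x\<bar> \<ge> \<tau> * card A}"
  let ?E = "real d ^ (2 * r) * (real d ^ (2 * r) * e + 2 * r)"
  let ?Q = "moment_const r * real d ^ (10 * r) * sqrt p"
  have fin: "finite A" using A finite_subset by blast
  have sp: "sqrt p \<ge> 1" using p2 by simp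
  have \<mu>: "0 \<le> \<mu>" "\<mu> \<le> 1"
  proof -
    show "0 \<le> \<mu>" using h by (auto simp: \<mu>_def intro!: divide_nonneg_nonneg sum_nonneg)
    have "(\<Sum>j<d. h j) \<le> (\<Sum>j<d. 1)" using h by (intro sum_mono) auto
    thus "\<mu> \<le> 1" using d by (simp add: \<mu>_def field_simps)
  qed
  have D_eq: "D x = (\<Sum>a\<in>{a\<in>A. \<not> p dvd x + a}. h (dlog_mod p g (x + a) mod d) - \<mu>)" for x
  proof -
    have "D x = (\<Sum>a\<in>{a\<in>A. \<not> p dvd x + a}. u (shift_class p g d a x))"
      unfolding D_def using fin by (intro sum.mono_neutral_right) (auto simp: u_def shift_class_def)
    also have "\<dots> = (\<Sum>a\<in>{a\<in>A. \<not> p dvd x + a}. h (dlog_mod p g (x + a) mod d) - \<mu>)"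
      using d by (intro sum.cong refl) (auto simp: u_def shift_class_def)
    finally show ?thesis .
  qed
  have "(\<Sum>x\<in>{..<p}. D x ^ (2 * r)) \<le>
     real (r ^ (2 * r)) * real (card A) ^ r * real (card {..<p}) + real (card A) ^ (2 * r) * (?E)"
    unfolding D_def
  proof (rule order.trans[OF moment_bound[OF _ fin d, where u = u and Y = "shift_class p g d" and r = r and e = e]])
    show "e \<ge> 0" by (simp add: e_def)
    show "\<bar>u j\<bar> \<le> 1" for j using h[of j] \<mu> by (auto simp: u_def abs_le_iff)
    show "u j = 0" if "d \<le> j" for j using that by (simp add: u_def)
    have "(\<Sum>j<d. u j) = (\<Sum>j<d. h j - \<mu>)" by (intro sum.cong) (auto simp: u_def)
    thus "(\<Sum>j<d. u j) = 0" using d by (simp add: sum_subtractf \<mu>_def)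
    fix T \<zeta> assume T: "T \<subseteq> A" "T \<noteq> {}" "card T \<le> 2 * r" "\<zeta> \<in> T \<rightarrow>\<^sub>E {..<d}"
    have "real (card {x\<in>{..<p}. \<forall>b\<in>T. shift_class p g d b x = \<zeta> b})
     \<le> real p / real d ^ card T + 72 * (real (card T) + 1) * (real d ^ card T) ^ 3 * sqrt p"
      using T A by (intro card_shift_class_fibre p) auto
    also have "72 * (real (card T) + 1) * (real d ^ card T) ^ 3 * sqrt p \<le> e"
    proof -
      have "(real d ^ card T) ^ 3 \<le> real d ^ (6 * r)"
        unfolding power_mult[symmetric] using d T by (intro power_increasing) auto
      thus ?thesis unfolding e_def using T by (auto intro!: mult_mono)
    qed
    finally show "real (card {x\<in>{..<p}. \<forall>b\<in>T. shift_class p g d b x = \<zeta> b}) \<le> real (card {..<p}) / real d ^ card T + e"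
      by simp
  next
    fix b
    have md: "\<not> d \<le> m mod d" for m using d by (simp add: not_le)
    have "{x\<in>{..<p}. d \<le> shift_class p g d b x} \<subseteq> {x\<in>{..<p}. p dvd x + b}"
      by (auto simp: shift_class_def md)
    hence "card {x\<in>{..<p}. d \<le> shift_class p g d b x} \<le> card {x\<in>{..<p}. p dvd x + b}" by (intro card_mono) auto
    thus "card {x\<in>{..<p}. d \<le> shift_class p g d b x} \<le> 1" using card_shift_zero[of p b] p2 by simp
  qed auto
  also have "\<dots> \<le> real (card A) ^ (2 * r) * (?Q)"
  proof -
    have a1: "real (card A) ^ r * p \<le> real (card A) ^ (2 * r) * sqrt p"
    proof -
      have "real p \<le> (real (card A) ^ r) ^ 2"
        using A(2) by (metis of_nat_le_iff of_nat_power power_mult mult.commute)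
      hence "sqrt p \<le> real (card A) ^ r" by (intro real_le_lsqrt) auto
      hence "real (card A) ^ r * (sqrt p * sqrt p) \<le> real (card A) ^ r * (real (card A) ^ r * sqrt p)"
        by (intro mult_left_mono mult_right_mono) auto
      moreover have "real (card A) ^ (2 * r) = real (card A) ^ r * real (card A) ^ r"
        by (simp only: mult_2 power_add)
      moreover have "sqrt p * sqrt p = p" by simp
      ultimately show ?thesis by (simp only: mult.assoc)
    qed
    have d1: "1 \<le> real d ^ (10 * r)" "real d ^ (2 * r) \<le> real d ^ (10 * r)"
      using d by (auto intro!: power_increasing)
    have "real (r ^ (2 * r)) * real (card A) ^ r * real (card {..<p}) \<le> real (r ^ (2 * r)) * (real (card A) ^ (2 * r) * sqrt p)"
      using a1 by (simp add: mult.assoc mult_left_mono)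
    also have "\<dots> \<le> real (r ^ (2 * r)) * (real (card A) ^ (2 * r) * sqrt p) * real d ^ (10 * r)"
      using mult_left_mono[OF d1(1), of "real (r ^ (2 * r)) * (real (card A) ^ (2 * r) * sqrt p)"]
      by (simp only: mult_1_right) (simp add: mult_nonneg_nonneg)
    finally have b1: "real (r ^ (2 * r)) * real (card A) ^ r * real (card {..<p}) \<le> real (card A) ^ (2 * r) * (real (r ^ (2 * r)) * real d ^ (10 * r) * sqrt p)"
      by (simp add: mult_ac)
    have "real d ^ (2 * r) * (real d ^ (2 * r) * e) = 72 * (2 * r + 1) * real d ^ (10 * r) * sqrt p"
      by (simp add: e_def power_add[symmetric] mult_ac)
    moreover have "real d ^ (2 * r) * (2 * r) * 1 \<le> real d ^ (10 * r) * (2 * r) * sqrt p"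
      using d1 sp by (intro mult_mono) auto
    ultimately have "?E \<le> (72 * (2 * r + 1) + 2 * r) * real d ^ (10 * r) * sqrt p"
      by (simp add: algebra_simps)
    hence "real (card A) ^ (2 * r) * (?E) \<le>
       real (card A) ^ (2 * r) * ((72 * (2 * r + 1) + 2 * r) * real d ^ (10 * r) * sqrt p)"
      by (intro mult_left_mono) auto
    from add_mono[OF b1 this] show ?thesis by (simp add: moment_const_def algebra_simps)
  qed
  finally have mom: "(\<Sum>x\<in>{..<p}. D x ^ (2 * r)) \<le> real (card A) ^ (2 * r) * (?Q)" .
  have "card X' * (\<tau> * card A) ^ (2 * r) = (\<Sum>x\<in>X'. (\<tau> * card A) ^ (2 * r))" by simp
  also have "\<dots> \<le> (\<Sum>x\<in>X'. D x ^ (2 * r))"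
  proof (rule sum_mono)
    fix x assume "x \<in> X'"
    hence "(\<tau> * card A) ^ (2 * r) \<le> \<bar>D x\<bar> ^ (2 * r)"
      using \<tau> by (intro power_mono) (auto simp: X'_def)
    thus "(\<tau> * card A) ^ (2 * r) \<le> D x ^ (2 * r)" by (simp add: power_even_abs)
  qed
  also have "\<dots> \<le> (\<Sum>x\<in>{..<p}. D x ^ (2 * r))"
    by (intro sum_mono2) (auto simp: X'_def)
  also note mom
  finally have "real (card A) ^ (2 * r) * (card X' * \<tau> ^ (2 * r)) \<le> real (card A) ^ (2 * r) * (?Q)"
    by (simp add: power_mult_distrib mult_ac)
  moreover have "real (card A) ^ (2 * r) > 0"
    using A(2) p2 by (cases "card A = 0") (auto simp: power_0_left split: if_splits)
  ultimately have "card X' * \<tau> ^ (2 * r) \<le> ?Q" by simp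
  hence "card X' \<le> ?Q / \<tau> ^ (2 * r)"
    using \<tau> by (simp add: field_simps)
  thus ?thesis by (simp add: X'_def D_eq)
qed

text \<open>For \<open>p \<le> l ^ k\<close> the \<open>k\<close>-fold intersections have size of
  order \<open>sqrt p\<close>, and \<open>card_many_hits\<close> takes the place of the moments. The
  condition \<open>\<tau> * card A \<ge> k\<close> provides \<open>k\<close>-subsets to
  count.\<close>

lemma card_large_prime_hits:
  fixes \<tau> :: real
  assumes p: "prime p" "residue_primroot p g" "l dvd p - 1" and A: "A \<subseteq> {..<p}"
    and k: "k \<ge> 1" "p \<le> l ^ k" and \<tau>: "\<tau> > 0" "\<tau> * card A \<ge> k"
  shows "real (card {x\<in>{..<p}. real (card {a\<in>A. \<not> p dvd x + a \<and> l dvd dlog_mod p g (x + a)}) \<ge> \<tau> * card A})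
     \<le> (22 * (10 * real k * 4 ^ k) * real k) * (real k / \<tau>) ^ k * sqrt p"
proof -
  define W where "W = 22 * (10 * real k * 4 ^ k) * real k * sqrt p"
  define s where "s = nat \<lceil>\<tau> * card A\<rceil>"
  have fin: "finite A" using A finite_subset by blast
  have p2: "p \<ge> 2" using prime_ge_2_nat[OF p(1)] .
  have l: "l > 0" using p(3) p2 by (cases "l = 0") auto
  have s: "s \<ge> k" "real s \<ge> \<tau> * card A"
    using \<tau> unfolding s_def by linarith+
  have c0: "card A > 0" using \<tau> k by (cases "card A") auto
  let ?Z = "\<lambda>a x. \<not> p dvd x + a \<and> l dvd dlog_mod p g (x + a)"
  define X' where "X' = {x\<in>{..<p}. card {a\<in>A. ?Z a x} \<ge> s}"
  have "card X' * (real s / real k) ^ k \<le> real (card A) ^ k * W"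
    unfolding X'_def
  proof (rule order.trans[OF card_many_hits[OF _ fin k(1) _ _ s(1), where Z = ?Z and W = W]])
    show "W \<ge> 0" by (simp add: W_def)
    fix T assume T: "T \<subseteq> A" "card T = k"
    have "{x\<in>{..<p}. \<forall>a\<in>T. ?Z a x} \<subseteq> {x\<in>{..<p}. \<forall>b\<in>T. shift_class p g l b x = 0}"
      by (auto simp: shift_class_def dvd_eq_mod_eq_0)
    hence "real (card {x\<in>{..<p}. \<forall>a\<in>T. ?Z a x}) \<le> card {x\<in>{..<p}. \<forall>b\<in>T. shift_class p g l b x = 0}"
      by (intro of_nat_mono card_mono) auto
    also have "\<dots> \<le> W"
      using card_shift_class_fibre(2)[OF p, of T "\<lambda>_. 0"] T A k l by (force simp: W_def)
    finally show "real (card {x\<in>{..<p}. \<forall>a\<in>T. ?Z a x}) \<le> W" .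
  qed auto
  moreover have "(\<tau> * card A / k) ^ k \<le> (real s / real k) ^ k"
    using s \<tau> by (intro power_mono divide_right_mono) auto
  ultimately have "card X' * (\<tau> * card A / k) ^ k \<le> real (card A) ^ k * W"
    by (meson mult_left_mono of_nat_0_le_iff order_trans)
  hence "real (card A) ^ k * (card X' * (\<tau> / k) ^ k) \<le> real (card A) ^ k * W"
    by (simp add: power_mult_distrib power_divide mult_ac)
  hence "card X' * (\<tau> / k) ^ k \<le> W" using c0 by simp
  hence "card X' \<le> W * (k / \<tau>) ^ k"
    using \<tau> k by (simp add: field_simps power_divide)
  moreover have "X' = {x\<in>{..<p}. real (card {a\<in>A. ?Z a x}) \<ge> \<tau> * card A}"
    unfolding X'_def s_def by (auto simp: nat_le_iff ceiling_le_iff)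
  ultimately show ?thesis by (simp add: W_def mult_ac)
qed

section \<open>Chebyshev bounds\<close>

lemma prime_factors_prod_primes:
  fixes S :: "nat set"
  assumes "finite S" "\<And>l. l \<in> S \<Longrightarrow> prime l"
  shows "prime_factors (\<Prod>S) = S"
proof -
  have "0 \<notin> (\<lambda>x. x) ` S" using assms(2) by fastforce
  hence "prime_factors (\<Prod>x\<in>S. x) = \<Union>((prime_factors \<circ> (\<lambda>x. x)) ` S)"
    using assms(1) by (intro prime_factors_prod) auto
  thus ?thesis using assms(2) by (auto simp: prime_prime_factors)
qed

lemma prod_primes_dvd:
  fixes S :: "nat set"
  assumes "finite S" "\<And>l. l \<in> S \<Longrightarrow> prime l" "\<And>l. l \<in> S \<Longrightarrow> l dvd n"
  shows "\<Prod>S dvd n"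
  using assms
proof (induction S rule: finite_induct)
  case (insert l S)
  have "coprime l (\<Prod>S)"
  proof (rule prod_coprime_right)
    fix l' assume "l' \<in> S"
    thus "coprime l l'" using insert.hyps insert.prems(1)[of l] insert.prems(1)[of l'] primes_coprime[of l l'] by auto
  qed
  thus ?case using insert by (simp add: divides_mult)
qed auto

text \<open>Leibniz's harmonic triangle: the reciprocal of \<open>Suc k * (n choose Suc k)\<close>
  is the difference of the reciprocals of \<open>k * ((n - 1) choose k)\<close> and
  \<open>k * (n choose k)\<close>. After multiplication by \<open>M\<close> the two terms of the
  difference are integers by induction.\<close>

lemma mult_binomial_dvd:
  fixes M :: nat
  assumes "1 \<le> k" "k \<le> n" "\<And>i. 1 \<le> i \<Longrightarrow> i \<le> n \<Longrightarrow> i dvd M"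
  shows "k * (n choose k) dvd M"
  using assms
proof (induction k arbitrary: n rule: nat_induct_at_least)
  case base
  thus ?case by simp
next
  case (Suc k)
  obtain m where n: "n = Suc m" using Suc.prems by (cases n) auto
  have "k * (n choose k) dvd M" "k * (m choose k) dvd M"
    using Suc.prems Suc.IH[of n] Suc.IH[of m] n by auto
  then obtain x y where x: "M = k * (m choose k) * x" and y: "M = k * (n choose k) * y" by (elim dvdE)
  define c where "c = int (Suc k * (n choose Suc k))"
  have c1: "c = int n * int (m choose k)"
  proof -
    have "Suc k * (Suc m choose Suc k) = Suc m * (m choose k)"
      using Suc_times_binomial_eq[of m k] by (simp only: mult.commute)
    thus ?thesis unfolding c_def n by (metis of_nat_mult)
  qed
  have c2: "c = (int n - int k) * int (n choose k)"
  proof -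
    have "Suc k * (n choose Suc k) = (n - k) * (n choose k)"
      using binomial_absorption[of k n] binomial_absorb_comp[of n k] n by (simp add: mult.commute)
    thus ?thesis unfolding c_def using Suc.prems by (simp add: of_nat_diff)
  qed
  have "int k * (c * (int x - int y)) = int n * int M - (int n - int k) * int M"
  proof -
    have "int k * (c * int x) = int n * int M" unfolding c1 x by (simp add: mult_ac)
    moreover have "int k * (c * int y) = (int n - int k) * int M" unfolding c2 y by (simp add: mult_ac)
    ultimately show ?thesis by (simp add: right_diff_distrib)
  qed
  also have "\<dots> = int k * int M" by (simp add: algebra_simps)
  finally have "int M = c * (int x - int y)" using Suc.hyps by simp
  hence "c dvd int M" by simp
  thus ?case by (simp only: c_def int_dvd_int_iff)
qed

lemma prime_power_dvd_Lcm:
  fixes X :: "nat set"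
  assumes "prime q" "finite X" "X \<noteq> {}" "0 \<notin> X" "q ^ e dvd Lcm X"
  shows "\<exists>x\<in>X. q ^ e dvd x"
  using assms(2-)
proof (induction X rule: finite_ne_induct)
  case (insert x X)
  have "Lcm X \<noteq> 0" using insert by (auto simp: Lcm_0_iff)
  moreover have "x \<noteq> 0" using insert by auto
  ultimately have "multiplicity q (lcm x (Lcm X)) = max (multiplicity q x) (multiplicity q (Lcm X))"
    using assms(1) by (intro multiplicity_lcm) auto
  moreover have "q ^ e dvd lcm x (Lcm X)" using insert.prems by simp
  hence "e \<le> multiplicity q (lcm x (Lcm X))"
    using \<open>x \<noteq> 0\<close> \<open>Lcm X \<noteq> 0\<close> assms(1) by (subst (asm) power_dvd_iff_le_multiplicity) auto
  ultimately have "e \<le> multiplicity q x \<or> e \<le> multiplicity q (Lcm X)" by (auto simp: max_def split: if_splits)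
  thus ?case using insert multiplicity_dvd' by auto
qed auto

text \<open>The binomial coefficient divides the least common multiple of 1, ..., n, and a prime
  power dividing that multiple divides one of these numbers.\<close>

lemma prime_power_dvd_binomial_le:
  assumes "prime q" "1 \<le> k" "k \<le> n" "q ^ e dvd (n choose k)"
  shows "q ^ e \<le> n"
proof -
  have "k * (n choose k) dvd Lcm {1..n}"
    using assms by (intro mult_binomial_dvd) auto
  hence "q ^ e dvd Lcm {1..n}" using assms(4) by (meson dvd_mult dvd_trans)
  then obtain x where "x \<in> {1..n}" "q ^ e dvd x"
    using prime_power_dvd_Lcm[OF assms(1), of "{1..n}" e] assms by auto
  thus ?thesis using dvd_imp_le[of "q ^ e" x] by auto
qed

definition primes_le :: "nat \<Rightarrow> nat set" where
  "primes_le n = {l. prime l \<and> l \<le> n}"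

lemma finite_primes_le [simp]: "finite (primes_le n)"
  unfolding primes_le_def by (rule finite_subset[of _ "{..n}"]) auto

text \<open>The central binomial coefficient is at least 2^m and is a product of prime powers, each
  of them at most \<open>2 * m\<close>.\<close>

lemma chebyshev_lower:
  assumes "m \<ge> 1"
  shows "2 ^ m \<le> (2 * m) ^ card (primes_le (2 * m))"
proof -
  define c where "c = (2 * m) choose m"
  have c0: "c > 0" by (simp add: c_def)
  have "real 2 ^ m \<le> real c"
    using binomial_ge_n_over_k_pow_k[of m "2 * m", where ?'a = real] assms by (simp add: c_def)
  hence "2 ^ m \<le> c" by (metis of_nat_le_iff of_nat_numeral of_nat_power)
  also have "c = (\<Prod>q\<in>prime_factors c. q ^ multiplicity q c)"
    using c0 by (simp add: prime_factorization_nat)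
  also have "\<dots> \<le> (\<Prod>q\<in>prime_factors c. 2 * m)"
    using assms by (intro prod_mono) (auto intro!: prime_power_dvd_binomial_le[of _ m] simp: c_def multiplicity_dvd)
  also have "\<dots> = (2 * m) ^ card (prime_factors c)" by simp
  also have "\<dots> \<le> (2 * m) ^ card (primes_le (2 * m))"
  proof (rule power_increasing)
    have "q \<le> 2 * m" if "prime q" "q dvd c" for q
      using prime_power_dvd_binomial_le[of q m "2 * m" 1] that assms by (simp add: c_def)
    thus "card (prime_factors c) \<le> card (primes_le (2 * m))"
      by (intro card_mono) (auto simp: primes_le_def)
  qed (use assms in auto)
  finally show ?thesis .
qed

text \<open>Erdos's argument: for \<open>n = 2 * m + 1\<close> the primes above \<open>m + 1\<close>
  divide \<open>n choose m\<close>, which is at most 4^m.\<close>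

lemma primorial_le:
  "\<Prod>(primes_le n) \<le> 4 ^ n"
proof (induction n rule: less_induct)
  case (less n)
  consider "n = 0" | "n = 1" | "n = 2" | "n > 2" "even n" | m where "n = 2 * m + 1" "m \<ge> 1"
    by (metis One_nat_def Suc_1 Suc_lessI add_eq_if le_simps(3) less_one linorder_neqE_nat mult_0_right neq0_conv oddE)
  thus ?case
  proof cases
    case 1
    hence "primes_le n = {}" by (auto simp: primes_le_def dest: prime_ge_2_nat)
    thus ?thesis by simp
  next
    case 2
    hence "primes_le n = {}" by (auto simp: primes_le_def dest: prime_ge_2_nat)
    thus ?thesis by simp
  next
    case 3
    hence "primes_le n = {2}" by (auto simp: primes_le_def dest: prime_ge_2_nat)
    thus ?thesis using 3 by simp
  next
    case 4
    hence "\<not> prime n" using prime_odd_nat by auto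
    hence "primes_le n = primes_le (n - 1)"
      by (auto simp: primes_le_def) (metis Suc_pred le_SucE not_gr_zero not_prime_0 le_0_eq)
    hence "\<Prod>(primes_le n) \<le> 4 ^ (n - 1)" using less.IH[of "n - 1"] 4 by simp
    also have "\<dots> \<le> 4 ^ n" by (intro power_increasing) auto
    finally show ?thesis .
  next
    case (5 m)
    define P where "P = {l. prime l \<and> m + 1 < l \<and> l \<le> n}"
    define c where "c = n choose m"
    have un: "primes_le n = primes_le (m + 1) \<union> P" "primes_le (m + 1) \<inter> P = {}" "finite P"
      using 5 finite_subset[of P "{..n}"] by (auto simp: primes_le_def P_def)
    have "\<Prod>P dvd c"
    proof (rule prod_primes_dvd)
      fix l assume l: "l \<in> P"
      have "l dvd fact n" using l prime_dvd_fact_iff[of l n] by (auto simp: P_def)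
      moreover have "fact n = fact m * fact (m + 1) * c"
        using binomial_fact_lemma[of m n] 5 by (simp add: c_def mult_ac)
      moreover have "\<not> l dvd fact m" "\<not> l dvd fact (m + 1)"
        using l prime_dvd_fact_iff[of l] by (auto simp: P_def simp del: fact_Suc)
      ultimately show "l dvd c" using l by (auto simp: P_def prime_dvd_mult_iff simp del: fact_Suc)
    qed (use un in \<open>auto simp: P_def\<close>)
    moreover have "c > 0" using 5 by (simp add: c_def)
    ultimately have "\<Prod>P \<le> c" by (rule dvd_imp_le)
    also have "c \<le> 4 ^ m"
    proof -
      have "c + (n choose (m + 1)) = (\<Sum>k\<in>{m, m + 1}. n choose k)" by (simp add: c_def)
      also have "\<dots> \<le> (\<Sum>k\<le>n. n choose k)" using 5 by (intro sum_mono2) auto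
      also have "\<dots> = 2 ^ n" by (rule choose_row_sum)
      also have "\<dots> = 2 * 4 ^ m" using 5 by (simp add: power_mult)
      finally show ?thesis using binomial_symmetric[of m n] 5 by (simp add: c_def)
    qed
    finally have P: "\<Prod>P \<le> 4 ^ m" .
    have "\<Prod>(primes_le n) = \<Prod>(primes_le (m + 1)) * \<Prod>P"
      unfolding un(1) using un by (intro prod.union_disjoint) auto
    also have "\<dots> \<le> 4 ^ (m + 1) * 4 ^ m"
      using less.IH[of "m + 1"] 5 P by (intro mult_le_mono) auto
    also have "\<dots> = 4 ^ n" using 5 by (simp add: power_add[symmetric])
    finally show ?thesis .
  qed
qed

section \<open>Primitive roots in sumsets\<close>

text \<open>The i-th smallest element is at least i + 1, and the product of 1 - 1/(i + 1)
  telescopes. It bounds the density of residues coprime to the small primes from below.\<close>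

lemma prod_one_minus_inverse_ge:
  fixes S :: "nat set"
  assumes "finite S" "\<And>l. l \<in> S \<Longrightarrow> l \<ge> 2"
  shows "(\<Prod>l\<in>S. 1 - 1 / real l) \<ge> 1 / (card S + 1)"
  using assms
proof (induction rule: finite_linorder_max_induct)
  case (insert b S)
  have "insert b S \<subseteq> {2..b}" using insert by (auto simp: less_imp_le)
  hence "card (insert b S) \<le> card {2..b}" by (intro card_mono) auto
  hence b: "real b \<ge> card S + 2" using insert.prems[of b] insert.hyps by (auto simp: card_insert_if split: if_splits)
  have "1 / (card (insert b S) + 1) = (1 - 1 / (card S + 2)) * (1 / (real (card S) + 1))"
    using insert.hyps by (auto simp: field_simps card_insert_if)
  also have "\<dots> \<le> (1 - 1 / real b) * (\<Prod>l\<in>S. 1 - 1 / real l)"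
  proof (rule mult_mono)
    show "1 / (real (card S) + 1) \<le> (\<Prod>l\<in>S. 1 - 1 / real l)"
      using insert.IH insert.prems by (simp add: add.commute)
  qed (use b in \<open>auto simp: frac_le\<close>)
  finally show ?case using insert.hyps by auto
qed auto

lemma card_coprime_below:
  assumes "d > 0"
  shows "card {j\<in>{..<d}. coprime j d} = totient d"
proof (cases "d = 1")
  case False
  hence "{j\<in>{..<d}. coprime j d} = totatives d"
    using assms by (auto simp: totatives_def intro: le_neq_implies_less gr0I)
  thus ?thesis by (simp add: totient_def)
qed (auto simp: lessThan_Suc)

lemma card_coprime_multiples_below:
  assumes "d > 0" "l > 0" "coprime l d"
  shows "card {j\<in>{..<d * l}. coprime j d \<and> l dvd j} = totient d"
proof -
  have "{j\<in>{..<d * l}. coprime j d \<and> l dvd j} = (\<lambda>i. l * i) ` {i\<in>{..<d}. coprime i d}"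
    using assms by (auto simp: mult.commute elim!: dvdE)
  thus ?thesis using assms card_coprime_below[OF assms(1)] by (simp add: card_image inj_on_def)
qed

definition hits_const :: "nat \<Rightarrow> real" where
  "hits_const k = (22 * (10 * real k * 4 ^ k) * real k) * real k ^ k"

text \<open>The bounds on exceptional shifts add up to less than \<open>card B\<close>, so some
  \<open>b\<close> behaves as expected for all prime divisors at once. For it the number of
  \<open>a\<close> whose logarithm is coprime to \<open>\<Prod>S\<close> is about
  \<open>\<mu> * card A\<close>; the primes in \<open>M\<close> spoil about half of these at most,
  and each prime in \<open>L\<close> fewer than \<open>\<tau> * card A\<close>. Any remaining
  \<open>a\<close> gives a logarithm coprime to \<open>p - 1\<close>.\<close>

theorem sumset_contains_primroot:
  fixes \<tau> R :: real
  defines "w \<equiv> \<lambda>p. real (card (prime_factors (p - 1)))"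
  assumes p: "prime p" "p > 2" and A: "A \<subseteq> {..<p}" "p \<le> card A ^ (2 * r)" "card A \<ge> 2" and B: "B \<subseteq> {..<p}"
    and rk: "r \<ge> 1" "k \<ge> 1" and split: "prime_factors (p - 1) = S \<union> M \<union> L" "S \<inter> M = {}"
    and R: "real (\<Prod>S) \<le> R" "\<And>l. l \<in> M \<Longrightarrow> real (\<Prod>S * l) \<le> R" and L: "\<And>l. l \<in> L \<Longrightarrow> p \<le> l ^ k"
    and M: "(\<Sum>l\<in>M. 1 / real l) \<le> 1 / 2"
    and \<tau>: "\<tau> > 0" "8 * \<tau> * (w p + 1) ^ 2 \<le> 1" "\<tau> * card A \<ge> k"
    and big: "(w p + 1) * (moment_const r * R ^ (10 * r) / \<tau> ^ (2 * r) + hits_const k / \<tau> ^ k) * sqrt p < card B"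
  shows "\<exists>a\<in>A. \<exists>b\<in>B. residue_primroot p (a + b)"
proof -
  obtain g where g: "residue_primroot p g" using prime_primitive_root_exists[of p] p by auto
  define d where "d = \<Prod>S"
  define W where "W = w p"
  define \<mu> where "\<mu> = totient d / real d"
  have fin: "finite S" "finite M" "finite L" "finite A" "finite B"
  proof -
    have "finite (S \<union> M \<union> L)" unfolding split(1)[symmetric] by simp
    thus "finite S" "finite M" "finite L" by auto
  qed (use A(1) B finite_subset in blast)+
  have pr: "prime l" "l dvd p - 1" if "l \<in> S \<union> M \<union> L" for l
    using that unfolding split(1)[symmetric] by auto
  have card_le: "real (card S) \<le> W" "real (card M) \<le> W" "real (card L) \<le> W"
    unfolding W_def w_def split(1) of_nat_le_iff by (intro card_mono; use fin in auto)+
  have W0: "W \<ge> 0" by (simp add: W_def w_def)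
  have d: "d dvd p - 1" unfolding d_def by (rule prod_primes_dvd) (use fin pr in auto)
  have d0: "d > 0" using d p by (cases "d = 0") auto
  have cop: "coprime l d" if "l \<in> M" for l
    unfolding d_def
  proof (rule prod_coprime_right)
    fix l' assume "l' \<in> S"
    thus "coprime l l'" using that split(2) pr primes_coprime[of l l'] by auto
  qed
  have dl: "d * l dvd p - 1" if "l \<in> M" for l
    using cop[OF that] d pr that by (intro divides_mult) (auto simp: coprime_commute)
  have \<mu>: "\<mu> \<ge> 1 / (W + 1)" "\<mu> > 0"
  proof -
    have "\<mu> = (\<Prod>l\<in>S. 1 - 1 / real l)"
    proof -
      have "prime_factors d = S" unfolding d_def using fin pr by (intro prime_factors_prod_primes) auto
      hence "real (totient d) = real d * (\<Prod>l\<in>S. 1 - 1 / real l)" using totient_formula2[of d] by simp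
      thus ?thesis using d0 by (simp add: \<mu>_def)
    qed
    also have "\<dots> \<ge> 1 / (card S + 1)"
      using fin pr prime_ge_2_nat by (intro prod_one_minus_inverse_ge) auto
    finally have "1 / (real (card S) + 1) \<le> \<mu>" by (simp add: add.commute)
    moreover have "1 / (W + 1) \<le> 1 / (real (card S) + 1)" using card_le by (intro frac_le) auto
    ultimately show "\<mu> \<ge> 1 / (W + 1)" by linarith
    moreover have "1 / (W + 1) > 0" using W0 by simp
    ultimately show "\<mu> > 0" by linarith
  qed
  define i where "i = (\<lambda>x. dlog_mod p g x)"
  define Ax where "Ax = (\<lambda>x. {a\<in>A. \<not> p dvd x + a})"
  define h1 where "h1 = (\<lambda>j. if coprime j d then 1 else 0 :: real)"
  define h2 where "h2 = (\<lambda>l j. if coprime j d \<and> l dvd j then 1 else 0 :: real)"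
  \<comment> \<open>The sets \<open>E1\<close>, \<open>E2 l\<close> and \<open>E3 l\<close> collect
    the exceptional shifts for the small, the medium and the large primes.\<close>
  define E1 where "E1 = {x\<in>{..<p}. \<bar>\<Sum>a\<in>Ax x. h1 (i (x + a) mod d) - \<mu>\<bar> \<ge> \<tau> * card A}"
  \<comment> \<open>Coprimality to \<open>d\<close> and divisibility by \<open>l\<close> are tested
    jointly, hence the modulus \<open>d * l\<close> and the mean \<open>\<mu> / l\<close>.\<close>
  define E2 where "E2 = (\<lambda>l. {x\<in>{..<p}. \<bar>\<Sum>a\<in>Ax x. h2 l (i (x + a) mod (d * l)) - \<mu> / l\<bar> \<ge> \<tau> * card A})"
  define E3 where "E3 = (\<lambda>l. {x\<in>{..<p}. real (card {a\<in>A. \<not> p dvd x + a \<and> l dvd i (x + a)}) \<ge> \<tau> * card A})"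
  define Q1 where "Q1 = moment_const r * R ^ (10 * r) / \<tau> ^ (2 * r) * sqrt p"
  define Q3 where "Q3 = hits_const k / \<tau> ^ k * sqrt p"
  let ?bad = "(\<Union>l\<in>M. E2 l) \<union> (\<Union>l\<in>L. E3 l)"
  have Rpow: "moment_const r * real n ^ (10 * r) / \<tau> ^ (2 * r) * sqrt p \<le> Q1" if "real n \<le> R" for n
    unfolding Q1_def using that \<tau> moment_const_nonneg
    by (intro mult_right_mono divide_right_mono mult_left_mono power_mono) auto
  have E1: "real (card E1) \<le> Q1"
  proof -
    have "(\<Sum>j<d. h1 j) = totient d"
      unfolding card_coprime_below[OF d0, symmetric] h1_def by (simp add: sum.If_cases Int_def)
    hence "real (card E1) \<le> moment_const r * real d ^ (10 * r) / \<tau> ^ (2 * r) * sqrt p"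
      using card_large_deviation[OF p(1) g d A(1,2) rk(1), of h1 \<tau>] \<tau>
      by (simp add: E1_def Ax_def i_def \<mu>_def h1_def)
    also have "\<dots> \<le> Q1" using R(1) by (intro Rpow) (simp add: d_def)
    finally show ?thesis .
  qed
  have E2: "real (card (E2 l)) \<le> Q1" if l: "l \<in> M" for l
  proof -
    have l0: "l > 0" using pr[of l] l prime_gt_0_nat by auto
    have "(\<Sum>j<d * l. h2 l j) = totient d"
      unfolding card_coprime_multiples_below[OF d0 l0 cop[OF l], symmetric] h2_def by (simp add: sum.If_cases Int_def)
    hence "(\<Sum>j<d * l. h2 l j) / real (d * l) = \<mu> / l" by (simp add: \<mu>_def)
    hence "real (card (E2 l)) \<le> moment_const r * real (d * l) ^ (10 * r) / \<tau> ^ (2 * r) * sqrt p"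
      using card_large_deviation[OF p(1) g dl[OF l] A(1,2) rk(1), of "h2 l" \<tau>] \<tau>(1)
      unfolding E2_def Ax_def i_def by (simp add: h2_def)
    also have "\<dots> \<le> Q1" using R(2)[OF l] by (intro Rpow) (simp add: d_def)
    finally show ?thesis .
  qed
  have E3: "real (card (E3 l)) \<le> Q3" if l: "l \<in> L" for l
    using card_large_prime_hits[OF p(1) g _ A(1) rk(2) L[OF l] \<tau>(1,3)] pr(2)[of l] l
    by (simp add: E3_def i_def Q3_def hits_const_def power_divide)
  have "\<exists>b\<in>B. b \<notin> E1 \<and> (\<forall>l\<in>M. b \<notin> E2 l) \<and> (\<forall>l\<in>L. b \<notin> E3 l)"
  proof (rule ccontr)
    assume "\<not> ?thesis"
    hence "B \<subseteq> E1 \<union> (?bad)" by blast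
    hence "card B \<le> card (E1 \<union> (?bad))"
      using fin by (intro card_mono) (auto simp: E1_def E2_def E3_def)
    also have "\<dots> \<le> card E1 + (card (\<Union>l\<in>M. E2 l) + card (\<Union>l\<in>L. E3 l))"
      by (intro order.trans[OF card_Un_le] add_mono) auto
    also have "\<dots> \<le> card E1 + ((\<Sum>l\<in>M. card (E2 l)) + (\<Sum>l\<in>L. card (E3 l)))"
      using fin by (intro add_mono card_UN_le) auto
    finally have "real (card B) \<le> real (card E1) + ((\<Sum>l\<in>M. real (card (E2 l))) + (\<Sum>l\<in>L. real (card (E3 l))))"
      by (simp flip: of_nat_sum of_nat_add)
    also have "\<dots> \<le> Q1 + ((\<Sum>l\<in>M. Q1) + (\<Sum>l\<in>L. Q3))"
      by (intro add_mono sum_mono E1 E2 E3)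
    also have "\<dots> = Q1 + (card M * Q1 + card L * Q3)" by simp
    also have "\<dots> \<le> Q1 + (W * Q1 + (W + 1) * Q3)"
    proof -
      have "R \<ge> 0" using R(1) by (meson of_nat_0_le_iff order_trans)
      hence "Q1 \<ge> 0" "Q3 \<ge> 0" using \<tau> moment_const_nonneg by (auto simp: Q1_def Q3_def hits_const_def)
      thus ?thesis using card_le by (intro add_mono mult_right_mono) auto
    qed
    also have "\<dots> = (W + 1) * (Q1 + Q3)" by (simp add: algebra_simps)
    also have "\<dots> = (w p + 1) * (moment_const r * R ^ (10 * r) / \<tau> ^ (2 * r) + hits_const k / \<tau> ^ k) * sqrt p"
      by (simp add: Q1_def Q3_def W_def algebra_simps)
    finally show False using big by simp
  qed
  then obtain b where b: "b \<in> B" "b \<notin> E1" "\<And>l. l \<in> M \<Longrightarrow> b \<notin> E2 l" "\<And>l. l \<in> L \<Longrightarrow> b \<notin> E3 l"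
    by blast
  have bp: "b < p" using b B by auto
  define c1 where "c1 = {a\<in>Ax b. coprime (i (b + a)) d}"
  define c2 where "c2 = (\<lambda>l. {a\<in>Ax b. coprime (i (b + a)) d \<and> l dvd i (b + a)})"
  define c3 where "c3 = (\<lambda>l. {a\<in>A. \<not> p dvd b + a \<and> l dvd i (b + a)})"
  define N where "N = real (card (Ax b))"
  have finx: "finite (Ax b)" using fin by (simp add: Ax_def)
  have N: "N \<ge> real (card A) - 1" "N \<le> card A"
  proof -
    have "card (A - Ax b) \<le> card {x\<in>{..<p}. p dvd x + b}"
      using A(1) by (intro card_mono) (auto simp: Ax_def add.commute)
    also have "\<dots> \<le> 1" using card_shift_zero[of p b] p by simp
    finally have "card (A - Ax b) \<le> 1" .
    moreover have "card (A - Ax b) = card A - card (Ax b)" "card (Ax b) \<le> card A"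
      using fin by (auto simp: card_Diff_subset Ax_def intro!: card_mono)
    ultimately show "N \<ge> real (card A) - 1" "N \<le> card A" unfolding N_def by linarith+
  qed
  have c1: "real (card c1) > \<mu> * N - \<tau> * card A"
  proof -
    have "coprime (i (b + a) mod d) d \<longleftrightarrow> coprime (i (b + a)) d" for a
      using d0 by (simp add: coprime_mod_left_iff)
    hence "(\<Sum>a\<in>Ax b. h1 (i (b + a) mod d) - \<mu>) = real (card c1) - \<mu> * N"
      using finx by (simp add: sum_subtractf h1_def sum.If_cases c1_def N_def Int_def mult.commute)
    thus ?thesis using b(2) bp by (simp add: E1_def)
  qed
  have c2: "real (card (c2 l)) < \<mu> * N * (1 / l) + \<tau> * card A" if l: "l \<in> M" for l
  proof -
    have "coprime (i (b + a) mod (d * l)) d \<longleftrightarrow> coprime (i (b + a)) d" for a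
      using d0 by (metis coprime_mod_left_iff mod_mod_cancel dvd_triv_left neq0_conv)
    moreover have "l dvd i (b + a) mod (d * l) \<longleftrightarrow> l dvd i (b + a)" for a
      by (simp add: dvd_mod_iff)
    ultimately have "(\<Sum>a\<in>Ax b. h2 l (i (b + a) mod (d * l)) - \<mu> / l) = real (card (c2 l)) - \<mu> * N * (1 / l)"
      using finx by (simp add: sum_subtractf h2_def sum.If_cases c2_def N_def Int_def mult.commute)
    thus ?thesis using b(3)[OF l] bp by (simp add: E2_def)
  qed
  have c3: "real (card (c3 l)) < \<tau> * card A" if "l \<in> L" for l
    using b(4)[OF that] bp by (simp add: E3_def c3_def)
  have "\<not> c1 \<subseteq> (\<Union>l\<in>M. c2 l) \<union> (\<Union>l\<in>L. c3 l)"
  proof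
    assume "c1 \<subseteq> (\<Union>l\<in>M. c2 l) \<union> (\<Union>l\<in>L. c3 l)"
    hence "card c1 \<le> card ((\<Union>l\<in>M. c2 l) \<union> (\<Union>l\<in>L. c3 l))"
      using fin finx by (intro card_mono) (auto simp: c2_def c3_def)
    also have "\<dots> \<le> card (\<Union>l\<in>M. c2 l) + card (\<Union>l\<in>L. c3 l)" by (rule card_Un_le)
    also have "\<dots> \<le> (\<Sum>l\<in>M. card (c2 l)) + (\<Sum>l\<in>L. card (c3 l))"
      using fin by (intro add_mono card_UN_le) auto
    finally have "real (card c1) \<le> (\<Sum>l\<in>M. real (card (c2 l))) + (\<Sum>l\<in>L. real (card (c3 l)))"
      by (simp flip: of_nat_sum of_nat_add)
    also have "\<dots> \<le> (\<Sum>l\<in>M. \<mu> * N * (1 / l) + \<tau> * card A) + (\<Sum>l\<in>L. \<tau> * card A)"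
      using c2 c3 by (intro add_mono sum_mono less_imp_le)
    also have "\<dots> = \<mu> * N * (\<Sum>l\<in>M. 1 / l) + (card M + real (card L)) * (\<tau> * card A)"
      by (simp add: sum.distrib sum_distrib_left algebra_simps)
    also have "\<dots> \<le> \<mu> * N * (1 / 2) + (2 * W) * (\<tau> * card A)"
      using M \<mu> \<tau>(1) card_le by (intro add_mono mult_left_mono mult_right_mono) (auto simp: N_def)
    \<comment> \<open>The error terms are at most \<open>2 * (W + 1) * \<tau> * card A\<close>, and
      \<open>8 * \<tau> * (W + 1) ^ 2 \<le> 1\<close> turns this into
      \<open>card A / (4 * (W + 1))\<close>. Since \<open>\<mu> \<ge> 1 / (W + 1)\<close> and
      \<open>N \<ge> card A - 1 \<ge> card A / 2\<close>, the main term \<open>\<mu> * N / 2\<close>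
      is no smaller.\<close>
    finally have "\<mu> * N / 2 < (2 * W + 1) * (\<tau> * card A)" using c1 by (simp add: algebra_simps)
    also have "\<dots> \<le> 2 * (W + 1) * (\<tau> * card A)" using \<tau>(1) by (intro mult_right_mono) auto
    also have "\<dots> = (8 * \<tau> * (W + 1) ^ 2) * card A / (4 * (W + 1))"
      using W0 by (simp add: field_simps power2_eq_square)
    also have "\<dots> \<le> 1 * card A / (4 * (W + 1))"
      using W0 mult_right_mono[OF \<tau>(2)[folded W_def], of "real (card A)"] by (intro divide_right_mono) auto
    also have "\<dots> \<le> (1 / (W + 1)) * (real (card A) - 1) / 2"
    proof -
      have "1 * card A / (4 * (W + 1)) = (1 / (W + 1)) * (real (card A) / 2) / 2" by simp
      also have "\<dots> \<le> (1 / (W + 1)) * (real (card A) - 1) / 2"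
        using W0 A(3) by (intro divide_right_mono mult_left_mono) auto
      finally show ?thesis .
    qed
    also have "\<dots> \<le> \<mu> * N / 2"
      using \<mu> N(1) A(3) W0 by (intro divide_right_mono mult_mono) auto
    finally show False by simp
  qed
  then obtain a where a: "a \<in> c1" "\<And>l. l \<in> M \<Longrightarrow> a \<notin> c2 l" "\<And>l. l \<in> L \<Longrightarrow> a \<notin> c3 l" by blast
  have aA: "a \<in> A" "\<not> p dvd b + a" "coprime (i (b + a)) d" using a(1) by (auto simp: c1_def Ax_def)
  have "coprime (i (b + a)) (p - 1)"
  proof (rule ccontr)
    assume "\<not> ?thesis"
    then obtain l where l: "prime l" "l dvd i (b + a)" "l dvd p - 1"
      using coprime_iff_gcd_eq_1 prime_factor_nat by (metis gcd_nat.bounded_iff)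
    hence "l \<in> prime_factors (p - 1)" using p by (auto simp: in_prime_factors_iff)
    then consider "l \<in> S" | "l \<in> M" | "l \<in> L" using split(1) by auto
    thus False
    proof cases
      case 1
      hence "l dvd d" unfolding d_def using fin by (intro dvd_prodI[of _ _ "\<lambda>x. x", simplified]) auto
      thus False using aA(3) l by (meson coprime_common_divisor not_prime_unit)
    next
      case 2
      thus False using a(2)[OF 2] l a(1) by (auto simp: c2_def c1_def)
    next
      case 3
      thus False using a(3)[OF 3] l aA by (auto simp: c3_def)
    qed
  qed
  hence "residue_primroot p (b + a)"
    using primroot_if_coprime_dlog[OF p(1) g aA(2)] by (simp add: i_def)
  thus ?thesis using aA b by (auto simp: add.commute)
qed

section \<open>Fermat quotients of primes\<close>

definition fq :: "nat \<Rightarrow> nat \<Rightarrow> nat" where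
  "fq p n = nat (fermat_quotient p (int n))"

lemma fermat_quotient_eq_mod:
  assumes "p > 0"
  shows "fermat_quotient p u = ((u ^ (p - 1) - 1) div int p) mod int p"
  unfolding fermat_quotient_def
proof (rule the1_equality[OF fermat_quotient_ex1[OF assms]])
  show "[(u ^ (p - 1) - 1) div int p mod int p = (u ^ (p - 1) - 1) div int p] (mod int p) \<and>
    0 \<le> (u ^ (p - 1) - 1) div int p mod int p \<and> (u ^ (p - 1) - 1) div int p mod int p \<le> int p - 1"
    using assms by simp
qed

lemma fq_less: "p > 0 \<Longrightarrow> fq p n < p"
  by (simp add: fq_def fermat_quotient_eq_mod nat_less_iff)

lemma power_eq_fq:
  assumes "prime p" "coprime n p"
  shows "[int n ^ (p - 1) = 1 + int p * int (fq p n)] (mod int p ^ 2)"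
proof -
  have p0: "p > 0" using assms prime_gt_0_nat by blast
  define a where "a = (int n ^ (p - 1) - 1) div int p"
  have "int p dvd int n ^ (p - 1) - 1"
    using assms by (intro fermat_quotient_div_exact) auto
  hence a: "int n ^ (p - 1) = 1 + int p * a" by (simp add: a_def)
  have "int (fq p n) = a mod int p"
    using p0 by (simp add: fq_def fermat_quotient_eq_mod a_def)
  hence "int n ^ (p - 1) - (1 + int p * int (fq p n)) = int p * (a - a mod int p)"
    using a by (simp add: algebra_simps)
  also have "\<dots> = int p ^ 2 * (a div int p)"
    by (simp add: minus_mod_eq_mult_div power2_eq_square)
  finally show ?thesis by (simp add: cong_iff_dvd_diff)
qed

lemma fq_unique:
  assumes "prime p" "coprime n p" "[int n ^ (p - 1) = 1 + int p * b] (mod int p ^ 2)"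
  shows "[int (fq p n) = b] (mod int p)"
proof -
  have p0: "int p \<noteq> 0" using assms(1) prime_gt_0_nat by auto
  have "[1 + int p * int (fq p n) = 1 + int p * b] (mod int p ^ 2)"
    using power_eq_fq[OF assms(1,2)] assms(3) by (metis cong_sym cong_trans)
  hence "int p * int p dvd int p * (int (fq p n) - b)"
    by (simp add: cong_iff_dvd_diff power2_eq_square right_diff_distrib)
  thus ?thesis using p0 by (simp add: cong_iff_dvd_diff)
qed

lemma fq_mult:
  assumes "prime p" "coprime m p" "coprime n p"
  shows "[fq p (m * n) = fq p m + fq p n] (mod p)"
proof -
  let ?a = "int (fq p m)" and ?b = "int (fq p n)"
  have "[int (m * n) ^ (p - 1) = (1 + int p * ?a) * (1 + int p * ?b)] (mod int p ^ 2)"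
    using cong_mult[OF power_eq_fq[OF assms(1,2)] power_eq_fq[OF assms(1,3)]] by (simp add: power_mult_distrib)
  also have "(1 + int p * ?a) * (1 + int p * ?b) = 1 + int p * (?a + ?b) + int p ^ 2 * (?a * ?b)"
    by (simp add: algebra_simps power2_eq_square)
  also have "[\<dots> = 1 + int p * (?a + ?b)] (mod int p ^ 2)"
    by (simp add: cong_iff_dvd_diff)
  finally have "[int (fq p (m * n)) = ?a + ?b] (mod int p)"
    using assms by (intro fq_unique) auto
  thus ?thesis by (simp flip: cong_int_iff)
qed

lemma fq_cong:
  assumes "prime p" "coprime m p" "coprime n p" "[m = n] (mod p ^ 2)"
  shows "fq p m = fq p n"
proof -
  have p0: "p > 0" using assms prime_gt_0_nat by blast
  have "[int m = int n] (mod int p ^ 2)" using assms(4) by (metis cong_int_iff of_nat_power)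
  hence "[int m ^ (p - 1) = int n ^ (p - 1)] (mod int p ^ 2)" by (rule cong_pow)
  hence "[int (fq p m) = int (fq p n)] (mod int p)"
    using power_eq_fq[OF assms(1,3)] assms(1,2) by (intro fq_unique) (auto intro: cong_trans)
  hence "[fq p m = fq p n] (mod p)" by (simp add: cong_int_iff)
  thus ?thesis using fq_less[OF p0] by (simp add: cong_def)
qed

text \<open>The residue of m^p modulo p^2 depends only on m modulo p. Equal Fermat quotients mean
  equal (p-1)-th powers modulo p^2, and these can be cancelled.\<close>

lemma fq_inj_on_residue_class:
  assumes "prime p" "coprime m p" "coprime n p" "[m = n] (mod p)" "fq p m = fq p n"
  shows "[m = n] (mod p ^ 2)"
proof -
  let ?u = "int m" and ?v = "int n"
  let ?S = "(\<Sum>i<p. ?u ^ i * ?v ^ (p - Suc i))"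
  have p0: "p > 0" using assms prime_gt_0_nat by blast
  have uv: "[?u = ?v] (mod int p)" using assms(4) by (simp add: cong_int_iff)
  have e: "[?u ^ (p - 1) = ?v ^ (p - 1)] (mod int p ^ 2)"
    using power_eq_fq[OF assms(1,2)] power_eq_fq[OF assms(1,3)] assms(5) by (metis cong_sym cong_trans)
  have "[?u ^ p = ?v ^ p] (mod int p ^ 2)"
  proof -
    have "?u ^ p - ?v ^ p = (?u - ?v) * ?S"
      by (subst power_diff_sumr2) (simp add: mult.commute)
    moreover have "int p dvd ?u - ?v" using uv by (simp add: cong_iff_dvd_diff)
    \<comment> \<open>All \<open>p\<close> terms of the sum are congruent modulo \<open>p\<close>,
      so this second factor is divisible by \<open>p\<close> too.\<close>
    moreover have "int p dvd ?S"
    proof -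
      have "[?S = (\<Sum>i<p. ?v ^ i * ?v ^ (p - Suc i))] (mod int p)"
        by (intro cong_sum cong_mult cong_pow uv cong_refl)
      also have "(\<Sum>i<p. ?v ^ i * ?v ^ (p - Suc i)) = (\<Sum>i<p. ?v ^ (p - 1))"
        by (intro sum.cong refl) (simp add: power_add[symmetric])
      finally have "[?S = int p * ?v ^ (p - 1)] (mod int p)" by simp
      thus ?thesis by (metis cong_dvd_iff dvd_triv_left)
    qed
    ultimately show ?thesis by (simp add: cong_iff_dvd_diff power2_eq_square mult_dvd_mono)
  qed
  moreover have "?u ^ p = ?u * ?u ^ (p - 1)" "?v ^ p = ?v * ?v ^ (p - 1)"
    using p0 by (simp_all add: power_eq_if)
  ultimately have "[?u * ?u ^ (p - 1) = ?v * ?u ^ (p - 1)] (mod int p ^ 2)"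
    using cong_mult[OF cong_refl[of ?v] cong_sym[OF e]] by (metis cong_trans)
  moreover have "coprime (?u ^ (p - 1)) (int p ^ 2)" using assms(2) by simp
  ultimately have "[?u = ?v] (mod int p ^ 2)" by (simp add: cong_mult_rcancel)
  thus ?thesis by (metis cong_int_iff of_nat_power)
qed

lemma card_fq_fibre:
  assumes "prime p"
  shows "card {c\<in>{..<p ^ 2}. coprime c p \<and> fq p c = v} \<le> p"
proof -
  have p0: "p > 0" using assms prime_gt_0_nat by blast
  let ?X = "{c\<in>{..<p ^ 2}. coprime c p \<and> fq p c = v}"
  have "inj_on (\<lambda>c. c mod p) ?X"
  proof (rule inj_onI)
    fix c c' assume c: "c \<in> ?X" "c' \<in> ?X" "c mod p = c' mod p"
    hence "[c = c'] (mod p ^ 2)"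
      using assms by (intro fq_inj_on_residue_class) (auto simp: cong_def)
    thus "c = c'" using c by (auto simp: cong_def)
  qed
  moreover have "(\<lambda>c. c mod p) ` ?X \<subseteq> {..<p}" using p0 by auto
  ultimately show ?thesis using card_inj_on_le[of "\<lambda>c. c mod p" ?X "{..<p}"] by simp
qed

lemma prime_less_coprime: "prime p \<Longrightarrow> prime l \<Longrightarrow> l < p \<Longrightarrow> coprime l p" for l p :: nat
  by (rule primes_coprime) auto

text \<open>Distinct pairs of primes below \<open>p\<close> have distinct ratios modulo \<open>p^2\<close>, and the ratio of two primes with
  equal Fermat quotient lies in the kernel of the Fermat quotient, which has fewer than \<open>p\<close> elements.\<close>

lemma card_equal_fq_pairs:
  assumes p: "prime p" and N: "N < p"
  shows "card {(m, n). m \<in> primes_le N \<and> n \<in> primes_le N \<and> m \<noteq> n \<and> fq p m = fq p n} \<le> p"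
proof -
  let ?X = "{(m, n). m \<in> primes_le N \<and> n \<in> primes_le N \<and> m \<noteq> n \<and> fq p m = fq p n}"
  let ?K = "{c\<in>{..<p ^ 2}. coprime c p \<and> fq p c = 0}"
  have p0: "p > 0" using p prime_gt_0_nat by blast
  have cop: "coprime n p" if "n \<in> primes_le N" for n
    using that N p by (intro prime_less_coprime) (auto simp: primes_le_def)
  have "\<exists>y. [n * y = 1] (mod p ^ 2)" if "n \<in> primes_le N" for n
    using cop[OF that] cong_solve_coprime_nat[of n "p ^ 2"] by simp
  then obtain y where y: "\<And>n. n \<in> primes_le N \<Longrightarrow> [n * y n = 1] (mod p ^ 2)" by metis
  define c where "c = (\<lambda>(m, n). (m * y n) mod p ^ 2)"
  have cn: "[c (m, n) * n = m] (mod p ^ 2)" if "n \<in> primes_le N" for m n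
  proof -
    have "[c (m, n) * n = m * y n * n] (mod p ^ 2)" by (simp add: c_def cong_def mod_mult_left_eq)
    also have "m * y n * n = m * (n * y n)" by simp
    also have "[m * (n * y n) = m * 1] (mod p ^ 2)" by (intro cong_mult cong_refl y that)
    finally show ?thesis by simp
  qed
  have "inj_on c ?X"
  proof (rule inj_onI)
    fix a b assume ab: "a \<in> ?X" "b \<in> ?X" "c a = c b"
    obtain m n m' n' where e: "a = (m, n)" "b = (m', n')" by fastforce
    have P: "prime m" "prime n" "prime m'" "prime n'" "m \<le> N" "n \<le> N" "m' \<le> N" "n' \<le> N" "m \<noteq> n"
      using ab e by (auto simp: primes_le_def)
    have "[m * n' = (c (m, n) * n) * n'] (mod p ^ 2)"
      using cn[of n m] ab e by (intro cong_mult cong_refl) (auto intro: cong_sym)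
    also have "(c (m, n) * n) * n' = (c (m', n') * n') * n" using ab(3) e by simp
    also have "[\<dots> = m' * n] (mod p ^ 2)"
      using cn[of n' m'] ab e by (intro cong_mult cong_refl) auto
    finally have "[m * n' = m' * n] (mod p ^ 2)" .
    moreover have "m * n' < p ^ 2" "m' * n < p ^ 2"
      using P N unfolding power2_eq_square by (auto intro!: mult_strict_mono)
    ultimately have eq: "m * n' = m' * n" by (simp add: cong_def)
    hence "m dvd m' * n" by (metis dvd_triv_left)
    hence "m dvd m' \<or> m dvd n" using P prime_dvd_mult_iff by blast
    hence "m = m'" using P primes_dvd_imp_eq by blast
    moreover hence "n = n'" using eq P by (auto simp: prime_gt_0_nat)
    ultimately show "a = b" by (simp add: e)
  qed
  moreover have "c ` ?X \<subseteq> ?K"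
  proof safe
    fix m n assume mn: "m \<in> primes_le N" "n \<in> primes_le N" "m \<noteq> n" "fq p m = fq p n"
    show "c (m, n) < p ^ 2" using p0 by (simp add: c_def)
    have cm: "[c (m, n) * n = m] (mod p ^ 2)" using cn mn by blast
    have "coprime (c (m, n) * n) (p ^ 2)"
      using cm cop[OF mn(1)] by (metis cong_imp_coprime cong_sym coprime_power_right_iff zero_less_numeral)
    thus co: "coprime (c (m, n)) p" by simp
    have "fq p (c (m, n) * n) = fq p m"
      using cop mn co by (intro fq_cong[OF p _ _ cm]) auto
    hence "[fq p m = fq p (c (m, n)) + fq p n] (mod p)"
      using fq_mult[OF p co cop[OF mn(2)]] by simp
    hence "[fq p n + 0 = fq p n + fq p (c (m, n))] (mod p)" using mn by (simp add: add.commute)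
    hence "[0 = fq p (c (m, n))] (mod p)" by (rule cong_add_lcancel_nat[THEN iffD1])
    thus "fq p (c (m, n)) = 0" using fq_less[OF p0] by (simp add: cong_def)
  qed
  ultimately have "card ?X \<le> card ?K" by (intro card_inj_on_le[where f = c]) auto
  also have "\<dots> \<le> p" using card_fq_fibre[OF p] by blast
  finally show ?thesis .
qed

text \<open>Cauchy-Schwarz: the squares of the fibre sizes add up to the number of pairs with equal
  Fermat quotient, at most \<open>p\<close> on the diagonal and at most \<open>p\<close> off
  it.\<close>

lemma card_fq_image_lower:
  assumes p: "prime p" and N: "N < p"
  shows "card (primes_le N) ^ 2 \<le> card (fq p ` primes_le N) * (2 * p)"
proof -
  define X where "X = primes_le N"
  define V where "V = fq p ` X"
  define t where "t = (\<lambda>v. card {m\<in>X. fq p m = v})"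
  let ?t2 = "(\<Sum>v\<in>V. real (t v) ^ 2)"
  have fin: "finite X" "finite V" by (auto simp: X_def V_def)
  have tot: "(\<Sum>v\<in>V. t v) = card X"
    using sum.group[of X V "fq p" "\<lambda>_. 1::nat"] fin by (simp add: t_def V_def)
  have "(\<Sum>v\<in>V. t v ^ 2) = card (\<Union>v\<in>V. {m\<in>X. fq p m = v} \<times> {m\<in>X. fq p m = v})"
    using fin by (subst card_UN_disjoint) (auto simp: t_def card_cartesian_product power2_eq_square)
  also have "\<dots> \<le> card ((\<lambda>m. (m, m)) ` X \<union> {(m, n). m \<in> X \<and> n \<in> X \<and> m \<noteq> n \<and> fq p m = fq p n})"
    using fin by (intro card_mono) (auto intro: finite_subset[of _ "X \<times> X"])
  also have "\<dots> \<le> card X + p"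
    using card_equal_fq_pairs[OF p N] fin card_image_le[of X "\<lambda>m. (m, m)"]
    by (intro order.trans[OF card_Un_le]) (auto simp: X_def)
  also have "card X \<le> card {..<p}"
    using N by (intro card_mono) (auto simp: X_def primes_le_def)
  finally have sq: "(\<Sum>v\<in>V. t v ^ 2) \<le> 2 * p" by simp
  have "real (\<Sum>v\<in>V. t v) ^ 2 \<le> real (card V) * ?t2"
  proof (cases "V = {}")
    case False
    \<comment> \<open>The mean fibre size; Cauchy-Schwarz is nonnegativity of the variance.\<close>
    define c where "c = (\<Sum>v\<in>V. real (t v)) / card V"
    have V0: "real (card V) > 0" using False fin by (simp add: card_gt_0_iff)
    have "0 \<le> (\<Sum>v\<in>V. (real (t v) - c) ^ 2)" by (intro sum_nonneg) auto
    also have "\<dots> = ?t2 - 2 * c * (\<Sum>v\<in>V. real (t v)) + card V * c ^ 2"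
      by (simp add: power2_diff sum.distrib sum_subtractf sum_distrib_left mult_ac)
    also have "\<dots> = ?t2 - (\<Sum>v\<in>V. real (t v)) ^ 2 / card V"
      using V0 by (simp add: c_def field_simps power2_eq_square)
    finally show ?thesis using V0 by (simp add: field_simps)
  qed auto
  also have "\<dots> \<le> real (card V) * (2 * p)"
  proof -
    have "real (\<Sum>v\<in>V. t v ^ 2) \<le> real (2 * p)" using sq by (simp only: of_nat_le_iff)
    thus ?thesis by (intro mult_left_mono) auto
  qed
  finally have "real (card X ^ 2) \<le> real (card V * (2 * p))" using tot by simp
  thus ?thesis unfolding X_def V_def by (simp only: of_nat_le_iff)
qed

text \<open>Products of \<open>s\<close> distinct primes from one fibre of the Fermat quotient are distinct, below \<open>p^2\<close>, and again
  lie in one fibre.\<close>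

lemma card_fq_fibre_primes:
  assumes p: "prime p" and K: "K < p" "K ^ s < p ^ 2"
  shows "card {m\<in>primes_le K. fq p m = v} choose s \<le> p"
proof -
  define P where "P = {m\<in>primes_le K. fq p m = v}"
  have finP: "finite P" by (simp add: P_def)
  have p0: "p > 0" using p prime_gt_0_nat by blast
  have Pp: "prime m" "m \<le> K" "coprime m p" if "m \<in> P" for m
    using that K p prime_less_coprime[OF p, of m] by (auto simp: P_def primes_le_def)
  let ?U = "{U. U \<subseteq> P \<and> card U = s}"
  \<comment> \<open>The term \<open>fq p 1\<close> is the contribution of the empty product; it is
    the same for all \<open>U\<close>.\<close>
  have prodU: "coprime (\<Prod>U) p \<and> fq p (\<Prod>U) = (card U * v + fq p 1) mod p" if "U \<subseteq> P" for U
  proof -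
    have "finite U" using that finP finite_subset by blast
    thus ?thesis using that
    proof (induction U rule: finite_induct)
      case empty
      thus ?case using fq_less[OF p0] by simp
    next
      case (insert m U)
      have m: "coprime m p" "fq p m = v" using insert.prems Pp by (auto simp: P_def)
      have "[fq p (m * \<Prod>U) = fq p m + fq p (\<Prod>U)] (mod p)"
        using insert m by (intro fq_mult[OF p]) auto
      hence "fq p (m * \<Prod>U) = (fq p m + fq p (\<Prod>U)) mod p"
        using fq_less[OF p0] by (simp add: cong_def)
      also have "\<dots> = (card (insert m U) * v + fq p 1) mod p"
        using insert m by (simp add: mod_add_right_eq add.assoc)
      finally show ?case using insert m by simp
    qed
  qed
  have "card P choose s = card ?U" using finP by (simp add: n_subsets)
  also have "\<dots> \<le> card {c\<in>{..<p ^ 2}. coprime c p \<and> fq p c = (s * v + fq p 1) mod p}"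
  proof (rule card_inj_on_le[where f = "\<lambda>U. \<Prod>U"])
    show "inj_on (\<lambda>U. \<Prod>U) ?U"
    proof (rule inj_onI)
      fix U U' assume U: "U \<in> ?U" "U' \<in> ?U" "\<Prod>U = \<Prod>U'"
      have pf: "prime_factors (\<Prod>W) = W" if "W \<subseteq> P" for W
      proof (rule prime_factors_prod_primes)
        show "finite W" using that finP by (rule finite_subset)
        show "prime l" if "l \<in> W" for l
          by (rule Pp(1)) (use that \<open>W \<subseteq> P\<close> in blast)
      qed
      have "U \<subseteq> P" "U' \<subseteq> P" using U(1,2) by blast+
      hence "U = prime_factors (\<Prod>U)" "prime_factors (\<Prod>U') = U'" by (simp_all only: pf)
      thus "U = U'" using U(3) by (metis (no_types))
    qed
    show "(\<lambda>U. \<Prod>U) ` ?U \<subseteq> {c\<in>{..<p ^ 2}. coprime c p \<and> fq p c = (s * v + fq p 1) mod p}"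
    proof safe
      fix U assume U: "U \<subseteq> P" "s = card U"
      have "(\<Prod>m\<in>U. m) \<le> (\<Prod>m\<in>U. K)" using U(1) Pp(2) by (intro prod_mono) auto
      also have "\<dots> = K ^ s" using U by simp
      finally show "\<Prod>U < p ^ 2" using K(2) by simp
      show "coprime (\<Prod>U) p" "fq p (\<Prod>U) = (card U * v + fq p 1) mod p"
        using prodU[OF U(1)] by simp_all
    qed
  qed auto
  also have "\<dots> \<le> p" by (rule card_fq_fibre[OF p])
  finally show ?thesis by (simp add: P_def)
qed

text \<open>A fibre of size t has (t/s)^s at most \<open>t choose s\<close>, hence at most
  \<open>p\<close>.\<close>

lemma card_fq_image_short:
  assumes p: "prime p" and K: "K < p" "K ^ s < p ^ 2" and s: "s \<ge> 1"
  shows "real (card (primes_le K)) \<le> card (fq p ` primes_le K) * (s * real p powr (1 / s))"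
proof -
  define X where "X = primes_le K"
  define V where "V = fq p ` X"
  define t where "t = (\<lambda>v. card {m\<in>X. fq p m = v})"
  have p1: "p \<ge> 1" using p prime_ge_1_nat by blast
  have fin: "finite X" "finite V" by (auto simp: X_def V_def)
  have "real (t v) \<le> s * real p powr (1 / s)" for v
  proof (cases "s \<le> t v")
    case True
    have "(real (t v) / s) ^ s \<le> real (t v choose s)"
      using binomial_ge_n_over_k_pow_k[OF True, where ?'a = real] by simp
    also have "\<dots> \<le> p" using card_fq_fibre_primes[OF p K, of v] by (simp add: t_def X_def)
    finally have "(real (t v) / s) ^ s \<le> p" .
    hence "((real (t v) / s) powr s) powr (1 / s) \<le> real p powr (1 / s)"
      using s True by (intro powr_mono2) (auto simp: powr_realpow)
    hence "real (t v) / s \<le> real p powr (1 / s)" using s by (simp add: powr_powr)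
    thus ?thesis using s by (simp add: field_simps)
  next
    case False
    have "real s * 1 \<le> s * real p powr (1 / s)"
      using p1 by (intro mult_left_mono ge_one_powr_ge_zero) auto
    moreover have "real (t v) \<le> real s * 1" using False by simp
    ultimately show ?thesis by (rule order.trans[rotated])
  qed
  hence "(\<Sum>v\<in>V. real (t v)) \<le> (\<Sum>v\<in>V. s * real p powr (1 / s))" by (intro sum_mono)
  moreover have "(\<Sum>v\<in>V. t v) = card X"
    using sum.group[of X V "fq p" "\<lambda>_. 1::nat"] fin by (simp add: t_def V_def)
  hence "(\<Sum>v\<in>V. real (t v)) = real (card X)" by (simp flip: of_nat_sum)
  ultimately show ?thesis by (simp add: V_def X_def)
qed

text \<open>Provides some admissible n for every prime, so that the final statement also covers the
  primes below the asymptotic range.\<close>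

lemma fq_surjective:
  assumes "prime p" "g < p"
  shows "\<exists>n>0. coprime n p \<and> fq p n = g"
proof -
  have p0: "p > 0" using assms prime_gt_0_nat by blast
  \<comment> \<open>The Fermat quotient of 1 + p*x is -x modulo p, because (1 + p*x)^(p-1) is 1 +
    p*(p-1)*x modulo p^2.\<close>
  define n where "n = 1 + p * (p - g)"
  have cop: "coprime n p"
  proof (rule coprimeI)
    fix c assume c: "c dvd n" "c dvd p"
    hence "c dvd p * (p - g)" by simp
    thus "is_unit c" using c(1) unfolding n_def by (simp only: dvd_add_left_iff)
  qed
  have "[int n ^ (p - 1) = 1 + int p * (int g)] (mod int p ^ 2)"
  proof -
    have bin: "[(1 + int p * x) ^ k = 1 + int p * (int k * x)] (mod int p ^ 2)" for x k
    proof (induction k)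
      case (Suc k)
      have "[(1 + int p * x) ^ Suc k = (1 + int p * x) * (1 + int p * (int k * x))] (mod int p ^ 2)"
        unfolding power_Suc by (intro cong_mult cong_refl Suc)
      also have "(1 + int p * x) * (1 + int p * (int k * x)) = 1 + int p * (int (Suc k) * x) + int p ^ 2 * (x * (int k * x))"
        by (simp add: algebra_simps power2_eq_square)
      also have "[\<dots> = 1 + int p * (int (Suc k) * x)] (mod int p ^ 2)" by (simp add: cong_iff_dvd_diff)
      finally show ?case .
    qed auto
    have "int n = 1 + int p * (int p - int g)" using assms by (simp add: n_def of_nat_diff)
    hence "[int n ^ (p - 1) = 1 + int p * (int (p - 1) * (int p - int g))] (mod int p ^ 2)"
      using bin[of "int p - int g" "p - 1"] by simp
    also have "1 + int p * (int (p - 1) * (int p - int g)) = 1 + int p * int g + int p ^ 2 * (int p - int g - 1)"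
      using p0 by (simp add: of_nat_diff algebra_simps power2_eq_square)
    also have "[\<dots> = 1 + int p * int g] (mod int p ^ 2)" by (simp add: cong_iff_dvd_diff)
    finally show ?thesis .
  qed
  hence "[int (fq p n) = int g] (mod int p)" using assms cop by (intro fq_unique)
  hence "[fq p n = g] (mod p)" by (simp add: cong_int_iff)
  hence "fq p n = g" using fq_less[OF p0] assms by (simp add: cong_def)
  thus ?thesis using cop by (intro exI[of _ n]) (simp add: n_def)
qed

section \<open>Asymptotic estimates\<close>

lemma ln_2_ge_half: "ln (2::real) \<ge> 1 / 2"
  using ln_le_minus_one[of "1 / 2 :: real"] by (simp add: ln_div)

text \<open>Used with \<open>y = 2\<close> to bound the number of prime divisors of
  \<open>p - 1\<close>, and with \<open>y\<close> of order ln p to bound the number of medium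
  ones.\<close>

lemma card_prime_divisors_power_le:
  fixes n :: nat and y :: real
  assumes "n > 0" "Q \<subseteq> prime_factors n" "\<And>l. l \<in> Q \<Longrightarrow> y \<le> real l" "y \<ge> 0"
  shows "y ^ card Q \<le> n"
proof -
  have fin: "finite Q" using assms(2) by (rule finite_subset) simp
  have "\<Prod>Q dvd n"
    using fin assms(2) by (intro prod_primes_dvd) auto
  hence "\<Prod>Q \<le> n" using assms(1) by (rule dvd_imp_le)
  have "y ^ card Q = (\<Prod>l\<in>Q. y)" by simp
  also have "\<dots> \<le> (\<Prod>l\<in>Q. real l)" using assms by (intro prod_mono) auto
  also have "\<dots> = real (\<Prod>Q)" by simp
  also have "\<dots> \<le> n" using \<open>\<Prod>Q \<le> n\<close> by (simp only: of_nat_le_iff)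
  finally show ?thesis .
qed

text \<open>The threshold \<open>y\<close> satisfies \<open>4 powr y = x powr (1 / k)\<close>, so
  \<open>primorial_le\<close> bounds the product of the small primes by
  \<open>x powr (1 / k)\<close>. The reciprocals of the medium primes sum to at most
  \<open>ln x / (y * ln y) = k * ln 4 / ln y\<close>. The choice of \<open>\<theta>\<close> keeps
  the inverse powers of \<open>\<tau>\<close> below \<open>x powr (\<beta> / 4)\<close>, and
  \<open>80 * r \<le> \<beta> * k\<close> does the same for \<open>R ^ (10 * r)\<close>.\<close>

lemma primroot_in_sumset_of_bounds:
  fixes \<beta> :: real
  assumes p: "prime p" "p > 2" and A: "A \<subseteq> {..<p}" "p \<le> card A ^ (2 * r)" and B: "B \<subseteq> {..<p}" "real p powr (1/2 + \<beta>) \<le> card B"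
    and r: "r \<ge> 1" and \<beta>: "\<beta> > 0" and k: "k \<ge> 1" "80 * r \<le> \<beta> * k"
  defines "x \<equiv> real p"
  defines "\<theta> \<equiv> \<beta> / (8 * r + 4 * k)"
  defines "y \<equiv> ln x / (k * ln 4)"
  assumes a1: "y > 1" "k * ln 4 / ln y \<le> 1 / 2"
    and a2: "8 * x powr (-\<theta>) * (2 * ln x + 1) ^ 2 \<le> 1"
    and a3: "(2 * ln x + 1) * (moment_const r + hits_const k) < x powr (\<beta> / 2)"
    and a4: "x powr (1 / (2 * r) - \<theta>) \<ge> k" "x powr (1 / (2 * r)) \<ge> 2"
  shows "\<exists>a\<in>A. \<exists>b\<in>B. residue_primroot p (a + b)"
proof -
  define z where "z = nat \<lfloor>y\<rfloor>"
  define F where "F = prime_factors (p - 1)"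
  define S where "S = {l\<in>F. l \<le> z}"
  define M where "M = {l\<in>F. z < l \<and> l ^ k < p}"
  define L where "L = {l\<in>F. z < l \<and> p \<le> l ^ k}"
  \<comment> \<open>One factor \<open>x powr (1 / k)\<close> for the product of the small primes and
    one for a medium prime.\<close>
  define R where "R = x powr (2 / k)"
  define \<tau> where "\<tau> = x powr (-\<theta>)"
  let ?E = "moment_const r * R ^ (10 * r) / \<tau> ^ (2 * r) + hits_const k / \<tau> ^ k"
  have x: "x > 2" using p(2) by (simp add: x_def)
  have lx: "ln x > 0" using x by simp
  have k0: "real k > 0" using k by simp
  have ln4: "ln (4::real) > 0" by simp
  have z: "real z \<le> y" "y < real z + 1" using a1 unfolding z_def by linarith+
  have w: "real (card F) \<le> 2 * ln x"
  proof -
    have "2 ^ card F \<le> real (p - 1)"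
    proof (rule card_prime_divisors_power_le)
      fix l assume "l \<in> F"
      hence "l \<ge> 2" unfolding F_def by (intro prime_ge_2_nat) auto
      thus "2 \<le> real l" by simp
    qed (use p in \<open>auto simp: F_def\<close>)
    also have "\<dots> \<le> x" by (simp add: x_def)
    finally have "ln ((2::real) ^ card F) \<le> ln x" using x by (subst ln_le_cancel_iff) auto
    hence "card F * ln 2 \<le> ln x" by (simp add: ln_realpow)
    moreover have "card F * (1 / 2) \<le> card F * ln (2::real)"
      using ln_2_ge_half by (intro mult_left_mono) auto
    ultimately show ?thesis by linarith
  qed
  have xk: "x powr (1 / k) * x powr (1 / k) = R"
    by (simp add: R_def powr_add[symmetric])
  have xk1: "x powr (1 / k) \<ge> 1" using x k0 by (intro ge_one_powr_ge_zero) auto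
  have prodS: "real (\<Prod>S) \<le> x powr (1 / k)"
  proof -
    have "\<Prod>S dvd \<Prod>(primes_le z)"
      by (rule prod_dvd_prod_subset) (auto simp: S_def F_def primes_le_def[of z] in_prime_factors_iff)
    hence "\<Prod>S \<le> \<Prod>(primes_le z)"
      by (rule dvd_imp_le) (auto simp: primes_le_def prime_gt_0_nat intro!: prod_pos)
    also have "\<dots> \<le> 4 ^ z" by (rule primorial_le)
    finally have "real (\<Prod>S) \<le> real (4 ^ z)" by (simp only: of_nat_le_iff)
    also have "\<dots> = 4 powr z" by (simp add: powr_realpow)
    also have "\<dots> \<le> 4 powr y" using z by (intro powr_mono) auto
    also have "4 powr y = x powr (1 / k)" using x ln4 k0 by (simp add: powr_def y_def)
    finally show ?thesis .
  qed
  have lM: "real l \<le> x powr (1 / k)" if "l \<in> M" for l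
  proof -
    have "real (l ^ k) \<le> x" using that by (simp add: M_def x_def del: of_nat_power)
    moreover have "l > 0" using that by (auto simp: M_def)
    ultimately have "real l powr k \<le> x" by (simp add: powr_realpow)
    hence "(real l powr k) powr (1 / k) \<le> x powr (1 / k)" using k0 by (intro powr_mono2) auto
    thus ?thesis using k0 \<open>l > 0\<close> by (simp add: powr_powr)
  qed
  have cardA: "x powr (1 / (2 * r)) \<le> card A"
  proof -
    have "card A > 0" using A(2) p(2) r by (cases "card A = 0") (auto simp: power_0_left)
    have "x \<le> real (card A ^ (2 * r))" using A(2) by (simp only: x_def of_nat_le_iff)
    also have "\<dots> = real (card A) powr (2 * r)"
      using \<open>card A > 0\<close> powr_realpow[of "real (card A)" "2 * r"] by simp
    finally have "x powr (1 / (2 * r)) \<le> (real (card A) powr (2 * r)) powr (1 / (2 * r))"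
      using x r by (intro powr_mono2) auto
    thus ?thesis using r by (simp add: powr_powr)
  qed
  have \<theta>: "\<theta> > 0" using \<beta> k0 by (simp add: \<theta>_def)
  have \<theta>1: "2 * r * \<theta> \<le> \<beta> / 4" "k * \<theta> \<le> \<beta> / 4"
    using \<beta> k0 by (simp_all add: \<theta>_def field_simps)
  have rk: "20 * real r / k \<le> \<beta> / 4" using k k0 by (simp add: field_simps)
  show ?thesis
  proof (rule sumset_contains_primroot[where S = S and M = M and L = L and R = R and \<tau> = \<tau>, OF p A _ B(1) r k(1)])
    show "card A \<ge> 2" using cardA a4(2) by linarith
    show "prime_factors (p - 1) = S \<union> M \<union> L" by (auto simp: S_def M_def L_def F_def)
    show "S \<inter> M = {}" by (auto simp: S_def M_def)
    have "x powr (1 / k) * 1 \<le> x powr (1 / k) * x powr (1 / k)" using xk1 by (intro mult_left_mono) auto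
    thus "real (\<Prod>S) \<le> R" using prodS unfolding xk by simp
    show "real (\<Prod>S * l) \<le> R" if "l \<in> M" for l
      unfolding of_nat_mult xk[symmetric] by (intro mult_mono prodS lM that) auto
    show "p \<le> l ^ k" if "l \<in> L" for l using that by (simp add: L_def)
    show "(\<Sum>l\<in>M. 1 / real l) \<le> 1 / 2"
    proof -
      have yl: "y \<le> real l" if "l \<in> M" for l using that z by (auto simp: M_def)
      have "y ^ card M \<le> real (p - 1)"
        using p yl a1 by (intro card_prime_divisors_power_le) (auto simp: M_def F_def)
      also have "\<dots> \<le> x" by (simp add: x_def)
      finally have "ln (y ^ card M) \<le> ln x" using x a1 by (subst ln_le_cancel_iff) auto
      hence cM: "card M * ln y \<le> ln x" using a1 by (simp add: ln_realpow)
      have ly: "ln y > 0" using a1 by simp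
      have "(\<Sum>l\<in>M. 1 / real l) \<le> (\<Sum>l\<in>M. 1 / y)"
        using yl a1 by (intro sum_mono divide_left_mono) fastforce+
      also have "\<dots> = card M * ln y / (y * ln y)" using ly a1 by simp
      also have "\<dots> \<le> ln x / (y * ln y)" using cM ly a1 by (intro divide_right_mono) auto
      also have "\<dots> = k * ln 4 / ln y" using lx k0 ln4 by (simp add: y_def)
      also have "\<dots> \<le> 1 / 2" by (rule a1)
      finally show ?thesis .
    qed
    show "\<tau> > 0" using x by (simp add: \<tau>_def)
    have "(real (card F) + 1) ^ 2 \<le> (2 * ln x + 1) ^ 2" using w by (intro power_mono) auto
    hence "8 * \<tau> * (real (card F) + 1) ^ 2 \<le> 8 * \<tau> * (2 * ln x + 1) ^ 2"
      using x by (intro mult_left_mono) (auto simp: \<tau>_def)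
    thus "8 * \<tau> * (real (card (prime_factors (p - 1))) + 1)\<^sup>2 \<le> 1"
      using a2 by (simp add: \<tau>_def F_def)
    have "real k \<le> x powr (-\<theta>) * x powr (1 / (2 * r))" using a4(1) by (simp add: powr_add[symmetric])
    also have "\<dots> \<le> \<tau> * card A" unfolding \<tau>_def using cardA by (intro mult_left_mono) auto
    finally show "real k \<le> \<tau> * card A" .
    have q1: "R ^ (10 * r) / \<tau> ^ (2 * r) \<le> x powr (\<beta> / 2)"
    proof -
      have "R ^ (10 * r) = x powr (20 * r / k)"
        using x by (simp add: R_def powr_realpow[symmetric] powr_powr mult_ac)
      moreover have "\<tau> ^ (2 * r) = x powr (- (2 * r * \<theta>))"
        using x by (simp add: \<tau>_def powr_realpow[symmetric] powr_powr mult_ac)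
      ultimately have "R ^ (10 * r) / \<tau> ^ (2 * r) = x powr (20 * r / k + 2 * r * \<theta>)"
        by (simp add: powr_diff[symmetric] powr_minus_divide powr_add)
      also have "\<dots> \<le> x powr (\<beta> / 2)" using x rk \<theta>1 by (intro powr_mono) auto
      finally show ?thesis .
    qed
    have q2: "1 / \<tau> ^ k \<le> x powr (\<beta> / 2)"
    proof -
      have "\<tau> ^ k = x powr (- (k * \<theta>))"
        using x by (simp add: \<tau>_def powr_realpow[symmetric] powr_powr mult_ac)
      hence "1 / \<tau> ^ k = x powr (k * \<theta>)" by (simp add: powr_minus_divide)
      also have "\<dots> \<le> x powr (\<beta> / 2)" using x \<theta>1 \<beta> by (intro powr_mono) auto
      finally show ?thesis .
    qed
    have "hits_const k \<ge> 0" by (simp add: hits_const_def)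
    hence "?E \<le> moment_const r * x powr (\<beta> / 2) + hits_const k * x powr (\<beta> / 2)"
      using mult_left_mono[OF q1 moment_const_nonneg[of r]] mult_left_mono[OF q2, of "hits_const k"] by simp
    hence "(real (card F) + 1) * (?E) * sqrt p
      \<le> (2 * ln x + 1) * ((moment_const r + hits_const k) * x powr (\<beta> / 2)) * sqrt p"
      using w lx moment_const_nonneg[of r] \<open>hits_const k \<ge> 0\<close> x
      by (intro mult_right_mono mult_mono) (auto simp: R_def \<tau>_def algebra_simps)
    also have "\<dots> = ((2 * ln x + 1) * (moment_const r + hits_const k)) * (x powr (\<beta> / 2) * sqrt p)" by simp
    also have "\<dots> < x powr (\<beta> / 2) * (x powr (\<beta> / 2) * sqrt p)"
      using a3 x p by (intro mult_strict_right_mono) (auto simp: x_def)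
    also have "\<dots> = x powr (1 / 2 + \<beta>)"
    proof -
      have "x powr (\<beta> / 2) * (x powr (\<beta> / 2) * x powr (1 / 2)) = x powr (\<beta> / 2 + (\<beta> / 2 + 1 / 2))"
        by (simp only: powr_add)
      moreover have "x powr (1 / 2) = sqrt p" using x by (simp add: powr_half_sqrt x_def)
      moreover have "\<beta> / 2 + (\<beta> / 2 + 1 / 2) = 1 / 2 + \<beta>" by simp
      ultimately show ?thesis by (simp only:)
    qed
    also have "\<dots> \<le> card B" using B by (simp add: x_def)
    finally show "(real (card (prime_factors (p - 1))) + 1) * (?E) * sqrt p < card B"
      by (simp add: F_def)
  qed
qed

theorem eventually_primroot_in_sumset:
  fixes \<beta> :: real
  assumes "0 < \<beta>" "\<beta> \<le> 1" "r \<ge> 1"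
  shows "\<forall>\<^sub>F p in sequentially. prime p \<longrightarrow> (\<forall>A B. A \<subseteq> {..<p} \<longrightarrow> B \<subseteq> {..<p} \<longrightarrow> p \<le> card A ^ (2 * r) \<longrightarrow>
     real p powr (1/2 + \<beta>) \<le> card B \<longrightarrow> (\<exists>a\<in>A. \<exists>b\<in>B. residue_primroot p (a + b)))"
proof -
  define k where "k = nat \<lceil>80 * r / \<beta>\<rceil>"
  have "80 * r / \<beta> \<le> k" unfolding k_def by linarith
  hence k: "80 * r \<le> \<beta> * k" using assms by (simp add: field_simps)
  have k1: "k \<ge> 1" using k assms by (cases k) auto
  define \<theta> where "\<theta> = \<beta> / (8 * r + 4 * k)"
  have \<theta>: "\<theta> > 0" using assms by (simp add: \<theta>_def)
  \<comment> \<open>Makes \<open>x powr (1 / (2 * r) - \<theta>)\<close>, a lower bound for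
    \<open>\<tau> * card A\<close>, tend to infinity.\<close>
  have "2 * r * \<theta> < 1"
  proof -
    have "2 * r * \<theta> \<le> 2 * r * (1 / (8 * r))"
      unfolding \<theta>_def using assms k1 by (intro mult_left_mono frac_le) auto
    also have "\<dots> < 1" using assms by simp
    finally show ?thesis .
  qed
  hence \<theta>r: "1 / (2 * r) - \<theta> > 0" using assms by (simp add: field_simps)
  define kk where "kk = real k * ln 4"
  have kk: "kk > 0" using k1 by (simp add: kk_def)
  define K where "K = moment_const r + hits_const k"
  define e where "e = 1 / (2 * real r) - \<theta>"
  define f where "f = 1 / (2 * real r)"
  have ef: "e > 0" "f > 0" using \<theta>r assms by (simp_all add: e_def f_def)
  have "\<forall>\<^sub>F p in sequentially. ln (real p) / kk > 1" using kk by real_asymp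
  moreover have "\<forall>\<^sub>F p in sequentially. kk / ln (ln (real p) / kk) \<le> 1 / 2" using kk by real_asymp
  moreover have "\<forall>\<^sub>F p in sequentially. 8 * real p powr (-\<theta>) * (2 * ln (real p) + 1) ^ 2 \<le> 1" using \<theta> by real_asymp
  moreover have "\<forall>\<^sub>F p in sequentially. (2 * ln (real p) + 1) * K < real p powr (\<beta> / 2)"
  proof -
    have "((\<lambda>p. (2 * ln (real p) + 1) * K / real p powr (\<beta> / 2)) \<longlongrightarrow> 0) sequentially" using assms(1) by real_asymp
    hence "\<forall>\<^sub>F p in sequentially. (2 * ln (real p) + 1) * K / real p powr (\<beta> / 2) < 1"
      by (rule order_tendstoD) simp
    thus ?thesis using eventually_gt_at_top[of 0]
      by eventually_elim (simp add: field_simps)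
  qed
  moreover have "\<forall>\<^sub>F p in sequentially. real p powr e \<ge> k" using ef by real_asymp
  moreover have "\<forall>\<^sub>F p in sequentially. real p powr f \<ge> 2" using ef by real_asymp
  moreover have "\<forall>\<^sub>F p in sequentially. p > (2::nat)" by (rule eventually_gt_at_top)
  ultimately show ?thesis
  proof eventually_elim
    case (elim p)
    show ?case
    proof (intro impI allI)
      fix A B assume "prime p" "A \<subseteq> {..<p}" "B \<subseteq> {..<p}" "p \<le> card A ^ (2 * r)" "real p powr (1/2 + \<beta>) \<le> card B"
      thus "\<exists>a\<in>A. \<exists>b\<in>B. residue_primroot p (a + b)"
        using elim assms k k1
        by (intro primroot_in_sumset_of_bounds[where \<beta> = \<beta> and r = r and k = k])
          (simp_all add: kk_def K_def e_def f_def \<theta>_def)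
    qed
  qed
qed

section \<open>Prime counts and the choice of the two ranges of primes\<close>

lemma card_primes_le_lower:
  assumes "n \<ge> 2"
  shows "real (card (primes_le n)) * (4 * ln n) \<ge> real n - 1"
proof -
  define m where "m = n div 2"
  have m: "m \<ge> 1" "2 * m \<le> n" "n \<le> 2 * m + 1" using assms by (auto simp: m_def)
  have "real (2 ^ m) \<le> real ((2 * m) ^ card (primes_le (2 * m)))"
    using chebyshev_lower[OF m(1)] by (simp only: of_nat_le_iff)
  hence "ln ((2::real) ^ m) \<le> ln (real (2 * m) ^ card (primes_le (2 * m)))"
    using m by (subst ln_le_cancel_iff) auto
  moreover have "ln (real (2 * m) ^ card (primes_le (2 * m))) = card (primes_le (2 * m)) * ln (real (2 * m))"
    by (rule ln_realpow)
  ultimately have "m * ln 2 \<le> card (primes_le (2 * m)) * ln (real (2 * m))" by (simp only: ln_realpow)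
  also have "\<dots> \<le> card (primes_le n) * ln (real n)"
  proof (rule mult_mono)
    have "card (primes_le (2 * m)) \<le> card (primes_le n)"
      using m by (intro card_mono) (auto simp: primes_le_def[of "2 * m"] primes_le_def[of n] finite_primes_le[unfolded primes_le_def])
    thus "real (card (primes_le (2 * m))) \<le> real (card (primes_le n))" by simp
  qed (use m in auto)
  finally have "m * ln 2 \<le> card (primes_le n) * ln (real n)" .
  moreover have "m * (1 / 2) \<le> m * ln (2::real)" using ln_2_ge_half by (intro mult_left_mono) auto
  moreover have "real n - 1 \<le> 2 * m" using m(3) by linarith
  ultimately show ?thesis by linarith
qed

lemma card_primes_le_floor_lower:
  fixes x y :: real
  assumes "3 \<le> y" "y \<le> x"
  shows "real (card (primes_le (nat \<lfloor>y\<rfloor>))) \<ge> (y - 2) / (4 * ln x)"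
proof -
  define n where "n = nat \<lfloor>y\<rfloor>"
  have n: "n \<ge> 2" "real n \<le> y" "real n \<ge> y - 1" using assms unfolding n_def by linarith+
  have lx: "ln x > 0" using assms by simp
  have "y - 2 \<le> real n - 1" using n by simp
  also have "\<dots> \<le> real (card (primes_le n)) * (4 * ln n)" by (rule card_primes_le_lower) (rule n)
  also have "\<dots> \<le> real (card (primes_le n)) * (4 * ln x)"
    using n assms by (intro mult_left_mono) auto
  finally show ?thesis using lx by (simp add: n_def pos_divide_le_eq)
qed

text \<open>For \<open>B\<close>, primes up to \<open>x powr (3 / 4 + \<epsilon> / 2)\<close> number
  at least \<open>x powr (3 / 4 + 3 * \<epsilon> / 8)\<close>, the logarithm being absorbed; the
  square of this exceeds \<open>2 * x\<close> times \<open>x powr (1 / 2 + \<epsilon> / 2)\<close>.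
  The other half of \<open>\<epsilon>\<close> pays for the second factor, a prime up to
  \<open>x powr c\<close>.\<close>

theorem eventually_small_fq_primroot:
  fixes \<epsilon> :: real
  assumes "0 < \<epsilon>" "\<epsilon> \<le> 1 / 4"
  shows "\<forall>\<^sub>F p in sequentially. prime p \<longrightarrow>
    (\<exists>n>0. real n \<le> real p powr (3 / 4 + \<epsilon>) \<and> coprime n p \<and> residue_primroot p (fq p n))"
proof -
  define s where "s = nat \<lceil>4 / \<epsilon>\<rceil>"
  have "4 / \<epsilon> \<le> s" unfolding s_def by linarith
  hence s: "4 \<le> \<epsilon> * s" using assms by (simp add: field_simps)
  have "4 / \<epsilon> \<ge> 16" using assms by (simp add: field_simps)
  hence s16: "real s \<ge> 16" using \<open>4 / \<epsilon> \<le> s\<close> by linarith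
  hence s1: "s \<ge> 1" by simp
  \<comment> \<open>The value 7/4 of \<open>c * s\<close> is below 2, which keeps products of
    \<open>s\<close> primes below p^2, and above 3/2: the image has size about
    \<open>x powr (c - u)\<close>, and \<open>c - u > v\<close> leaves room for logarithms. The
    target \<open>v\<close> is what \<open>p \<le> card A ^ (2 * s)\<close> demands.\<close>
  define c where "c = 7 / (4 * real s)"
  define u where "u = 1 / real s"
  define v where "v = 1 / (2 * real s)"
  have cuv: "c - u - v > 0" "c > 0" "u > 0" "v > 0" "c < 1" "c \<le> \<epsilon> / 2"
    using s16 s assms by (auto simp: c_def u_def v_def field_simps)
  have "\<forall>\<^sub>F p in sequentially. real p powr (3 / 4 + \<epsilon> / 2) \<ge> 3" using assms by real_asymp
  moreover have "\<forall>\<^sub>F p in sequentially. real p powr c \<ge> 3" using cuv by real_asymp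
  moreover have "\<forall>\<^sub>F p in sequentially. (real p powr (3 / 4 + \<epsilon> / 2) - 2) / (4 * ln (real p)) \<ge> real p powr (3 / 4 + 3 * \<epsilon> / 8)"
    using assms by real_asymp
  moreover have "\<forall>\<^sub>F p in sequentially. (real p powr (3 / 4 + 3 * \<epsilon> / 8)) ^ 2 \<ge> real p powr (1 / 2 + \<epsilon> / 2) * (2 * real p)"
    using assms by real_asymp
  moreover have "\<forall>\<^sub>F p in sequentially. (real p powr c - 2) / (4 * ln (real p)) \<ge> real p powr v * (s * real p powr u)"
  proof -
    have aux: "T \<le> (X - 2) / (4 * l)" if "T * (8 * l) / X < 1" "4 \<le> X" "0 < l" for T X l :: real
    proof -
      have "T * (8 * l) < X" using that by (simp add: pos_divide_less_eq)
      thus ?thesis using that by (simp add: pos_le_divide_eq)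
    qed
    have "((\<lambda>p. real p powr v * (s * real p powr u) * (8 * ln (real p)) / real p powr c) \<longlongrightarrow> 0) sequentially"
      using cuv by real_asymp
    hence "\<forall>\<^sub>F p in sequentially. real p powr v * (s * real p powr u) * (8 * ln (real p)) / real p powr c < 1"
      by (rule order_tendstoD) simp
    moreover have "\<forall>\<^sub>F p in sequentially. real p powr c \<ge> 4" using cuv by real_asymp
    moreover have "\<forall>\<^sub>F p in sequentially. ln (real p) > 0" by real_asymp
    ultimately show ?thesis by eventually_elim (rule aux)
  qed
  moreover have "\<forall>\<^sub>F p in sequentially. p > (2::nat)" by (rule eventually_gt_at_top)
  moreover have "\<forall>\<^sub>F p in sequentially. prime p \<longrightarrow> (\<forall>A B. A \<subseteq> {..<p} \<longrightarrow> B \<subseteq> {..<p} \<longrightarrow> p \<le> card A ^ (2 * s) \<longrightarrow>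
     real p powr (1/2 + \<epsilon> / 2) \<le> card B \<longrightarrow> (\<exists>a\<in>A. \<exists>b\<in>B. residue_primroot p (a + b)))"
    using assms s1 by (intro eventually_primroot_in_sumset) auto
  ultimately show ?thesis
  proof eventually_elim
    case (elim p)
    show ?case
    proof
      assume p: "prime p"
      define x where "x = real p"
      define N where "N = nat \<lfloor>x powr (3 / 4 + \<epsilon> / 2)\<rfloor>"
      define K where "K = nat \<lfloor>x powr c\<rfloor>"
      define A where "A = fq p ` primes_le K"
      define B where "B = fq p ` primes_le N"
      have p0: "p > 0" and x: "x > 2" using elim(6) by (auto simp: x_def)
      have N: "real N \<le> x powr (3 / 4 + \<epsilon> / 2)" and K: "real K \<le> x powr c"
        using x by (simp_all add: N_def K_def)
      have ltx: "x powr a < x" if "a < 1" for a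
        using powr_less_mono[of a 1 x] that x by simp
      have Nx: "x powr (3 / 4 + \<epsilon> / 2) < x" and Kx: "x powr c < x"
        using assms cuv by (auto intro!: ltx)
      have Np: "N < p" "K < p" using N K Nx Kx by (auto simp: x_def)
      have sub: "A \<subseteq> {..<p}" "B \<subseteq> {..<p}" using fq_less[OF p0] by (auto simp: A_def B_def)
      have Ks: "K ^ s < p ^ 2"
      proof -
        have "real K ^ s \<le> (x powr c) ^ s" using K by (intro power_mono) auto
        also have "\<dots> = x powr (c * s)" using x by (simp add: powr_realpow[symmetric] powr_powr)
        also have "c * s = 7 / 4" using s1 by (simp add: c_def)
        also have "x powr (7 / 4) < x powr 2" using x by (intro powr_less_mono) auto
        also have "x powr 2 = x ^ 2" using x by (simp add: powr_numeral)
        finally have "real (K ^ s) < real (p ^ 2)" by (simp add: x_def)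
        thus ?thesis by (simp only: of_nat_less_iff)
      qed
      have cB: "x powr (1 / 2 + \<epsilon> / 2) \<le> card B"
      proof -
        have "x powr (3 / 4 + 3 * \<epsilon> / 8) \<le> card (primes_le N)"
          using card_primes_le_floor_lower[of "x powr (3 / 4 + \<epsilon> / 2)" x] elim(1,3) Nx
          unfolding N_def x_def by linarith
        hence "(x powr (3 / 4 + 3 * \<epsilon> / 8)) ^ 2 \<le> real (card (primes_le N)) ^ 2" by (intro power_mono) auto
        also have "\<dots> = real (card (primes_le N) ^ 2)" by simp
        also have "\<dots> \<le> real (card B * (2 * p))"
          using card_fq_image_lower[OF p Np(1)] unfolding B_def by (simp only: of_nat_le_iff)
        finally have "x powr (1 / 2 + \<epsilon> / 2) * (2 * x) \<le> card B * (2 * x)"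
          using elim(4) by (simp add: x_def)
        thus ?thesis using x by simp
      qed
      have cA: "p \<le> card A ^ (2 * s)"
      proof -
        have "x powr v * (s * x powr u) \<le> card (primes_le K)"
          using card_primes_le_floor_lower[of "x powr c" x] elim(2,5) Kx
          unfolding K_def x_def by linarith
        also have "\<dots> \<le> card A * (s * x powr u)"
          using card_fq_image_short[OF p Np(2) Ks s1] by (simp add: A_def x_def u_def)
        finally have "x powr v \<le> card A" using x s1 by simp
        hence "(x powr v) ^ (2 * s) \<le> real (card A) ^ (2 * s)" by (intro power_mono) auto
        moreover have "(x powr v) ^ (2 * s) = x"
        proof -
          have "(x powr v) ^ (2 * s) = x powr (v * real (2 * s))"
            using x powr_realpow[of "x powr v" "2 * s"] by (simp add: powr_powr)
          moreover have "v * real (2 * s) = 1" using s1 by (simp add: v_def)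
          ultimately show ?thesis using x by simp
        qed
        ultimately have "real p \<le> real (card A ^ (2 * s))" by (simp add: x_def)
        thus ?thesis by (simp only: of_nat_le_iff)
      qed
      obtain a b where ab: "a \<in> A" "b \<in> B" "residue_primroot p (a + b)"
        using elim(7) p sub cA cB unfolding x_def by blast
      then obtain m n where mn: "m \<in> primes_le K" "n \<in> primes_le N" "a = fq p m" "b = fq p n"
        by (auto simp: A_def B_def)
      have cop: "coprime m p" "coprime n p"
        using mn Np p by (auto simp: primes_le_def intro!: prime_less_coprime)
      have "[fq p (m * n) = a + b] (mod p)" using fq_mult[OF p cop] mn by simp
      hence "residue_primroot p (fq p (m * n))" using ab(3) residue_primroot_cong by blast
      moreover have "m * n > 0" using mn by (auto simp: primes_le_def prime_gt_0_nat)
      moreover have "coprime (m * n) p" using cop by simp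
      moreover have "real (m * n) \<le> x powr (3 / 4 + \<epsilon>)"
      proof -
        have "real m \<le> x powr c" "real n \<le> x powr (3 / 4 + \<epsilon> / 2)"
          using mn N K by (auto simp: primes_le_def intro: order.trans[OF of_nat_mono])
        hence "real m * real n \<le> x powr c * x powr (3 / 4 + \<epsilon> / 2)" by (intro mult_mono) auto
        also have "\<dots> = x powr (c + (3 / 4 + \<epsilon> / 2))" by (simp add: powr_add)
        also have "\<dots> \<le> x powr (3 / 4 + \<epsilon>)" using x cuv by (intro powr_mono) auto
        finally show ?thesis by simp
      qed
      ultimately show "\<exists>n>0. real n \<le> real p powr (3 / 4 + \<epsilon>) \<and> coprime n p \<and> residue_primroot p (fq p n)"
        unfolding x_def by blast
    qed
  qed
qed

theorem theorem13:
  "\<exists>\<epsilon> :: nat \<Rightarrow> real. \<epsilon> \<longlonglongrightarrow> 0 \<and>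
     (\<forall>p :: nat. prime p \<longrightarrow>
        (\<exists>n :: nat. n > 0 \<and> real n \<le> real p powr (3 / 4 + \<epsilon> p) \<and> coprime n p \<and>
           residue_primroot p (nat (fermat_quotient p (int n)))))"
proof -
  define good where "good = (\<lambda>p n. n > 0 \<and> coprime n p \<and> residue_primroot p (fq p n))"
  define N where "N = (\<lambda>p. LEAST n. good p n)"
  \<comment> \<open>The exponent is read off from the least admissible n. Truncation at 0 means that
    upper bounds for \<open>N p\<close> alone give convergence to 0.\<close>
  define \<epsilon> where "\<epsilon> = (\<lambda>p. if prime p then max 0 (ln (real (N p)) / ln (real p) - 3 / 4) else 0)"
  have N: "good p (N p)" if p: "prime p" for p
  proof -
    obtain g where g: "residue_primroot p g" using prime_primitive_root_exists[of p] p prime_gt_1_nat by auto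
    have "g mod p < p" using p prime_gt_0_nat by simp
    then obtain n where "n > 0" "coprime n p" "fq p n = g mod p" using fq_surjective[OF p] by blast
    hence "good p n" using g by (simp add: good_def)
    thus ?thesis unfolding N_def by (rule LeastI)
  qed
  have "\<epsilon> \<longlonglongrightarrow> 0"
  proof (rule tendstoI)
    fix e :: real assume "e > 0"
    define e' where "e' = min (e / 2) (1 / 4)"
    have e': "0 < e'" "e' \<le> 1 / 4" "e' < e" using \<open>e > 0\<close> by (auto simp: e'_def)
    from eventually_small_fq_primroot[OF e'(1,2)]
    show "\<forall>\<^sub>F p in sequentially. dist (\<epsilon> p) 0 < e"
    proof eventually_elim
      case (elim p)
      show ?case
      proof (cases "prime p")
        case True
        then obtain n where n: "good p n" "real n \<le> real p powr (3 / 4 + e')"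
          using elim by (auto simp: good_def)
        have p1: "real p > 1" using prime_gt_1_nat[OF True] by simp
        have "N p \<le> n" unfolding N_def by (rule Least_le) (rule n)
        hence "real (N p) \<le> real p powr (3 / 4 + e')" using n(2) by linarith
        moreover have "N p > 0" using N[OF True] by (simp add: good_def)
        ultimately have "ln (real (N p)) \<le> ln (real p powr (3 / 4 + e'))"
          using p1 by (subst ln_le_cancel_iff) auto
        also have "\<dots> = (3 / 4 + e') * ln (real p)" using p1 by (simp add: ln_powr)
        finally have "ln (real (N p)) / ln (real p) \<le> 3 / 4 + e'" using p1 by (simp add: pos_divide_le_eq)
        thus ?thesis using True e' by (simp add: \<epsilon>_def)
      qed (use \<open>e > 0\<close> in \<open>simp add: \<epsilon>_def\<close>)
    qed
  qed
  moreover have "real (N p) \<le> real p powr (3 / 4 + \<epsilon> p)" if "prime p" for p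
  proof -
    have p1: "real p > 1" using prime_gt_1_nat[OF that] by simp
    have "N p > 0" using N[OF that] by (simp add: good_def)
    hence "real (N p) = real p powr (ln (real (N p)) / ln (real p))"
      using p1 by (simp add: powr_def)
    also have "\<dots> \<le> real p powr (3 / 4 + \<epsilon> p)"
      using p1 that by (intro powr_mono) (auto simp: \<epsilon>_def)
    finally show ?thesis .
  qed
  ultimately show ?thesis
    using N unfolding good_def fq_def by (intro exI[of _ \<epsilon>]) blast
qed

end
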